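(* Let $b=\{b_k\}_{k\ge 1}$ be a sequence of non-negative real numbers satisfying the Meinardus conditions $(M_1)$, $(M_2)$ and $(M_3)$ (stated in the context), with constants $\rho>0$ and $A>0$ as in $(M_1)$. Let $X_n$ be the size of the largest part of a random $b$-weighted partition of $n$, with distribution $\mathbb{P}=\mathbb{P}_{n,b}$ as defined in the context, and let $$a(n)=\left(\frac{A\,\Gamma(\rho+1)\,\zeta(\rho+1)}{n}\right)^{\frac{1}{\rho+1}},\quad n\ge 1,$$ where $\zeta$ is the Riemann zeta function. Then, for every real $t$, $$\lim_{n\to\infty}\mathbb{P}\bigl(a(n)X_n+\rho\log a(n)-(\rho-1)\log|\log a(n)|-(\rho-1)\log\rho-\log A\le t\bigr)=e^{-e^{-t}}.$$
   Context: Weighted partitions. For a sequence $b=\{b_k\}_{k\ge1}$ of non-negative reals, the numbers $p_b(n)$ are defined by $$f_b(x)=1+\sum_{n\ge1}p_b(n)x^n=\prod_{k\ge1}(1-x^k)^{-b_k},\quad |x|<1.$$ When the $b_k$ are integers, $p_b(n)$ is the number of weighted partitions of $n$, i.e. partitions of $n$ (multisets of parts with total size $n$) in which each part of size $k$ comes in one of $b_k$ possible types; $\mathbb{P}=\mathbb{P}_{n,b}$ is the uniform probability measure on the set of these partitions, and $X_n$ is the size of the largest part. The distribution of $X_n$ is given by $$1+\sum_{n\ge1}p_b(n)\,\mathbb{P}(X_n\le m)\,x^n=\prod_{k=1}^m(1-x^k)^{-b_k},\quad m\ge1.$$ For general non-negative real $b_k$ this identity is taken as the definition of the law of the positive-integer-valued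 random variable $X_n$ (for $n$ with $p_b(n)>0$). Meinardus conditions. Let $D(s)=\sum_{k\ge1}b_kk^{-s}$, $s=\sigma+iy$, and $G(z)=\sum_{k\ge1}b_kz^k$. $(M_1)$ The Dirichlet series $D(s)$ converges in the half-plane $\sigma>\rho>0$, and there is a constant $C_0\in(0,1)$ such that $D(s)$ has an analytic continuation to the half-plane $\{s:\sigma\ge-C_0\}$, on which it is analytic except for a simple pole at $s=\rho$ with residue $A>0$. $(M_2)$ There is a constant $C_1>0$ such that $D(s)=O(|y|^{C_1})$ as $|y|\to\infty$, uniformly for $\sigma\ge-C_0$. $(M_3)$ There are constants $\epsilon>0$ and $C_2=C_2(\epsilon)>0$ such that $g(\tau)=G(e^{-\tau})$, with $\tau=\alpha+2\pi iu$, $u$ real and $\alpha>0$, satisfies $$\Re(g(\tau))-g(\alpha)\le-C_2\alpha^{-\epsilon}\quad\text{whenever } |\arg\tau|>\pi/4,\ 0\ne|u|\le1/2,$$ for all sufficiently small $\alpha>0$. *)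

theory Defs
  imports "HOL-Complex_Analysis.Complex_Analysis" "HOL-Probability.Probability"
begin

text \<open>
  A weight sequence is a function \<open>b :: nat \<Rightarrow> real\<close> of which only the values at
  positive indices are used; products and sums over \<open>k \<ge> 1\<close> are therefore indexed
  by \<open>Suc k\<close>.
\<close>

text \<open>
  For \<open>|x| < 1\<close> the base \<open>1 - x^k\<close> has positive real part, so the principal branch
  of \<open>powr\<close> is the power of \<open>1 - x^k\<close> that is analytic in the unit disc and equal
  to 1 at \<open>x = 0\<close>.
\<close>

definition weighted_gf :: "(nat \<Rightarrow> real) \<Rightarrow> complex \<Rightarrow> complex" where
  "weighted_gf b x = (\<Prod>k. (1 - x ^ Suc k) powr (- of_real (b (Suc k))))"

definition weighted_partitions :: "(nat \<Rightarrow> real) \<Rightarrow> nat \<Rightarrow> real" where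
  "weighted_partitions b n = Re (fps_nth (fps_expansion (weighted_gf b) 0) n)"

text \<open>
  \<open>X n\<close> is a random variable on the probability space \<open>M n\<close>, and its law is specified by
  the generating function identity. Nothing is required of \<open>M n\<close> and \<open>X n\<close>
  if \<open>weighted_partitions b n = 0\<close>: the corresponding summand is then zero.
\<close>

definition largest_part_model ::
    "(nat \<Rightarrow> real) \<Rightarrow> (nat \<Rightarrow> 'a measure) \<Rightarrow> (nat \<Rightarrow> 'a \<Rightarrow> nat) \<Rightarrow> bool" where
  "largest_part_model b M X \<longleftrightarrow>
     (\<forall>n\<ge>1. weighted_partitions b n > 0 \<longrightarrow>
        prob_space (M n) \<and> X n \<in> measurable (M n) (count_space UNIV) \<and>
        (\<forall>\<omega>\<in>space (M n). X n \<omega> \<ge> 1)) \<and>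
     (\<forall>m\<ge>1. \<forall>x::complex. norm x < 1 \<longrightarrow>
        (\<lambda>n. if n = 0 then 1
              else of_real (weighted_partitions b n * \<P>(\<omega> in M n. X n \<omega> \<le> m)) * x ^ n)
          sums (\<Prod>k=1..m. (1 - x ^ k) powr (- of_real (b k))))"

text \<open>
  In the following two conditions \<open>D\<close> is the analytic continuation of the Dirichlet
  series of \<open>b\<close>. Its value at the pole itself is irrelevant.
\<close>

definition meinardus_M1 ::
    "(nat \<Rightarrow> real) \<Rightarrow> real \<Rightarrow> real \<Rightarrow> real \<Rightarrow> (complex \<Rightarrow> complex) \<Rightarrow> bool" where
  "meinardus_M1 b \<rho> A C0 D \<longleftrightarrow>
     \<rho> > 0 \<and> A > 0 \<and> 0 < C0 \<and> C0 < 1 \<and>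
     (\<forall>s. Re s > \<rho> \<longrightarrow>
        (\<lambda>k. of_real (b (Suc k)) * of_nat (Suc k) powr (- s)) sums D s) \<and>
     D analytic_on ({s. Re s \<ge> - C0} - {of_real \<rho>}) \<and>
     is_pole D (of_real \<rho>) \<and> zorder D (of_real \<rho>) = - 1 \<and>
     residue D (of_real \<rho>) = of_real A"

definition meinardus_M2 :: "real \<Rightarrow> (complex \<Rightarrow> complex) \<Rightarrow> bool" where
  "meinardus_M2 C0 D \<longleftrightarrow>
     (\<exists>C1>0. \<exists>K Y. \<forall>s. Re s \<ge> - C0 \<and> \<bar>Im s\<bar> \<ge> Y \<longrightarrow> norm (D s) \<le> K * \<bar>Im s\<bar> powr C1)"

definition weight_series :: "(nat \<Rightarrow> real) \<Rightarrow> complex \<Rightarrow> complex" where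
  "weight_series b z = (\<Sum>k. of_real (b (Suc k)) * z ^ Suc k)"

definition meinardus_M3 :: "(nat \<Rightarrow> real) \<Rightarrow> bool" where
  "meinardus_M3 b \<longleftrightarrow>
     (\<exists>\<epsilon>>0. \<exists>C2>0. eventually (\<lambda>\<alpha>::real. \<forall>u::real.
        (let \<tau> = Complex \<alpha> (2 * pi * u) in
          \<bar>Arg \<tau>\<bar> > pi / 4 \<and> u \<noteq> 0 \<and> \<bar>u\<bar> \<le> 1 / 2 \<longrightarrow>
          Re (weight_series b (exp (- \<tau>))) - Re (weight_series b (exp (- of_real \<alpha>)))
            \<le> - C2 * \<alpha> powr (- \<epsilon>)))
      (at_right 0))"

text \<open>The Riemann zeta function at real arguments \<open>s > 1\<close>.\<close>

definition zeta_real :: "real \<Rightarrow> real" where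
  "zeta_real s = (\<Sum>k. 1 / real (Suc k) powr s)"

definition scaling :: "real \<Rightarrow> real \<Rightarrow> nat \<Rightarrow> real" where
  "scaling \<rho> A n = (A * Gamma (\<rho> + 1) * zeta_real (\<rho> + 1) / real n) powr (1 / (\<rho> + 1))"

end

theory Submission
  imports Defs "HOL-Real_Asymp.Real_Asymp"
begin

text \<open>
  Write \<open>B(x)\<close> for the sum of \<open>b k\<close> over \<open>k \<le> x\<close>. Smoothing \<open>B\<close> with a log-normal kernel of width
  \<open>\<epsilon>\<close> multiplies \<open>D(s)\<close> by \<open>exp (\<epsilon>\<^sup>2 s\<^sup>2 / 2)\<close>, which beats the polynomial growth in \<open>(M\<^sub>2)\<close>, so the line of
  integration can be moved to the left of the pole; letting \<open>\<epsilon>\<close> tend to zero like a power of \<open>x\<close>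
  gives \<open>B(x) = (A/\<rho>) x^\<rho> + O(x^(\<rho> - \<delta>))\<close>. Everything else about \<open>b\<close> follows from this estimate and
  \<open>(M\<^sub>3)\<close>.

  Let \<open>\<alpha>\<^sub>n\<close> be the exact saddle point, the solution of \<open>- (ln f\<^sub>b(e\<^sup>-\<^sup>\<alpha>))' = n\<close>. It satisfies
  \<open>\<alpha>\<^sub>n = a(n) (1 + O(\<alpha>\<^sub>n^\<delta>))\<close>. The event in question is \<open>X\<^sub>n \<le> m\<close> with \<open>m = m\<^sub>n\<close> asymptotic to
  \<open>\<rho> \<bar>ln a(n)\<bar> / a(n)\<close>, and its probability is the quotient of the \<open>n\<close>-th coefficients of
  \<open>f\<^sub>c\<close> and \<open>f\<^sub>b\<close>, where \<open>c\<close> is \<open>b\<close> cut off at \<open>m\<close>. In Cauchy's formula on the circle of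
  radius \<open>e^(-\<alpha>\<^sub>n)\<close> both integrals, rescaled by the order of the standard deviation, converge to the same Gaussian
  integral, because discarding the weights above \<open>m\<close> changes mean and variance negligibly.
  The probability is therefore asymptotic to \<open>f\<^sub>c(e^(-\<alpha>\<^sub>n)) / f\<^sub>b(e^(-\<alpha>\<^sub>n))\<close>, that is, to
  \<open>exp (- T)\<close> where \<open>T\<close> is the sum of \<open>b k e^(-\<alpha>\<^sub>n k)\<close> over \<open>k > m\<close>, and partial summation shows
  that \<open>T\<close> tends to \<open>e\<^sup>-\<^sup>t\<close>.
\<close>

section \<open>Log-normal smoothing of the Dirichlet series\<close>

text \<open>Two features shape the argument. First, the cutoff has \<alpha> m of order \<rho> |ln
  a|, where \<open>exp (- \<alpha> m)\<close> and \<alpha>^(-\<rho>) balance up to powers of the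
  logarithm, and \<alpha> m must be known up to an additive o(1). Replacing the saddle point by a(n)
  costs a relative error times a logarithm, and the increment of B just beyond the cutoff is smaller
  than B by such a factor as well. A bare asymptotic for B does not control either effect; a power
  saving does. Second, both coefficients are taken at the saddle point of b, not each at its own.
  The mean lost by truncation is about 1 / \<alpha> up to logarithms, while the standard deviation
  has order \<alpha>^(-1 - \<rho>/2). The decay away from the real point passes to the truncated
  weights in two ways: off the central arc, truncation lowers the exponent supplied by (M3) by at
  most 2T, which stays bounded; on the arc |\<theta>| \<le> \<alpha>, parts between 1 / (2 \<alpha>)
  and 1 / \<alpha>, which survive truncation, provide the decay.\<close>

lemma integrable_inverse_one_plus_square:
  "integrable lborel (\<lambda>y::real. 1 / (1 + y\<^sup>2))"
  using integrable_inverse_1_plus_square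
  by (simp add: set_integrable_def einterval_eq_UNIV divide_inverse)

text \<open>Cauchy's integral formula on the rectangle with corners \<sigma> - iT and c + iT; its
  horizontal sides have fixed length and an integrand of size O(1 / T^2). The pole is split off as
  the factor \<open>1 / (s - x)\<close>, so f is holomorphic throughout, and the bound is asked for
  only on the two vertical lines and at height at least Y, away from the pole.\<close>

lemma vertical_line_shift:
  fixes f :: "complex \<Rightarrow> complex" and s0 \<sigma> c x C Y :: real
  assumes hol: "f holomorphic_on {s. Re s > s0}" and s: "s0 < \<sigma>" "\<sigma> < x" "x < c"
    and bnd: "\<And>s. \<sigma> \<le> Re s \<Longrightarrow> Re s \<le> c \<Longrightarrow> \<bar>Im s\<bar> \<ge> Y \<or> Re s = \<sigma> \<or> Re s = c \<Longrightarrow>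
                norm (f s / (s - of_real x)) \<le> C / (1 + (Im s)\<^sup>2)"
  shows "integrable lborel (\<lambda>y. f (Complex \<sigma> y) / (Complex \<sigma> y - of_real x))"
    and "integrable lborel (\<lambda>y. f (Complex c y) / (Complex c y - of_real x))"
    and "(\<integral>y. f (Complex c y) / (Complex c y - of_real x) \<partial>lborel)
           - (\<integral>y. f (Complex \<sigma> y) / (Complex \<sigma> y - of_real x) \<partial>lborel) = 2 * pi * f (of_real x)"
proof -
  define q where "q s = f s / (s - of_real x)" for s
  have contq: "continuous_on ({s. Re s > s0} - {of_real x}) q"
    unfolding q_def using hol
    by (intro continuous_intros) (auto intro: holomorphic_on_imp_continuous_on continuous_on_subset)
  have contv: "continuous_on UNIV (\<lambda>y. q (Complex a y))" if "a = \<sigma> \<or> a = c" for a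
  proof (rule continuous_on_compose2[OF contq])
    show "continuous_on UNIV (Complex a)"
      unfolding Complex_eq by (intro continuous_intros)
    show "range (Complex a) \<subseteq> {s. Re s > s0} - {of_real x}"
      using that s by (auto simp: complex_eq_iff)
  qed
  have intv: "integrable lborel (\<lambda>y. q (Complex a y))" if "a = \<sigma> \<or> a = c" for a
  proof (rule Bochner_Integration.integrable_bound)
    show "integrable lborel (\<lambda>y. C * (1 / (1 + y\<^sup>2)))"
      by (intro integrable_mult_right integrable_inverse_one_plus_square)
    show "(\<lambda>y. q (Complex a y)) \<in> borel_measurable lborel"
      using borel_measurable_continuous_onI[OF contv[OF that]] by simp
    show "AE y in lborel. norm (q (Complex a y)) \<le> norm (C * (1 / (1 + y\<^sup>2)))"
    proof (intro AE_I2)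
      fix y
      have "norm (q (Complex a y)) \<le> C / (1 + y\<^sup>2)"
        using bnd[of "Complex a y"] that s by (auto simp: q_def)
      also have "\<dots> \<le> norm (C * (1 / (1 + y\<^sup>2)))"
        by (auto intro!: divide_right_mono)
      finally show "norm (q (Complex a y)) \<le> norm (C * (1 / (1 + y\<^sup>2)))" .
    qed
  qed
  show "integrable lborel (\<lambda>y. f (Complex \<sigma> y) / (Complex \<sigma> y - of_real x))"
    "integrable lborel (\<lambda>y. f (Complex c y) / (Complex c y - of_real x))"
    using intv[of \<sigma>] intv[of c] by (auto simp: q_def)
  have "\<exists>C'\<ge>0. C \<le> C'" by (rule exI[of _ "max C 0"]) auto
  then obtain C' where C': "C' \<ge> 0" "C \<le> C'" by blast
  define I where "I a T = integral {-T..T} (\<lambda>y. q (Complex a y))" for a T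
  have main: "norm (2 * pi * f (of_real x) - (I c T - I \<sigma> T)) \<le> 2 * (c - \<sigma>) * (C' / (1 + T\<^sup>2))"
    if T: "T \<ge> Y" "T \<ge> 1" for T
  proof -
    define a1 a2 a3 a4 where "a1 = Complex \<sigma> (-T)" "a2 = Complex c (-T)" "a3 = Complex c T" "a4 = Complex \<sigma> T"
    note adefs = this
    have pim: "path_image (rectpath a1 a3) \<subseteq> {s. Re s > s0} - {of_real x}"
      using T s by (subst path_image_rectpath) (auto simp: adefs)
    have "(q has_contour_integral (2 * pi * \<i> * winding_number (rectpath a1 a3) (of_real x) * f (of_real x)))
            (rectpath a1 a3)"
      unfolding q_def
    proof (rule Cauchy_integral_formula_convex_simple[OF _ hol])
      show "convex {s. s0 < Re s}" by (rule convex_halfspace_Re_gt)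
      show "of_real x \<in> interior {s. s0 < Re s}"
        using s by (subst interior_open) (auto simp: open_halfspace_Re_gt)
    qed (use pim in auto)
    moreover have "winding_number (rectpath a1 a3) (of_real x) = 1"
      using T s by (intro winding_number_rectpath) (auto simp: adefs in_box_complex_iff)
    ultimately have J: "(q has_contour_integral (2 * pi * \<i> * f (of_real x))) (rectpath a1 a3)" by simp
    have sub: "closed_segment a1 a2 \<subseteq> {s. Re s > s0} - {of_real x}"
       "closed_segment a2 a3 \<subseteq> {s. Re s > s0} - {of_real x}"
       "closed_segment a3 a4 \<subseteq> {s. Re s > s0} - {of_real x}"
       "closed_segment a4 a1 \<subseteq> {s. Re s > s0} - {of_real x}"
      using T s by (auto simp: adefs closed_segment_same_Re closed_segment_same_Im closed_segment_eq_real_ivl)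
    have ci: "q contour_integrable_on linepath a1 a2" "q contour_integrable_on linepath a2 a3"
      "q contour_integrable_on linepath a3 a4" "q contour_integrable_on linepath a4 a1"
      by (intro contour_integrable_continuous_linepath continuous_on_subset[OF contq] sub)+
    have "contour_integral (rectpath a1 a3) q = contour_integral (linepath a1 a2) q
      + (contour_integral (linepath a2 a3) q + (contour_integral (linepath a3 a4) q + contour_integral (linepath a4 a1) q))"
      unfolding rectpath_def Let_def using ci
      by (simp add: adefs contour_integrable_joinI)
    moreover have "contour_integral (linepath a2 a3) q = \<i> * I c T"
      unfolding I_def using T by (intro contour_integral_linepath_same_Re) (auto simp: adefs)
    moreover have "contour_integral (linepath a4 a1) q = - (\<i> * I \<sigma> T)"
    proof -
      have "contour_integral (linepath a4 a1) q = - contour_integral (linepath a1 a4) q"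
        using sub(4) by (intro contour_integral_reverse_linepath continuous_on_subset[OF contq]) 
          (auto simp: closed_segment_commute)
      also have "contour_integral (linepath a1 a4) q = \<i> * I \<sigma> T"
        unfolding I_def using T by (intro contour_integral_linepath_same_Re) (auto simp: adefs)
      finally show ?thesis .
    qed
    moreover have "norm (contour_integral (linepath a1 a2) q) \<le> (C' / (1 + T\<^sup>2)) * norm (a2 - a1)"
    proof (rule contour_integral_bound_linepath[OF ci(1)])
      show "norm (q s) \<le> C' / (1 + T\<^sup>2)" if "s \<in> closed_segment a1 a2" for s
      proof -
        have "\<sigma> \<le> Re s" "Re s \<le> c" "Im s = -T"
          using that s by (auto simp: adefs closed_segment_same_Im closed_segment_eq_real_ivl)
        then have "norm (q s) \<le> C / (1 + T\<^sup>2)" using bnd[of s] T by (auto simp: q_def)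
        also have "\<dots> \<le> C' / (1 + T\<^sup>2)" using C' by (intro divide_right_mono) auto
        finally show ?thesis .
      qed
    qed (use C' in auto)
    moreover have "norm (contour_integral (linepath a3 a4) q) \<le> (C' / (1 + T\<^sup>2)) * norm (a4 - a3)"
    proof (rule contour_integral_bound_linepath[OF ci(3)])
      show "norm (q s) \<le> C' / (1 + T\<^sup>2)" if "s \<in> closed_segment a3 a4" for s
      proof -
        have "\<sigma> \<le> Re s" "Re s \<le> c" "Im s = T"
          using that s by (auto simp: adefs closed_segment_same_Im closed_segment_eq_real_ivl)
        then have "norm (q s) \<le> C / (1 + T\<^sup>2)" using bnd[of s] T by (auto simp: q_def)
        also have "\<dots> \<le> C' / (1 + T\<^sup>2)" using C' by (intro divide_right_mono) auto
        finally show ?thesis .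
      qed
    qed (use C' in auto)
    moreover have "norm (a2 - a1) = c - \<sigma>" "norm (a4 - a3) = c - \<sigma>"
      using s by (auto simp: adefs cmod_def)
    moreover have "contour_integral (rectpath a1 a3) q = 2 * pi * \<i> * f (of_real x)"
      using J by (rule contour_integral_unique)
    ultimately obtain h1 h2 where h: "2 * pi * \<i> * f (of_real x) = h1 + (\<i> * I c T + (h2 + - (\<i> * I \<sigma> T)))"
      "norm h1 \<le> (C' / (1 + T\<^sup>2)) * (c - \<sigma>)" "norm h2 \<le> (C' / (1 + T\<^sup>2)) * (c - \<sigma>)"
      by metis
    have "\<i> * (2 * pi * f (of_real x) - (I c T - I \<sigma> T)) = h1 + h2"
      using h(1) by (simp add: algebra_simps)
    then have "norm (2 * pi * f (of_real x) - (I c T - I \<sigma> T)) = norm (h1 + h2)"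
      by (metis norm_ii norm_mult mult_1)
    also have "\<dots> \<le> norm h1 + norm h2" by (rule norm_triangle_ineq)
    also have "2 * (c - \<sigma>) * (C' / (1 + T\<^sup>2)) = 2 * ((C' / (1 + T\<^sup>2)) * (c - \<sigma>))" by simp
    then have "norm h1 + norm h2 \<le> 2 * (c - \<sigma>) * (C' / (1 + T\<^sup>2))" using h(2,3) by linarith
    finally show ?thesis .
  qed
  have lim: "(\<lambda>n. I a (real n)) \<longlonglongrightarrow> (\<integral>y. q (Complex a y) \<partial>lborel)" if a: "a = \<sigma> \<or> a = c" for a
  proof -
    have "(\<lambda>n. \<integral>y. indicator {- real n..real n} y *\<^sub>R q (Complex a y) \<partial>lborel) \<longlonglongrightarrow> (\<integral>y. q (Complex a y) \<partial>lborel)"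
    proof (rule integral_dominated_convergence)
      show "(\<lambda>y. q (Complex a y)) \<in> borel_measurable lborel"
        using borel_measurable_integrable[OF intv[OF a]] .
      then show "(\<lambda>y. indicator {- real n..real n} y *\<^sub>R q (Complex a y)) \<in> borel_measurable lborel" for n
        by measurable
      show "integrable lborel (\<lambda>y. norm (q (Complex a y)))" using intv[OF a] by simp
      show "AE y in lborel. (\<lambda>n. indicator {- real n..real n} y *\<^sub>R q (Complex a y)) \<longlonglongrightarrow> q (Complex a y)"
      proof (intro AE_I2 tendsto_eventually)
        fix y
        obtain N where N: "real N \<ge> \<bar>y\<bar>" using real_arch_simple by blast
        show "\<forall>\<^sub>F n in sequentially. indicator {- real n..real n} y *\<^sub>R q (Complex a y) = q (Complex a y)"
          using eventually_ge_at_top[of N]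
          by eventually_elim (use N in \<open>auto simp: indicator_def abs_le_iff\<close>)
      qed
    qed (auto simp: indicator_def)
    moreover have "(\<integral>y. indicator {- real n..real n} y *\<^sub>R q (Complex a y) \<partial>lborel) = I a (real n)" for n
    proof -
      have "set_integrable lborel {- real n..real n} (\<lambda>y. q (Complex a y))"
        unfolding set_integrable_def
        by (rule Bochner_Integration.integrable_bound[OF intv[OF a]])
           (use borel_measurable_integrable[OF intv[OF a]] in \<open>auto simp: indicator_def\<close>)
      from set_borel_integral_eq_integral(2)[OF this] show ?thesis
        by (simp add: I_def set_lebesgue_integral_def)
    qed
    ultimately show ?thesis by simp
  qed
  have "(\<lambda>n. 2 * pi * f (of_real x) - (I c (real n) - I \<sigma> (real n))) \<longlonglongrightarrow> 0"
  proof (rule Lim_null_comparison)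
    show "\<forall>\<^sub>F n in sequentially. norm (2 * pi * f (of_real x) - (I c (real n) - I \<sigma> (real n)))
        \<le> 2 * (c - \<sigma>) * (C' / (1 + (real n)\<^sup>2))"
      using eventually_ge_at_top[of "nat \<lceil>max 1 Y\<rceil>"]
      by eventually_elim (intro main; linarith)
    show "(\<lambda>n. 2 * (c - \<sigma>) * (C' / (1 + (real n)\<^sup>2))) \<longlonglongrightarrow> 0"
      by real_asymp
  qed
  moreover have "(\<lambda>n. 2 * pi * f (of_real x) - (I c (real n) - I \<sigma> (real n))) \<longlonglongrightarrow>
     2 * pi * f (of_real x) - ((\<integral>y. q (Complex c y) \<partial>lborel) - (\<integral>y. q (Complex \<sigma> y) \<partial>lborel))"
    by (intro tendsto_intros lim) auto
  ultimately have "0 = 2 * pi * f (of_real x) - ((\<integral>y. q (Complex c y) \<partial>lborel) - (\<integral>y. q (Complex \<sigma> y) \<partial>lborel))"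
    by (rule LIMSEQ_unique)
  then show "(\<integral>y. f (Complex c y) / (Complex c y - of_real x) \<partial>lborel)
           - (\<integral>y. f (Complex \<sigma> y) / (Complex \<sigma> y - of_real x) \<partial>lborel) = 2 * pi * f (of_real x)"
    unfolding q_def by simp
qed

text \<open>Completing the square: with \<open>x = \<epsilon> * y\<close> the integral becomes the
  characteristic function of the standard normal law at t. Up to 2 pi this is Mellin inversion of
  \<open>exp (\<epsilon>^2 s^2 / 2)\<close>; the abscissa c drops out of the value.\<close>

lemma gaussian_vertical_integral:
  fixes v c \<epsilon> :: real
  assumes "\<epsilon> > 0"
  defines "g \<equiv> \<lambda>y. exp (of_real v * Complex c y + of_real (\<epsilon>\<^sup>2) * (Complex c y)\<^sup>2 / 2)"
  shows "integrable lborel g" and "(\<integral>y. g y \<partial>lborel) = of_real (2 * pi * normal_density 0 \<epsilon> v)"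
proof -
  define t where "t = (\<epsilon>\<^sup>2 * c + v) / \<epsilon>"
  define K where "K = exp (\<epsilon>\<^sup>2 * c\<^sup>2 / 2 + v * c) * sqrt (2 * pi)"
  define h where "h x = of_real (std_normal_density x) * exp (\<i> * of_real (t * x))" for x :: real
  have geq: "g y = of_real K * h (0 + \<epsilon> * y)" for y
  proof -
    have "of_real v * Complex c y + of_real (\<epsilon>\<^sup>2) * (Complex c y)\<^sup>2 / 2 =
       of_real (\<epsilon>\<^sup>2 * c\<^sup>2 / 2 + v * c) + (of_real (- (\<epsilon> * y)\<^sup>2 / 2) + \<i> * of_real (t * (\<epsilon> * y)))"
      using assms(1) by (simp add: complex_eq_iff t_def power2_eq_square field_simps)
    then have "g y = exp (of_real (\<epsilon>\<^sup>2 * c\<^sup>2 / 2 + v * c)) *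
        (exp (of_real (- (\<epsilon> * y)\<^sup>2 / 2)) * exp (\<i> * of_real (t * (\<epsilon> * y))))"
      by (simp only: g_def) (simp only: exp_add)
    then show ?thesis
      unfolding h_def K_def std_normal_density_def exp_of_real by simp
  qed
  have hint: "integrable lborel h"
  proof (rule Bochner_Integration.integrable_bound)
    show "integrable lborel (normal_density 0 1)" by simp
    show "h \<in> borel_measurable lborel" unfolding h_def by measurable
    show "AE x in lborel. norm (h x) \<le> norm (std_normal_density x)"
      unfolding h_def by (intro AE_I2) (simp add: norm_mult)
  qed
  have hval: "(\<integral>x. h x \<partial>lborel) = of_real (exp (- (t\<^sup>2) / 2))"
  proof -
    have "(\<integral>x. h x \<partial>lborel) = (\<integral>x. std_normal_density x *\<^sub>R exp (\<i> * of_real (t * x)) \<partial>lborel)"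
      by (simp add: h_def scaleR_conv_of_real)
    also have "\<dots> = char std_normal_distribution t"
      unfolding char_def by (subst integral_density) auto
    finally show ?thesis by (simp add: char_std_normal_distribution)
  qed
  show "integrable lborel g"
    unfolding geq using lborel_integrable_real_affine[OF hint, of \<epsilon> 0] assms(1) by simp
  have "of_real \<epsilon> * (\<integral>y. g y \<partial>lborel) = of_real K * (\<epsilon> *\<^sub>R (\<integral>y. h (0 + \<epsilon> * y) \<partial>lborel))"
    unfolding geq by (simp add: scaleR_conv_of_real)
  also have "\<epsilon> *\<^sub>R (\<integral>y. h (0 + \<epsilon> * y) \<partial>lborel) = (\<integral>x. h x \<partial>lborel)"
    using lborel_integral_real_affine[of \<epsilon> h 0] assms(1) by simp
  also note hval
  also have "of_real K * complex_of_real (exp (- (t\<^sup>2) / 2)) = of_real (\<epsilon> * (2 * pi * normal_density 0 \<epsilon> v))"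
  proof -
    have e: "\<epsilon>\<^sup>2 * c\<^sup>2 / 2 + v * c + - (t\<^sup>2) / 2 = - v\<^sup>2 / (2 * \<epsilon>\<^sup>2)"
      using assms(1) by (simp add: t_def field_simps power2_eq_square)
    have "K * exp (- (t\<^sup>2) / 2) = sqrt (2 * pi) * exp (\<epsilon>\<^sup>2 * c\<^sup>2 / 2 + v * c + - (t\<^sup>2) / 2)"
      unfolding K_def exp_add by simp
    also have "\<dots> = sqrt (2*pi) * exp (- v\<^sup>2 / (2 * \<epsilon>\<^sup>2))" unfolding e ..
    also have "sqrt (2 * pi) = \<epsilon> * (2 * pi) * (1 / sqrt (2 * pi * \<epsilon>\<^sup>2))"
      using assms(1) by (simp add: real_sqrt_mult field_simps)
    finally have "K * exp (- (t\<^sup>2) / 2) = \<epsilon> * (2 * pi * normal_density 0 \<epsilon> v)"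
      by (simp add: normal_density_def)
    then show ?thesis by (simp only: of_real_mult[symmetric])
  qed
  finally show "(\<integral>y. g y \<partial>lborel) = of_real (2 * pi * normal_density 0 \<epsilon> v)"
    using assms(1) by simp
qed

text \<open>The factor k^(-s) merges with \<open>exp (u s)\<close> into
  \<open>exp ((u - ln k) s)\<close>, so every term is a Gaussian integral and yields the kernel
  centred at ln k. Termwise integration is legitimate because |k^(-s)| is constant on a vertical
  line, and with non-negative weights convergence at the real point c is absolute convergence on the
  whole line.\<close>

lemma gaussian_dirichlet_integral:
  fixes b :: "nat \<Rightarrow> real" and c u \<epsilon> :: real and D :: "complex \<Rightarrow> complex"
  assumes nonneg: "\<And>k. k \<ge> 1 \<Longrightarrow> b k \<ge> 0" and eps: "\<epsilon> > 0"
    and D: "\<And>s. Re s = c \<Longrightarrow> (\<lambda>k. of_real (b (Suc k)) * of_nat (Suc k) powr (- s)) sums D s"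
  shows "(\<lambda>k. of_real (2 * pi * (b (Suc k) * normal_density 0 \<epsilon> (u - ln (real (Suc k)))))) sums
     (\<integral>y. D (Complex c y) * exp (of_real u * Complex c y + of_real (\<epsilon>\<^sup>2) * (Complex c y)\<^sup>2 / 2) \<partial>lborel)"
proof -
  define g where "g v y = exp (of_real v * Complex c y + of_real (\<epsilon>\<^sup>2) * (Complex c y)\<^sup>2 / 2)" for v y :: real
  define F where "F k y = of_real (b (Suc k)) * g (u - ln (real (Suc k))) y" for k y
  have Feq: "F k y = (of_real (b (Suc k)) * of_nat (Suc k) powr (- Complex c y)) * g u y" for k y
  proof -
    have "of_nat (Suc k) powr (- Complex c y) = exp (- Complex c y * of_real (ln (real (Suc k))))"
      by (simp add: powr_def Ln_of_nat del: of_nat_Suc)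
    then show ?thesis
      by (simp add: F_def g_def exp_add[symmetric] algebra_simps del: of_nat_Suc)
  qed
  have norm_g: "norm (g v y) = exp (v * c) * norm (g 0 y)" for v y
    by (simp add: g_def norm_mult exp_add)
  have gint: "integrable lborel (g v)" for v
    unfolding g_def[abs_def] by (rule gaussian_vertical_integral(1)[OF eps])
  have norm_F: "norm (F k y) = b (Suc k) * real (Suc k) powr (- c) * (exp (u * c) * norm (g 0 y))" for k y
  proof -
    have "exp ((u - ln (real (Suc k))) * c) = real (Suc k) powr (- c) * exp (u * c)"
      by (simp add: powr_def exp_add[symmetric] algebra_simps del: of_nat_Suc)
    then show ?thesis
      using nonneg[of "Suc k"] unfolding F_def norm_mult norm_g[of "u - _"]
      by (simp del: of_nat_Suc)
  qed
  have "(\<lambda>k. of_real (b (Suc k)) * of_nat (Suc k) powr (- complex_of_real c)) sums D (of_real c)"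
    using D[of "of_real c"] by simp
  moreover have "(\<lambda>k. of_real (b (Suc k)) * of_nat (Suc k) powr (- complex_of_real c)) =
      (\<lambda>k. complex_of_real (b (Suc k) * real (Suc k) powr (- c)))"
  proof
    fix k
    show "of_real (b (Suc k)) * of_nat (Suc k) powr (- complex_of_real c) = 
      complex_of_real (b (Suc k) * real (Suc k) powr (- c))"
      using powr_of_real[of "real (Suc k)" "-c"] by simp
  qed
  ultimately have "summable (\<lambda>k. complex_of_real (b (Suc k) * real (Suc k) powr (- c)))"
    by (simp only: sums_summable)
  then have summ: "summable (\<lambda>k. b (Suc k) * real (Suc k) powr (- c))"
    using summable_of_real_iff by blast
  have Fint: "integrable lborel (F k)" for k
    unfolding F_def[abs_def] using gint by simp
  have "(\<lambda>k. integral\<^sup>L lborel (F k)) sums (\<integral>y. (\<Sum>k. F k y) \<partial>lborel)"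
  proof (rule sums_integral[OF Fint])
    show "AE y in lborel. summable (\<lambda>k. norm (F k y))"
      unfolding norm_F by (intro AE_I2 summable_mult2 summ)
    show "summable (\<lambda>k. \<integral>y. norm (F k y) \<partial>lborel)"
      unfolding norm_F using summ by (simp add: summable_mult2)
  qed
  moreover have "integral\<^sup>L lborel (F k) = of_real (2 * pi * (b (Suc k) * normal_density 0 \<epsilon> (u - ln (real (Suc k)))))" for k
  proof -
    have "integral\<^sup>L lborel (F k) = of_real (b (Suc k)) * (\<integral>y. g (u - ln (real (Suc k))) y \<partial>lborel)"
      unfolding F_def[abs_def] by (rule integral_mult_right_zero)
    also have "(\<integral>y. g (u - ln (real (Suc k))) y \<partial>lborel) = of_real (2 * pi * normal_density 0 \<epsilon> (u - ln (real (Suc k))))"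
      unfolding g_def[abs_def] by (rule gaussian_vertical_integral(2)[OF eps])
    finally show ?thesis by (simp add: mult_ac del: of_nat_Suc)
  qed
  moreover have "(\<Sum>k. F k y) = D (Complex c y) * g u y" for y
  proof -
    have "(\<lambda>k. F k y) sums (D (Complex c y) * g u y)"
      unfolding Feq by (intro sums_mult2 D) simp
    then show ?thesis by (simp add: sums_iff)
  qed
  ultimately show ?thesis by (simp add: g_def)
qed

lemma power_le_fact_exp:
  fixes x :: real assumes "x \<ge> 0"
  shows "x ^ n \<le> fact n * exp x"
proof -
  have "(\<lambda>n. x ^ n /\<^sub>R fact n) sums exp x" by (rule exp_converges)
  then have "(\<Sum>i\<in>{n}. x ^ i /\<^sub>R fact i) \<le> exp x"
    using assms by (intro sum_le_suminf[of _ "{n}", THEN order_trans]) (auto simp: sums_iff)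
  then show ?thesis by (simp add: field_simps)
qed

text \<open>One power more than N is spent: bounding w^(N+1) for w = \<epsilon>^2 (1 + y^2) by a
  multiple of \<open>exp (w / 2)\<close> leaves the integrable factor 1 / (1 + y^2), at the price of
  a negative power of \<epsilon>.\<close>

lemma power_times_gaussian_le:
  fixes \<epsilon> y :: real
  assumes "0 < \<epsilon>" "\<epsilon> \<le> 1"
  shows "(1 + y\<^sup>2) ^ N * exp (- (\<epsilon>\<^sup>2 * y\<^sup>2 / 2)) \<le> 2 * 2 ^ (N + 1) * fact (N + 1) / \<epsilon> ^ (2 * N + 2) / (1 + y\<^sup>2)"
proof -
  define w where "w = \<epsilon>\<^sup>2 * (1 + y\<^sup>2)"
  have y1: "1 + y\<^sup>2 > 0" by (simp add: add_pos_nonneg)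
  have "w ^ (N+1) = 2 ^ (N+1) * (w / 2) ^ (N+1)"
    unfolding power_mult_distrib[symmetric] by simp
  also have "\<dots> \<le> 2 ^ (N + 1) * (fact (N+1) * exp (w / 2))"
    using y1 by (intro mult_left_mono power_le_fact_exp) (auto simp: w_def)
  finally have "w ^ (N+1) * exp (- (\<epsilon>\<^sup>2 * y\<^sup>2 / 2)) \<le> 2 ^ (N + 1) * (fact (N+1) * exp (w / 2)) * exp (- (\<epsilon>\<^sup>2 * y\<^sup>2 / 2))"
    by (rule mult_right_mono) simp
  also have "\<dots> = 2 ^ (N + 1) * fact (N+1) * exp (\<epsilon>\<^sup>2 / 2)"
    by (simp add: w_def exp_add[symmetric] algebra_simps add_divide_distrib)
  also have "exp (\<epsilon>\<^sup>2 / 2) \<le> 2"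
  proof -
    have "\<epsilon>\<^sup>2 \<le> 1" using assms by (simp add: power_le_one)
    have "exp (\<epsilon>\<^sup>2 / 2) \<le> exp (1 / 2)" using \<open>\<epsilon>\<^sup>2 \<le> 1\<close> by simp
    also have "\<dots> \<le> 1 + 1 / 2 + (1 / 2)\<^sup>2" by (rule exp_bound) auto
    finally show ?thesis by (simp add: power2_eq_square)
  qed
  finally have "w ^ (N+1) * exp (- (\<epsilon>\<^sup>2 * y\<^sup>2 / 2)) \<le> 2 * 2 ^ (N + 1) * fact (N+1)"
    by simp
  moreover have "w ^ (N+1) = \<epsilon> ^ (2 * N + 2) * ((1 + y\<^sup>2) ^ N * (1 + y\<^sup>2))"
    unfolding w_def power_mult_distrib power_mult[symmetric] by simp
  ultimately have "(1 + y\<^sup>2) ^ N * exp (- (\<epsilon>\<^sup>2 * y\<^sup>2 / 2)) * (1 + y\<^sup>2) * \<epsilon> ^ (2 * N + 2) \<le> 2 * 2 ^ (N + 1) * fact (N + 1)"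
    by (simp only: mult_ac)
  moreover have "\<epsilon> ^ (2 * N + 2) > 0" using assms by simp
  ultimately show ?thesis
    using y1 by (simp only: pos_le_divide_eq)
qed

section \<open>Continuation and growth of the Dirichlet series; the shifted line\<close>

locale meinardus_dirichlet =
  fixes b :: "nat \<Rightarrow> real" and \<rho> A C0 :: real and D :: "complex \<Rightarrow> complex"
  assumes weight_nonneg: "\<And>k. k \<ge> 1 \<Longrightarrow> b k \<ge> 0"
    and M1: "meinardus_M1 b \<rho> A C0 D"
    and M2: "meinardus_M2 C0 D"
begin

lemma rho_pos: "\<rho> > 0" and A_pos: "A > 0" and C0_pos: "C0 > 0"
  using M1 by (auto simp: meinardus_M1_def)

lemma dirichlet_sums:
  "Re s > \<rho> \<Longrightarrow> (\<lambda>k. of_real (b (Suc k)) * of_nat (Suc k) powr (- s)) sums D s"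
  using M1 by (auto simp: meinardus_M1_def)

lemma D_analytic: "D analytic_on ({s. Re s \<ge> - C0} - {of_real \<rho>})"
  using M1 by (auto simp: meinardus_M1_def)

text \<open>Turns order and residue into a limit: at a simple pole the residue is the value of
  \<open>zor_poly\<close>, which is continuous there.\<close>

lemma D_pole_limit: "((\<lambda>s. D s * (s - of_real \<rho>)) \<longlongrightarrow> of_real A) (at (of_real \<rho>))"
proof -
  have hol: "D holomorphic_on ball (of_real \<rho>) \<rho> - {of_real \<rho>}"
  proof (rule analytic_imp_holomorphic[OF analytic_on_subset[OF D_analytic]], safe)
    fix s :: complex assume s: "s \<in> ball (of_real \<rho>) \<rho>"
    have "\<bar>Re (of_real \<rho> - s)\<bar> < \<rho>" using s abs_Re_le_cmod[of "of_real \<rho> - s"] by (auto simp: dist_norm)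
    then show "- C0 \<le> Re s" using C0_pos by simp
  qed
  have iso: "isolated_singularity_at D (of_real \<rho>)"
    using hol rho_pos by (intro isolated_singularity_at_holomorphic[of _ "ball (of_real \<rho>) \<rho>"]) auto
  have pole: "is_pole D (of_real \<rho>)" "zorder D (of_real \<rho>) = - 1" "residue D (of_real \<rho>) = of_real A"
    using M1 by (auto simp: meinardus_M1_def)
  have "zor_poly D (of_real \<rho>) (of_real \<rho>) = of_real A"
    using residue_simple_pole[OF iso pole(1,2)] pole(3) by simp
  moreover have "isCont (zor_poly D (of_real \<rho>)) (of_real \<rho>)"
  proof -
    obtain e where "e > 0" "zor_poly D (of_real \<rho>) holomorphic_on cball (of_real \<rho>) e"
      using zorder_exist_pole[OF hol] rho_pos pole by auto
    then show ?thesis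
      by (metis centre_in_ball continuous_on_eq_continuous_at holomorphic_on_imp_continuous_on 
          ball_subset_cball continuous_on_subset open_ball)
  qed
  ultimately have "(zor_poly D (of_real \<rho>) \<longlongrightarrow> of_real A) (at (of_real \<rho>))"
    by (simp add: isCont_def)
  then show ?thesis
    using zor_poly_pole_eq[OF iso pole(1)] pole(2)
    by (rule_tac Lim_transform_eventually) (auto elim!: eventually_mono)
qed

text \<open>Riemann's theorem on removable singularities. This function, times the Gaussian kernel,
  is the f to which \<open>vertical_line_shift\<close> is applied with x = \<rho>.\<close>

lemma D_times_holomorphic:
  "(\<lambda>s. if s = of_real \<rho> then of_real A else D s * (s - of_real \<rho>)) holomorphic_on {s. Re s > 0}"
proof (rule no_isolated_singularity'[where K = "{of_real \<rho>}"])
  show "open {s. Re s > 0}" by (rule open_halfspace_Re_gt)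
  have "(\<lambda>s. D s * (s - of_real \<rho>)) holomorphic_on {s. Re s > 0} - {of_real \<rho>}"
    using C0_pos by (intro holomorphic_intros analytic_imp_holomorphic[OF analytic_on_subset[OF D_analytic]]) auto
  then show "(\<lambda>s. if s = of_real \<rho> then of_real A else D s * (s - of_real \<rho>)) holomorphic_on {s. Re s > 0} - {of_real \<rho>}"
    by (rule holomorphic_transform) auto
  fix z :: complex assume "z \<in> {of_real \<rho>}"
  then have z: "z = of_real \<rho>" by simp
  have "((\<lambda>s. if s = of_real \<rho> then of_real A else D s * (s - of_real \<rho>)) \<longlongrightarrow> of_real A) (at (of_real \<rho>))"
    by (rule Lim_transform_eventually[OF D_pole_limit]) (auto simp: eventually_at_filter)
  then show "((\<lambda>s. if s = of_real \<rho> then of_real A else D s * (s - of_real \<rho>)) \<longlongrightarrow>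
      (if z = of_real \<rho> then of_real A else D z * (z - of_real \<rho>))) (at z within {s. Re s > 0})"
    using z by (auto intro: tendsto_mono[OF at_le[OF subset_UNIV]])
qed auto

text \<open>The shape \<open>(1 + y^2) ^ N\<close> with a natural exponent fits
  \<open>power_times_gaussian_le\<close>. High up the bound is (M2); the bounded pieces of the two
  lines that the shift uses, Re s = \<rho> / 2 and Re s = \<rho> + 1, miss the pole and are handled
  by compactness.\<close>

lemma D_strip_bound:
  "\<exists>K::real. \<exists>N::nat. \<exists>Y::real. K \<ge> 0 \<and>
     (\<forall>s. \<rho> / 2 \<le> Re s \<longrightarrow> \<bar>Im s\<bar> \<ge> Y \<or> Re s = \<rho> / 2 \<or> Re s = \<rho> + 1 \<longrightarrow>
       norm (D s) \<le> K * (1 + (Im s)\<^sup>2) ^ N)"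
proof -
  obtain C1 K0 Y0 where C1: "C1 > 0"
    and K0: "\<And>s. Re s \<ge> - C0 \<Longrightarrow> \<bar>Im s\<bar> \<ge> Y0 \<Longrightarrow> norm (D s) \<le> K0 * \<bar>Im s\<bar> powr C1"
    using M2 unfolding meinardus_M2_def by blast
  define Y where "Y = max Y0 1"
  define N where "N = nat \<lceil>C1\<rceil>"
  have far: "norm (D s) \<le> \<bar>K0\<bar> * (1 + (Im s)\<^sup>2) ^ N" if "\<rho> / 2 \<le> Re s" "\<bar>Im s\<bar> \<ge> Y" for s
  proof -
    have "norm (D s) \<le> K0 * \<bar>Im s\<bar> powr C1"
      using that rho_pos C0_pos by (intro K0) (auto simp: Y_def)
    also have "\<dots> \<le> \<bar>K0\<bar> * \<bar>Im s\<bar> powr C1" by (intro mult_right_mono) auto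
    also have "\<bar>Im s\<bar> powr C1 \<le> \<bar>Im s\<bar> powr (real N)"
      using that C1 by (intro powr_mono) (auto simp: Y_def N_def)
    also have "\<dots> = \<bar>Im s\<bar> ^ N" using that by (subst powr_realpow) (auto simp: Y_def)
    also have "\<dots> \<le> (1 + (Im s)\<^sup>2) ^ N"
    proof (rule power_mono)
      have "\<bar>Im s\<bar> \<le> \<bar>Im s\<bar>^2" using that self_le_power[of "\<bar>Im s\<bar>" 2] by (auto simp: Y_def)
      then show "\<bar>Im s\<bar> \<le> 1 + (Im s)\<^sup>2" by simp
    qed auto
    finally show ?thesis by (simp add: mult_left_mono)
  qed
  have near: "\<exists>B\<ge>0. \<forall>y\<in>{-Y..Y}. norm (D (Complex a y)) \<le> B" if "a = \<rho> / 2 \<or> a = \<rho> + 1" for a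
  proof -
    have "continuous_on {-Y..Y} (\<lambda>y. D (Complex a y))"
    proof (rule continuous_on_compose2[of "{s. Re s \<ge> - C0} - {of_real \<rho>}" D])
      show "continuous_on ({s. Re s \<ge> - C0} - {of_real \<rho>}) D"
        using D_analytic analytic_imp_holomorphic holomorphic_on_imp_continuous_on by blast
      show "continuous_on {-Y..Y} (Complex a)" unfolding Complex_eq by (intro continuous_intros)
      show "Complex a ` {-Y..Y} \<subseteq> {s. Re s \<ge> - C0} - {of_real \<rho>}"
        using that rho_pos C0_pos by (auto simp: complex_eq_iff)
    qed
    then have "compact ((\<lambda>y. D (Complex a y)) ` {-Y..Y})"
      by (intro compact_continuous_image) auto
    then obtain B where "B > 0" "\<forall>x\<in>(\<lambda>y. D (Complex a y)) ` {-Y..Y}. norm x \<le> B"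
      using compact_imp_bounded bounded_pos by blast
    then show ?thesis by (intro exI[of _ B]) auto
  qed
  from near[of "\<rho> / 2"] near[of "\<rho> + 1"] obtain B1 B2 where B: "B1 \<ge> 0" "B2 \<ge> 0"
     "\<And>y. \<bar>y\<bar> \<le> Y \<Longrightarrow> norm (D (Complex (\<rho> / 2) y)) \<le> B1"
     "\<And>y. \<bar>y\<bar> \<le> Y \<Longrightarrow> norm (D (Complex (\<rho> + 1) y)) \<le> B2"
    by (auto simp: abs_le_iff)
  show ?thesis
  proof (rule exI[of _ "\<bar>K0\<bar> + B1 + B2"], rule exI[of _ N], rule exI[of _ Y], intro conjI allI impI)
    fix s assume s: "\<rho> / 2 \<le> Re s" "\<bar>Im s\<bar> \<ge> Y \<or> Re s = \<rho> / 2 \<or> Re s = \<rho> + 1"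
    have one: "1 \<le> (1 + (Im s)\<^sup>2) ^ N" by (intro one_le_power) auto
    have "norm (D s) \<le> \<bar>K0\<bar> * (1 + (Im s)\<^sup>2) ^ N \<or> norm (D s) \<le> B1 * 1 \<or> norm (D s) \<le> B2 * 1"
    proof (cases "Y \<le> \<bar>Im s\<bar>")
      case False
      have "norm (D s) \<le> B1" if "Re s = \<rho> / 2"
      proof -
        have "Complex (\<rho> / 2) (Im s) = s" using that by (simp add: complex_eq_iff)
        then show ?thesis using B(3)[of "Im s"] False by simp
      qed
      moreover have "norm (D s) \<le> B2" if "Re s = \<rho> + 1"
      proof -
        have "Complex (\<rho> + 1) (Im s) = s" using that by (simp add: complex_eq_iff)
        then show ?thesis using B(4)[of "Im s"] False by simp
      qed
      ultimately show ?thesis using s(2) False by auto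
    qed (use far[OF s(1)] in auto)
    moreover have "B1 * 1 \<le> B1 * (1 + (Im s)\<^sup>2) ^ N" "B2 * 1 \<le> B2 * (1 + (Im s)\<^sup>2) ^ N"
      "\<bar>K0\<bar> * (1 + (Im s)\<^sup>2) ^ N \<ge> 0"
      using mult_left_mono[OF one B(1)] mult_left_mono[OF one B(2)] by simp_all
    moreover have "B1 * (1 + (Im s)\<^sup>2) ^ N \<ge> 0" "B2 * (1 + (Im s)\<^sup>2) ^ N \<ge> 0" using B by auto
    ultimately show "norm (D s) \<le> (\<bar>K0\<bar> + B1 + B2) * (1 + (Im s)\<^sup>2) ^ N"
      unfolding distrib_right by linarith
  qed (use B in auto)
qed

text \<open>The line \<rho> + 1 lies in the half-plane of convergence and carries the smoothed sum.
  Moving it to \<rho> / 2 crosses only the pole at \<rho>, whose residue is the main term; the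
  remaining integral has half the exponent of the main term and a power of 1 / \<epsilon> from the
  Gaussian bound.\<close>

lemma smoothed_sum_bound:
  "\<exists>(C::real) (m::nat). C \<ge> 0 \<and> (\<forall>u \<epsilon>. 0 < \<epsilon> \<longrightarrow> \<epsilon> \<le> 1 \<longrightarrow>
     (\<exists>V. (\<lambda>k. b (Suc k) * normal_density 0 \<epsilon> (u - ln (real (Suc k)))) sums V \<and>
        \<bar>V - A * exp (\<rho> * u + \<epsilon>\<^sup>2 * \<rho>\<^sup>2 / 2)\<bar> \<le> C * exp (\<rho> * u / 2) / \<epsilon> ^ m))"
proof -
  obtain K :: real and N :: nat and Y :: real where K: "K \<ge> 0"
    "\<And>s. \<rho> / 2 \<le> Re s \<Longrightarrow> \<bar>Im s\<bar> \<ge> Y \<or> Re s = \<rho> / 2 \<or> Re s = \<rho> + 1 \<Longrightarrow>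
       norm (D s) \<le> K * (1 + (Im s)\<^sup>2) ^ N"
    using D_strip_bound by auto
  define G :: real where "G = 2 * 2 ^ (N + 1) * fact (N + 1)"
  define P where "P = (\<integral>y. 1 / (1 + y\<^sup>2) \<partial>(lborel :: real measure))"
  define F where "F s = (if s = of_real \<rho> then of_real A else D s * (s - of_real \<rho>))" for s
  have P: "P \<ge> 0" unfolding P_def by (intro integral_nonneg_AE AE_I2) (simp add: add_nonneg_nonneg)
  have G: "G \<ge> 0" by (simp add: G_def)
  show ?thesis
  proof (rule exI[of _ "K * exp (\<rho>\<^sup>2 / 8) * G * P / (2 * pi)"], rule exI[of _ "2 * N + 2"], intro conjI allI impI)
    fix u \<epsilon> :: real assume eps: "0 < \<epsilon>" "\<epsilon> \<le> 1"
    define h where "h s = exp (of_real u * s + of_real (\<epsilon>\<^sup>2) * s\<^sup>2 / 2)" for s :: complex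
    have norm_h: "norm (h s) = exp (u * Re s + \<epsilon>\<^sup>2 * (Re s)\<^sup>2 / 2) * exp (- (\<epsilon>\<^sup>2 * (Im s)\<^sup>2 / 2))" for s
      by (simp add: h_def exp_add[symmetric] Re_power2 diff_divide_distrib right_diff_distrib)
    have Dh: "norm (D s * h s) \<le> K * exp (u * Re s + \<epsilon>\<^sup>2 * (Re s)\<^sup>2 / 2) * (G / \<epsilon> ^ (2 * N + 2)) / (1 + (Im s)\<^sup>2)"
      if s: "\<rho> / 2 \<le> Re s" "\<bar>Im s\<bar> \<ge> Y \<or> Re s = \<rho> / 2 \<or> Re s = \<rho> + 1" for s
    proof -
      have "norm (D s * h s) \<le> (K * (1 + (Im s)\<^sup>2) ^ N) * norm (h s)"
        unfolding norm_mult by (intro mult_right_mono K(2) s) auto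
      also have "\<dots> = K * exp (u * Re s + \<epsilon>\<^sup>2 * (Re s)\<^sup>2 / 2) * ((1 + (Im s)\<^sup>2) ^ N * exp (- (\<epsilon>\<^sup>2 * (Im s)\<^sup>2 / 2)))"
        by (simp add: norm_h mult_ac)
      also have "\<dots> \<le> K * exp (u * Re s + \<epsilon>\<^sup>2 * (Re s)\<^sup>2 / 2) * (G / \<epsilon> ^ (2 * N + 2) / (1 + (Im s)\<^sup>2))"
        unfolding G_def by (intro mult_left_mono power_times_gaussian_le eps) (use K in auto)
      finally show ?thesis by simp
    qed
    have quot: "F s * h s / (s - of_real \<rho>) = D s * h s" if "s \<noteq> of_real \<rho>" for s
      using that by (simp add: F_def)
    \<comment> \<open>Only the finiteness of this constant matters, since it serves to justify the
      shift. It may depend on u: |u| (\<rho> + 1) dominates u Re s over the whole strip for either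
      sign of u. The quantitative estimate comes from \<open>Dh\<close> on the line \<rho> /
      2.\<close>
    define CC where "CC = K * exp (\<bar>u\<bar> * (\<rho> + 1) + \<epsilon>\<^sup>2 * (\<rho> + 1)\<^sup>2 / 2) * (G / \<epsilon> ^ (2 * N + 2))"
    have hol: "(\<lambda>s. F s * h s) holomorphic_on {s. Re s > 0}"
      unfolding F_def h_def by (intro holomorphic_on_mult D_times_holomorphic holomorphic_intros) auto
    have bnd: "norm (F s * h s / (s - of_real \<rho>)) \<le> CC / (1 + (Im s)\<^sup>2)"
      if s: "\<rho> / 2 \<le> Re s" "Re s \<le> \<rho> + 1" "\<bar>Im s\<bar> \<ge> max Y 1 \<or> Re s = \<rho> / 2 \<or> Re s = \<rho> + 1" for s
    proof -
      have "s \<noteq> of_real \<rho>" using s rho_pos by auto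
      then have "norm (F s * h s / (s - of_real \<rho>)) = norm (D s * h s)" by (simp add: quot)
      also have "\<dots> \<le> K * exp (u * Re s + \<epsilon>\<^sup>2 * (Re s)\<^sup>2 / 2) * (G / \<epsilon> ^ (2 * N + 2)) / (1 + (Im s)\<^sup>2)"
        using s by (intro Dh) auto
      also have "\<dots> \<le> CC / (1 + (Im s)\<^sup>2)"
        unfolding CC_def
      proof (intro divide_right_mono mult_right_mono mult_left_mono, unfold exp_le_cancel_iff)
        have "u * Re s \<le> \<bar>u\<bar> * (\<rho> + 1)" using s rho_pos by (intro mult_mono) auto
        moreover have "(Re s)\<^sup>2 \<le> (\<rho> + 1)\<^sup>2" using s rho_pos by (intro power_mono) auto
        then have "\<epsilon>\<^sup>2 * (Re s)\<^sup>2 \<le> \<epsilon>\<^sup>2 * (\<rho> + 1)\<^sup>2" by (intro mult_left_mono) auto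
        ultimately show "u * Re s + \<epsilon>\<^sup>2 * (Re s)\<^sup>2 / 2 \<le> \<bar>u\<bar> * (\<rho> + 1) + \<epsilon>\<^sup>2 * (\<rho> + 1)\<^sup>2 / 2" by simp
      qed (use K G eps in auto)
      finally show ?thesis .
    qed
    define J where "J a = (\<integral>y. D (Complex a y) * h (Complex a y) \<partial>lborel)" for a
    have Jeq: "(\<integral>y. F (Complex a y) * h (Complex a y) / (Complex a y - of_real \<rho>) \<partial>lborel) = J a" if "a \<noteq> \<rho>" for a
      unfolding J_def using that by (intro Bochner_Integration.integral_cong refl quot) (auto simp: complex_eq_iff)
    have order: "0 < \<rho> / 2" "\<rho> / 2 < \<rho>" "\<rho> < \<rho> + 1" using rho_pos by auto
    note line_shift = vertical_line_shift[where Y = "max Y 1", OF hol order bnd]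
    have shift: "J (\<rho> + 1) - J (\<rho> / 2) = 2 * pi * (F (of_real \<rho>) * h (of_real \<rho>))"
      using line_shift(3) Jeq[of "\<rho> + 1"] Jeq[of "\<rho> / 2"] order by simp
    have J2: "norm (J (\<rho> / 2)) \<le> K * exp (u * (\<rho> / 2) + \<epsilon>\<^sup>2 * (\<rho> / 2)\<^sup>2 / 2) * (G / \<epsilon> ^ (2 * N + 2)) * P"
    proof -
      have "norm (J (\<rho> / 2)) \<le> (\<integral>y. K * exp (u * (\<rho> / 2) + \<epsilon>\<^sup>2 * (\<rho> / 2)\<^sup>2 / 2) * (G / \<epsilon> ^ (2 * N + 2)) * (1 / (1 + y\<^sup>2)) \<partial>lborel)"
        unfolding J_def
      proof (rule Bochner_Integration.integral_norm_bound_integral)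
        have "(\<lambda>y. F (Complex (\<rho>/2) y) * h (Complex (\<rho>/2) y) / (Complex (\<rho>/2) y - of_real \<rho>)) =
            (\<lambda>y. D (Complex (\<rho>/2) y) * h (Complex (\<rho>/2) y))"
          using rho_pos by (intro ext quot) (simp add: complex_eq_iff)
        with line_shift(1) show "integrable lborel (\<lambda>y. D (Complex (\<rho>/2) y) * h (Complex (\<rho>/2) y))"
          by (simp only:)
        show "norm (D (Complex (\<rho>/2) y) * h (Complex (\<rho>/2) y)) \<le> K * exp (u * (\<rho> / 2) + \<epsilon>\<^sup>2 * (\<rho> / 2)\<^sup>2 / 2) * (G / \<epsilon> ^ (2 * N + 2)) * (1 / (1 + y\<^sup>2))" for y
          using Dh[of "Complex (\<rho>/2) y"] by simp
      qed (intro integrable_mult_right integrable_inverse_one_plus_square)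
      then show ?thesis unfolding P_def by (simp only: integral_mult_right_zero)
    qed
    \<comment> \<open>Here \<epsilon> \<le> 1 enters: it bounds the factor
      \<open>exp (\<epsilon>^2 (\<rho> / 2)^2 / 2)\<close> by
      \<open>exp (\<rho>^2 / 8)\<close>.\<close>
    also have "\<dots> \<le> K * (exp (\<rho> * u / 2) * exp (\<rho>\<^sup>2 / 8)) * (G / \<epsilon> ^ (2 * N + 2)) * P"
    proof (intro mult_right_mono mult_left_mono)
      have "\<epsilon>\<^sup>2 * (\<rho> / 2)\<^sup>2 \<le> 1 * (\<rho> / 2)\<^sup>2" using eps by (intro mult_right_mono) (auto simp: power_le_one)
      then show "exp (u * (\<rho> / 2) + \<epsilon>\<^sup>2 * (\<rho> / 2)\<^sup>2 / 2) \<le> exp (\<rho> * u / 2) * exp (\<rho>\<^sup>2 / 8)"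
        unfolding exp_add[symmetric] exp_le_cancel_iff by (simp add: power_divide mult.commute)
    qed (use K G P eps in auto)
    finally have J2: "norm (J (\<rho> / 2)) \<le> \<dots>" .
    define t where "t k = b (Suc k) * normal_density 0 \<epsilon> (u - ln (real (Suc k)))" for k
    have "(\<lambda>k. of_real (2 * pi * t k)) sums J (\<rho> + 1)"
      unfolding t_def J_def h_def
      by (rule gaussian_dirichlet_integral[OF weight_nonneg eps(1) dirichlet_sums]) auto
    then have sm: "(\<lambda>k. complex_of_real (2 * pi * t k)) sums J (\<rho> + 1)" .
    define R where "R = Re (J (\<rho> + 1))"
    \<comment> \<open>The series on the line \<rho> + 1 has real terms, so the integral there is
      real and the estimate can be stated over the reals.\<close>
    have R: "(\<lambda>k. 2 * pi * t k) sums R" "J (\<rho> + 1) = of_real R"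
    proof -
      show "(\<lambda>k. 2 * pi * t k) sums R" using sums_Re[OF sm] by (simp only: R_def Re_complex_of_real)
      have "(\<lambda>k::nat. 0::real) sums Im (J (\<rho> + 1))" using sums_Im[OF sm] by (simp only: Im_complex_of_real)
      then have "Im (J (\<rho> + 1)) = 0" using sums_zero sums_unique2 by blast
      then show "J (\<rho> + 1) = of_real R" by (simp add: R_def complex_eq_iff)
    qed
    have "t sums (R / (2 * pi))"
      using sums_divide[OF R(1), of "2 * pi"] by simp
    moreover have "\<bar>R / (2 * pi) - A * exp (\<rho> * u + \<epsilon>\<^sup>2 * \<rho>\<^sup>2 / 2)\<bar> \<le> K * exp (\<rho>\<^sup>2 / 8) * G * P / (2 * pi) * exp (\<rho> * u / 2) / \<epsilon> ^ (2 * N + 2)"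
    proof -
      have "h (of_real \<rho>) = exp (of_real (\<rho> * u + \<epsilon>\<^sup>2 * \<rho>\<^sup>2 / 2))"
        by (simp add: h_def mult.commute)
      then have "F (of_real \<rho>) * h (of_real \<rho>) = of_real (A * exp (\<rho> * u + \<epsilon>\<^sup>2 * \<rho>\<^sup>2 / 2))"
        by (simp only: F_def exp_of_real of_real_mult simp_thms if_True)
      then have "J (\<rho> / 2) = of_real R - of_real (2 * pi) * of_real (A * exp (\<rho> * u + \<epsilon>\<^sup>2 * \<rho>\<^sup>2 / 2))"
        using shift unfolding R(2) by (simp only: diff_eq_eq eq_diff_eq add.commute)
      then have "J (\<rho> / 2) = of_real (R - 2 * pi * (A * exp (\<rho> * u + \<epsilon>\<^sup>2 * \<rho>\<^sup>2 / 2)))"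
        by (simp only: of_real_mult of_real_diff)
      then have "norm (J (\<rho> / 2)) = \<bar>R - 2 * pi * (A * exp (\<rho> * u + \<epsilon>\<^sup>2 * \<rho>\<^sup>2 / 2))\<bar>"
        by (simp only: norm_of_real)
      then have "\<bar>R - 2 * pi * (A * exp (\<rho> * u + \<epsilon>\<^sup>2 * \<rho>\<^sup>2 / 2))\<bar> \<le> K * (exp (\<rho> * u / 2) * exp (\<rho>\<^sup>2 / 8)) * (G / \<epsilon> ^ (2 * N + 2)) * P"
        using J2 by (simp only:)
      then have "\<bar>R - 2 * pi * (A * exp (\<rho> * u + \<epsilon>\<^sup>2 * \<rho>\<^sup>2 / 2))\<bar> / (2 * pi) \<le> K * (exp (\<rho> * u / 2) * exp (\<rho>\<^sup>2 / 8)) * (G / \<epsilon> ^ (2 * N + 2)) * P / (2 * pi)"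
        by (rule divide_right_mono) simp
      moreover have "\<bar>R - 2 * pi * (A * exp (\<rho> * u + \<epsilon>\<^sup>2 * \<rho>\<^sup>2 / 2))\<bar> / (2 * pi) = \<bar>(R - 2 * pi * (A * exp (\<rho> * u + \<epsilon>\<^sup>2 * \<rho>\<^sup>2 / 2))) / (2 * pi)\<bar>"
        by simp
      moreover have "(R - 2 * pi * (A * exp (\<rho> * u + \<epsilon>\<^sup>2 * \<rho>\<^sup>2 / 2))) / (2 * pi) = R / (2 * pi) - A * exp (\<rho> * u + \<epsilon>\<^sup>2 * \<rho>\<^sup>2 / 2)"
        by (simp add: diff_divide_distrib)
      ultimately have "\<bar>R / (2 * pi) - A * exp (\<rho> * u + \<epsilon>\<^sup>2 * \<rho>\<^sup>2 / 2)\<bar> \<le> K * (exp (\<rho> * u / 2) * exp (\<rho>\<^sup>2 / 8)) * (G / \<epsilon> ^ (2 * N + 2)) * P / (2 * pi)"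
        by (simp only:)
      then show ?thesis by (simp add: mult_ac)
    qed
    ultimately show "\<exists>V. (\<lambda>k. b (Suc k) * normal_density 0 \<epsilon> (u - ln (real (Suc k)))) sums V \<and>
        \<bar>V - A * exp (\<rho> * u + \<epsilon>\<^sup>2 * \<rho>\<^sup>2 / 2)\<bar> \<le> K * exp (\<rho>\<^sup>2 / 8) * G * P / (2 * pi) * exp (\<rho> * u / 2) / \<epsilon> ^ (2 * N + 2)"
      unfolding t_def[abs_def] by blast
  qed (use K G P in auto)
qed

end

section \<open>Partial sums of the weights\<close>

lemma lborel_has_bochner_integral_real_affine:
  fixes f :: "real \<Rightarrow> real"
  assumes "has_bochner_integral lborel f x" "c \<noteq> 0"
  shows "has_bochner_integral lborel (\<lambda>x. f (t + c * x)) (x /\<^sub>R \<bar>c\<bar>)"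
  using assms lborel_integrable_real_affine[of f c t] lborel_integral_real_affine[of c f t]
  by (auto simp: has_bochner_integral_iff divide_inverse[symmetric] field_simps)

lemma has_bochner_integral_exp_Iic:
  fixes a U :: real assumes "a > 0"
  shows "has_bochner_integral lborel (\<lambda>u. indicator {..U} u * exp (a * u)) (exp (a * U) / a)"
proof -
  have "has_bochner_integral lborel (\<lambda>x. exp (- x) * indicator {0..} x) (1::real)"
  proof (rule has_bochner_integral_nn_integral)
    show "(\<integral>\<^sup>+ x. ennreal (exp (- x) * indicator {0..} x) \<partial>lborel) = ennreal 1"
      using nn_intergal_power_times_exp_Ici[of 0] by (simp add: ennreal_mult' ennreal_indicator)
  qed auto
  then have "has_bochner_integral lborel (\<lambda>x. exp (- (a * U + (- a) * x)) * indicator {0..} (a * U + (- a) * x)) (1 /\<^sub>R \<bar>- a\<bar>)"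
    using assms by (intro lborel_has_bochner_integral_real_affine) auto
  then have "has_bochner_integral lborel (\<lambda>x. exp (a * U) * (exp (- (a * U + (- a) * x)) * indicator {0..} (a * U + (- a) * x))) (exp (a * U) * (1 /\<^sub>R \<bar>- a\<bar>))"
    by (intro has_bochner_integral_mult_right) auto
  moreover have "exp (a * U) * (exp (- (a * U + (- a) * x)) * indicator {0..} (a * U + (- a) * x)) = indicator {..U} x * exp (a * x)" for x
    using assms by (auto simp: indicator_def exp_add[symmetric])
  ultimately show ?thesis using assms by (simp add: divide_inverse)
qed

lemma normal_density_second_moment:
  assumes "\<epsilon> > 0"
  shows "has_bochner_integral lborel (\<lambda>v. normal_density 0 \<epsilon> v * v\<^sup>2) (\<epsilon>\<^sup>2)"
  using normal_moment_even[of \<epsilon> 0 1] assms by (simp add: fact_numeral eval_nat_numeral)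

text \<open>Chebyshev's inequality in pointwise form: the density times 1 - (u - c)^2 / h^2 lies
  below the density cut off at r, because the factor is at most 1 and is not positive where u - c is
  at least h.\<close>

lemma normal_density_Iic_ge:
  fixes \<epsilon> h r c :: real
  assumes "\<epsilon> > 0" "h > 0" "c + h \<le> r"
  shows "integrable lborel (\<lambda>u. indicator {..r} u * normal_density 0 \<epsilon> (u - c))"
    and "(\<integral>u. indicator {..r} u * normal_density 0 \<epsilon> (u - c) \<partial>lborel) \<ge> 1 - \<epsilon>\<^sup>2 / h\<^sup>2"
proof -
  have c1: "integrable lborel (\<lambda>u. normal_density 0 \<epsilon> (- c + 1 * u))"
    using assms by (intro lborel_integrable_real_affine) auto
  then have c1: "integrable lborel (\<lambda>u. normal_density 0 \<epsilon> (u - c))" by simp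
  have c1v: "(\<integral>u. normal_density 0 \<epsilon> (u - c) \<partial>lborel) = 1"
    using lborel_integral_real_affine[of 1 "normal_density 0 \<epsilon>" "- c"] assms by simp
  have "has_bochner_integral lborel (\<lambda>u. normal_density 0 \<epsilon> (- c + 1 * u) * (- c + 1 * u)\<^sup>2) (\<epsilon>\<^sup>2 /\<^sub>R \<bar>1\<bar>)"
    by (intro lborel_has_bochner_integral_real_affine normal_density_second_moment assms) auto
  then have c2: "has_bochner_integral lborel (\<lambda>u. normal_density 0 \<epsilon> (u - c) * (u - c)\<^sup>2) (\<epsilon>\<^sup>2)" by simp
  show int: "integrable lborel (\<lambda>u. indicator {..r} u * normal_density 0 \<epsilon> (u - c))"
    by (rule Bochner_Integration.integrable_bound[OF c1]) (auto simp: indicator_def)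
  have "1 - \<epsilon>\<^sup>2 / h\<^sup>2 = (\<integral>u. normal_density 0 \<epsilon> (u - c) - normal_density 0 \<epsilon> (u - c) * (u - c)\<^sup>2 / h\<^sup>2 \<partial>lborel)"
    using c1 c1v c2 by (simp add: has_bochner_integral_iff)
  also have "\<dots> \<le> (\<integral>u. indicator {..r} u * normal_density 0 \<epsilon> (u - c) \<partial>lborel)"
  proof (rule integral_mono[OF _ int])
    show "integrable lborel (\<lambda>u. normal_density 0 \<epsilon> (u - c) - normal_density 0 \<epsilon> (u - c) * (u - c)\<^sup>2 / h\<^sup>2)"
      using c1 c2 by (intro Bochner_Integration.integrable_diff integrable_divide) (auto simp: has_bochner_integral_iff)
    fix u
    have nn: "normal_density 0 \<epsilon> (u - c) \<ge> 0" by simp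
    show "normal_density 0 \<epsilon> (u - c) - normal_density 0 \<epsilon> (u - c) * (u - c)\<^sup>2 / h\<^sup>2 \<le> indicator {..r} u * normal_density 0 \<epsilon> (u - c)"
    proof (cases "u \<le> r")
      case True
      then show ?thesis using nn by simp
    next
      case False
      then have "u - c \<ge> h" using assms by simp
      then have "(u - c)\<^sup>2 \<ge> h\<^sup>2" using assms by (intro power_mono) auto
      then have "(u - c)\<^sup>2 / h\<^sup>2 \<ge> 1" using assms by simp
      then have "normal_density 0 \<epsilon> (u - c) * 1 \<le> normal_density 0 \<epsilon> (u - c) * ((u - c)\<^sup>2 / h\<^sup>2)"
        by (intro mult_left_mono nn)
      then show ?thesis using False by simp
    qed
  qed
  finally show "(\<integral>u. indicator {..r} u * normal_density 0 \<epsilon> (u - c) \<partial>lborel) \<ge> 1 - \<epsilon>\<^sup>2 / h\<^sup>2" .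
qed

lemma normal_density_Iic_le:
  fixes \<epsilon> r c :: real
  assumes "\<epsilon> > 0"
  shows "integrable lborel (\<lambda>u. indicator {..r} u * normal_density 0 \<epsilon> (u - c))"
    and "(\<integral>u. indicator {..r} u * normal_density 0 \<epsilon> (u - c) \<partial>lborel) \<le> 1"
proof -
  have "integrable lborel (\<lambda>u. normal_density 0 \<epsilon> (- c + 1 * u))"
    using assms by (intro lborel_integrable_real_affine) auto
  then have c1: "integrable lborel (\<lambda>u. normal_density 0 \<epsilon> (u - c))" by simp
  have c1v: "(\<integral>u. normal_density 0 \<epsilon> (u - c) \<partial>lborel) = 1"
    using lborel_integral_real_affine[of 1 "normal_density 0 \<epsilon>" "- c"] assms by simp
  show int: "integrable lborel (\<lambda>u. indicator {..r} u * normal_density 0 \<epsilon> (u - c))"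
    by (rule Bochner_Integration.integrable_bound[OF c1]) (auto simp: indicator_def)
  show "(\<integral>u. indicator {..r} u * normal_density 0 \<epsilon> (u - c) \<partial>lborel) \<le> 1"
    using integral_mono[OF int c1] c1v by (auto simp: indicator_def)
qed

text \<open>The trade of a quadratic for a linear exponent rests on (|v| / \<epsilon> - 1)^2 \<ge>
  0. With v = u - ln k a linear exponent is a power of k, so that a tail of the smoothed sum can be
  compared with the Dirichlet series.\<close>

lemma normal_density_le_exp:
  assumes "\<epsilon> > 0"
  shows "normal_density 0 \<epsilon> v \<le> 1 / \<epsilon> * exp (1 / 2 - \<bar>v\<bar> / \<epsilon>)"
proof -
  have "0 \<le> (\<bar>v\<bar> / \<epsilon> - 1)\<^sup>2" by simp
  also have "\<dots> = v\<^sup>2 / \<epsilon>\<^sup>2 - 2 * (\<bar>v\<bar> / \<epsilon>) + 1" by (simp add: power2_diff power_divide)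
  finally have "- v\<^sup>2 / (2 * \<epsilon>\<^sup>2) \<le> 1 / 2 - \<bar>v\<bar> / \<epsilon>" by (simp add: field_simps)
  then have "exp (- v\<^sup>2 / (2 * \<epsilon>\<^sup>2)) \<le> exp (1 / 2 - \<bar>v\<bar> / \<epsilon>)" by simp
  moreover have "1 / sqrt (2 * pi * \<epsilon>\<^sup>2) \<le> 1 / \<epsilon>"
  proof -
    have "1 * \<epsilon>\<^sup>2 \<le> 2 * pi * \<epsilon>\<^sup>2" using pi_ge_two by (intro mult_right_mono) auto
    then have "\<epsilon> \<le> sqrt (2 * pi * \<epsilon>\<^sup>2)" by (intro real_le_rsqrt) simp
    then show ?thesis using assms by (intro divide_left_mono) auto
  qed
  ultimately show ?thesis
    using assms unfolding normal_density_def by (intro mult_mono) auto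
qed

definition weight_sum :: "(nat \<Rightarrow> real) \<Rightarrow> real \<Rightarrow> real" where
  "weight_sum b x = (\<Sum>k\<in>{1..nat \<lfloor>x\<rfloor>}. b k)"

lemma weight_sum_lessThan: "weight_sum b x = (\<Sum>k<nat \<lfloor>x\<rfloor>. b (Suc k))"
  unfolding weight_sum_def
  by (rule sum.reindex_bij_witness[of _ Suc "\<lambda>k. k - 1"]) auto

lemma weight_sum_mono:
  assumes "\<And>k. k \<ge> 1 \<Longrightarrow> b k \<ge> 0" "x \<le> y"
  shows "weight_sum b x \<le> weight_sum b y"
proof -
  have "nat \<lfloor>x\<rfloor> \<le> nat \<lfloor>y\<rfloor>" using assms(2) by (intro nat_mono floor_mono)
  then show ?thesis
    unfolding weight_sum_def using assms(1) by (intro sum_mono2) auto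
qed

lemma ln_Suc_le_iff: "ln (real (Suc k)) \<le> U \<longleftrightarrow> k < nat \<lfloor>exp U\<rfloor>"
proof -
  have "ln (real (Suc k)) \<le> U \<longleftrightarrow> real (Suc k) \<le> exp U" using exp_le_cancel_iff[of "ln (real (Suc k))" U] by (simp del: of_nat_Suc)
  also have "\<dots> \<longleftrightarrow> k < nat \<lfloor>exp U\<rfloor>" by linarith
  finally show ?thesis .
qed

section \<open>From smoothed to sharp partial sums\<close>

context meinardus_dirichlet
begin

text \<open>Integrate the smoothed sum over u up to U + h. Every k up to exp U then contributes at
  least 1 - \<epsilon>^2 / h^2 of its unit mass, all further terms are non-negative and dropped, and
  the right side is the integral of the main and error terms of the smoothed sum.\<close>

lemma weight_sum_upper:
  fixes C \<epsilon> h U :: real and m :: nat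
  assumes C: "C \<ge> 0"
    "\<And>u \<epsilon>. 0 < \<epsilon> \<Longrightarrow> \<epsilon> \<le> 1 \<Longrightarrow> \<exists>V. (\<lambda>k. b (Suc k) * normal_density 0 \<epsilon> (u - ln (real (Suc k)))) sums V \<and>
        \<bar>V - A * exp (\<rho> * u + \<epsilon>\<^sup>2 * \<rho>\<^sup>2 / 2)\<bar> \<le> C * exp (\<rho> * u / 2) / \<epsilon> ^ m"
    and eps: "0 < \<epsilon>" "\<epsilon> \<le> 1" "h > 0"
  shows "weight_sum b (exp U) * (1 - \<epsilon>\<^sup>2 / h\<^sup>2) \<le> A / \<rho> * exp (\<rho> * (U + h) + \<epsilon>\<^sup>2 * \<rho>\<^sup>2 / 2) + 2 * C / \<rho> * exp (\<rho> * (U + h) / 2) / \<epsilon> ^ m"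
proof -
  note rp = rho_pos and Ap = A_pos
  let ?K = "{..<nat \<lfloor>exp U\<rfloor>}"
  have "weight_sum b (exp U) * (1 - \<epsilon>\<^sup>2 / h\<^sup>2) = (\<Sum>k\<in>?K. b (Suc k) * (1 - \<epsilon>\<^sup>2 / h\<^sup>2))"
    by (simp add: weight_sum_lessThan sum_distrib_right)
  also have "\<dots> \<le> (\<Sum>k\<in>?K. b (Suc k) * (\<integral>u. indicator {..U + h} u * normal_density 0 \<epsilon> (u - ln (real (Suc k))) \<partial>lborel))"
  proof (intro sum_mono mult_left_mono normal_density_Iic_ge(2) eps weight_nonneg)
    fix k assume "k \<in> ?K"
    then show "ln (real (Suc k)) + h \<le> U + h" using ln_Suc_le_iff[of k U] by simp
  qed auto
  also have "\<dots> = (\<integral>u. (\<Sum>k\<in>?K. b (Suc k) * (indicator {..U + h} u * normal_density 0 \<epsilon> (u - ln (real (Suc k))))) \<partial>lborel)"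
    using normal_density_Iic_le(1)[OF eps(1)] by (subst Bochner_Integration.integral_sum) (auto simp del: of_nat_Suc)
  also have "\<dots> \<le> (\<integral>u. A * exp (\<epsilon>\<^sup>2 * \<rho>\<^sup>2 / 2) * (indicator {..U + h} u * exp (\<rho> * u)) + C / \<epsilon> ^ m * (indicator {..U + h} u * exp (\<rho> / 2 * u)) \<partial>lborel)"
  proof (rule integral_mono)
    show "integrable lborel (\<lambda>u. \<Sum>k\<in>?K. b (Suc k) * (indicator {..U + h} u * normal_density 0 \<epsilon> (u - ln (real (Suc k)))))"
      using normal_density_Iic_le(1)[OF eps(1)] by (intro Bochner_Integration.integrable_sum integrable_mult_right) auto
    show "integrable lborel (\<lambda>u. A * exp (\<epsilon>\<^sup>2 * \<rho>\<^sup>2 / 2) * (indicator {..U + h} u * exp (\<rho> * u)) + C / \<epsilon> ^ m * (indicator {..U + h} u * exp (\<rho> / 2 * u)))"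
      using rp by (intro Bochner_Integration.integrable_add integrable_mult_right integrable.intros[OF has_bochner_integral_exp_Iic]) auto
    fix u
    obtain V where V: "(\<lambda>k. b (Suc k) * normal_density 0 \<epsilon> (u - ln (real (Suc k)))) sums V"
      "\<bar>V - A * exp (\<rho> * u + \<epsilon>\<^sup>2 * \<rho>\<^sup>2 / 2)\<bar> \<le> C * exp (\<rho> * u / 2) / \<epsilon> ^ m"
      using C(2)[OF eps(1,2)] by blast
    have "(\<Sum>k\<in>?K. b (Suc k) * normal_density 0 \<epsilon> (u - ln (real (Suc k)))) \<le> V"
      using V(1) weight_nonneg by (intro sum_le_suminf[THEN order_trans]) (auto simp: sums_iff)
    also have "V \<le> A * exp (\<epsilon>\<^sup>2 * \<rho>\<^sup>2 / 2) * exp (\<rho> * u) + C / \<epsilon> ^ m * exp (\<rho> / 2 * u)"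
      using V(2) by (simp add: exp_add mult_ac abs_le_iff)
    finally show "(\<Sum>k\<in>?K. b (Suc k) * (indicator {..U + h} u * normal_density 0 \<epsilon> (u - ln (real (Suc k)))))
       \<le> A * exp (\<epsilon>\<^sup>2 * \<rho>\<^sup>2 / 2) * (indicator {..U + h} u * exp (\<rho> * u)) + C / \<epsilon> ^ m * (indicator {..U + h} u * exp (\<rho> / 2 * u))"
      by (cases "u \<le> U + h") (auto simp: mult_ac)
  qed
  also have "\<dots> = A * exp (\<epsilon>\<^sup>2 * \<rho>\<^sup>2 / 2) * (exp (\<rho> * (U + h)) / \<rho>) + C / \<epsilon> ^ m * (exp (\<rho> / 2 * (U + h)) / (\<rho> / 2))"
    using rp by (intro has_bochner_integral_integral_eq has_bochner_integral_add has_bochner_integral_mult_right has_bochner_integral_exp_Iic) auto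
  also have "\<dots> = A / \<rho> * exp (\<rho> * (U + h) + \<epsilon>\<^sup>2 * \<rho>\<^sup>2 / 2) + 2 * C / \<rho> * exp (\<rho> * (U + h) / 2) / \<epsilon> ^ m"
    by (simp add: exp_add mult_ac)
  finally show ?thesis .
qed

lemma dirichlet_real_summable: "summable (\<lambda>k. b (Suc k) * real (Suc k) powr (- (\<rho> + 1)))"
proof -
  have "(\<lambda>k. of_real (b (Suc k)) * of_nat (Suc k) powr (- of_real (\<rho> + 1))) sums D (of_real (\<rho> + 1))"
    by (intro dirichlet_sums) simp
  moreover have "(\<lambda>k. of_real (b (Suc k)) * of_nat (Suc k) powr (- of_real (\<rho> + 1))) =
    (\<lambda>k. complex_of_real (b (Suc k) * real (Suc k) powr (- (\<rho> + 1))))"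
  proof
    fix k
    show "of_real (b (Suc k)) * of_nat (Suc k) powr (- of_real (\<rho> + 1)) = 
      complex_of_real (b (Suc k) * real (Suc k) powr (- (\<rho> + 1)))"
      using powr_of_real[of "real (Suc k)" "- (\<rho> + 1)"] by simp
  qed
  ultimately have "summable (\<lambda>k. complex_of_real (b (Suc k) * real (Suc k) powr (- (\<rho> + 1))))"
    by (simp only: sums_summable)
  then show ?thesis by (simp only: summable_of_real_iff)
qed

definition dirichlet_const :: real where
  "dirichlet_const = (\<Sum>k. b (Suc k) * real (Suc k) powr (- (\<rho> + 1)))"

lemma dirichlet_const_nonneg: "dirichlet_const \<ge> 0"
  unfolding dirichlet_const_def using weight_nonneg by (intro suminf_nonneg[OF dirichlet_real_summable]) auto

text \<open>The mirror image: integrate only up to U - h, where every k up to exp U contributes at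
  most its whole mass. What has to be subtracted is the mass leaking in from k beyond exp U, whose
  centres ln k are at distance at least h from the range of integration; the Dirichlet series at
  \<rho> + 1 bounds its total.\<close>

lemma weight_sum_lower:
  fixes C \<epsilon> h U :: real and m :: nat
  assumes C: "C \<ge> 0"
    "\<And>u \<epsilon>. 0 < \<epsilon> \<Longrightarrow> \<epsilon> \<le> 1 \<Longrightarrow> \<exists>V. (\<lambda>k. b (Suc k) * normal_density 0 \<epsilon> (u - ln (real (Suc k)))) sums V \<and>
        \<bar>V - A * exp (\<rho> * u + \<epsilon>\<^sup>2 * \<rho>\<^sup>2 / 2)\<bar> \<le> C * exp (\<rho> * u / 2) / \<epsilon> ^ m"
    and eps: "0 < \<epsilon>" "\<epsilon> \<le> 1" "h > 0" "1 / \<epsilon> \<ge> \<rho> + 1"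
  shows "weight_sum b (exp U) \<ge> A / \<rho> * exp (\<rho> * (U - h)) - 2 * C / \<rho> * exp (\<rho> * (U - h) / 2) / \<epsilon> ^ m
       - dirichlet_const * exp (1 / 2) / (\<rho> + 1) * (1 / \<epsilon> * exp ((\<rho> + 1) * U - h / \<epsilon>))"
proof -
  note rp = rho_pos and Ap = A_pos
  let ?K = "{..<nat \<lfloor>exp U\<rfloor>}"
  \<comment> \<open>T times \<open>exp ((\<rho> + 1) * u)\<close> bounds the leaked density at the
    point u; integrated up to U - h it becomes the last term of the claim.\<close>
  define T where "T = dirichlet_const * (1 / \<epsilon> * exp (1 / 2 - (1 / \<epsilon> - \<rho> - 1) * h))"
  have "A * exp (\<epsilon>\<^sup>2 * \<rho>\<^sup>2 / 2) * (exp (\<rho> * (U - h)) / \<rho>) - C / \<epsilon> ^ m * (exp (\<rho> / 2 * (U - h)) / (\<rho> / 2)) =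
    (\<integral>u. A * exp (\<epsilon>\<^sup>2 * \<rho>\<^sup>2 / 2) * (indicator {..U - h} u * exp (\<rho> * u)) - C / \<epsilon> ^ m * (indicator {..U - h} u * exp (\<rho> / 2 * u)) \<partial>lborel)"
    using rp by (intro has_bochner_integral_integral_eq[symmetric] has_bochner_integral_diff has_bochner_integral_mult_right has_bochner_integral_exp_Iic) auto
  also have "\<dots> \<le> (\<integral>u. (\<Sum>k\<in>?K. b (Suc k) * (indicator {..U - h} u * normal_density 0 \<epsilon> (u - ln (real (Suc k)))))
       + T * (indicator {..U - h} u * exp ((\<rho> + 1) * u)) \<partial>lborel)"
  proof (rule integral_mono)
    show "integrable lborel (\<lambda>u. (\<Sum>k\<in>?K. b (Suc k) * (indicator {..U - h} u * normal_density 0 \<epsilon> (u - ln (real (Suc k)))))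
       + T * (indicator {..U - h} u * exp ((\<rho> + 1) * u)))"
      using rp by (intro Bochner_Integration.integrable_add Bochner_Integration.integrable_sum integrable_mult_right
          normal_density_Iic_le(1)[OF eps(1)] integrable.intros[OF has_bochner_integral_exp_Iic]) auto
    show "integrable lborel (\<lambda>u. A * exp (\<epsilon>\<^sup>2 * \<rho>\<^sup>2 / 2) * (indicator {..U - h} u * exp (\<rho> * u)) - C / \<epsilon> ^ m * (indicator {..U - h} u * exp (\<rho> / 2 * u)))"
      using rp by (intro Bochner_Integration.integrable_diff integrable_mult_right integrable.intros[OF has_bochner_integral_exp_Iic]) auto
    fix u
    obtain V where V: "(\<lambda>k. b (Suc k) * normal_density 0 \<epsilon> (u - ln (real (Suc k)))) sums V"
      "\<bar>V - A * exp (\<rho> * u + \<epsilon>\<^sup>2 * \<rho>\<^sup>2 / 2)\<bar> \<le> C * exp (\<rho> * u / 2) / \<epsilon> ^ m"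
      using C(2)[OF eps(1,2)] by blast
    show "A * exp (\<epsilon>\<^sup>2 * \<rho>\<^sup>2 / 2) * (indicator {..U - h} u * exp (\<rho> * u)) - C / \<epsilon> ^ m * (indicator {..U - h} u * exp (\<rho> / 2 * u))
      \<le> (\<Sum>k\<in>?K. b (Suc k) * (indicator {..U - h} u * normal_density 0 \<epsilon> (u - ln (real (Suc k)))))
       + T * (indicator {..U - h} u * exp ((\<rho> + 1) * u))"
    proof (cases "u \<le> U - h")
      case False
      then show ?thesis by simp
    next
      case True
      let ?f = "\<lambda>k. b (Suc k) * normal_density 0 \<epsilon> (u - ln (real (Suc k)))"
      let ?n = "nat \<lfloor>exp U\<rfloor>"
      have "A * exp (\<epsilon>\<^sup>2 * \<rho>\<^sup>2 / 2) * exp (\<rho> * u) - C / \<epsilon> ^ m * exp (\<rho> / 2 * u) \<le> V"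
        using V(2) by (simp add: exp_add mult_ac abs_le_iff)
      also have "V = sum ?f ?K + (\<Sum>k. ?f (k + ?n))"
        using V(1) suminf_split_initial_segment[of ?f ?n] by (simp add: sums_iff)
      also have "(\<Sum>k. ?f (k + ?n)) \<le> (\<Sum>k. b (Suc (k + ?n)) * real (Suc (k + ?n)) powr (- (\<rho> + 1)) * (1 / \<epsilon> * exp (1 / 2 - (1 / \<epsilon> - \<rho> - 1) * h) * exp ((\<rho> + 1) * u)))"
      proof (rule suminf_le)
        show "summable (\<lambda>k. ?f (k + ?n))" using V(1) by (intro summable_ignore_initial_segment) (simp add: sums_iff)
        show "summable (\<lambda>k. b (Suc (k + ?n)) * real (Suc (k + ?n)) powr (- (\<rho> + 1)) * (1 / \<epsilon> * exp (1 / 2 - (1 / \<epsilon> - \<rho> - 1) * h) * exp ((\<rho> + 1) * u)))"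
          using summable_ignore_initial_segment[OF dirichlet_real_summable, of ?n] by (intro summable_mult2) simp
        fix k
        define w where "w = ln (real (Suc (k + ?n))) - u"
        have "w \<ge> h" using ln_Suc_le_iff[of "k + ?n" U] True unfolding w_def by linarith
        \<comment> \<open>The exponent w / \<epsilon> is split: the part (\<rho> + 1) w produces the
          term of the Dirichlet series at \<rho> + 1 together with
          \<open>exp ((\<rho> + 1) * u)\<close>, and in the remainder w is replaced by its lower
          bound h, which requires 1 / \<epsilon> \<ge> \<rho> + 1.\<close>
        have exponent: "1 / 2 - w / \<epsilon> \<le> - (\<rho> + 1) * ln (real (Suc (k + ?n))) + ((1 / 2 - (1 / \<epsilon> - \<rho> - 1) * h) + (\<rho> + 1) * u)"
        proof -
          have "(1 / \<epsilon> - \<rho> - 1) * h \<le> (1 / \<epsilon> - \<rho> - 1) * w" using eps \<open>w \<ge> h\<close> by (intro mult_left_mono) auto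
          moreover have "(1 / \<epsilon> - \<rho> - 1) * w = w / \<epsilon> - (\<rho> + 1) * w" by (simp add: algebra_simps)
          moreover have "(\<rho> + 1) * w = (\<rho> + 1) * ln (real (Suc (k + ?n))) - (\<rho> + 1) * u"
            by (simp only: w_def right_diff_distrib)
          ultimately show ?thesis unfolding mult_minus_left by linarith
        qed
        have "normal_density 0 \<epsilon> (u - ln (real (Suc (k + ?n)))) \<le> 1 / \<epsilon> * exp (1 / 2 - w / \<epsilon>)"
        proof -
          have "\<bar>u - ln (real (Suc (k + ?n)))\<bar> = w" using \<open>w \<ge> h\<close> eps unfolding w_def by linarith
          then show ?thesis using normal_density_le_exp[OF eps(1), of "u - ln (real (Suc (k + ?n)))"] by (simp only:)
        qed
        also have "\<dots> \<le> 1 / \<epsilon> * exp (- (\<rho> + 1) * ln (real (Suc (k + ?n))) + ((1 / 2 - (1 / \<epsilon> - \<rho> - 1) * h) + (\<rho> + 1) * u))"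
          using eps exponent by (intro mult_left_mono) (simp_all only: exp_le_cancel_iff, simp)
        also have "\<dots> = real (Suc (k + ?n)) powr (- (\<rho> + 1)) * (1 / \<epsilon> * exp (1 / 2 - (1 / \<epsilon> - \<rho> - 1) * h) * exp ((\<rho> + 1) * u))"
        proof -
          have "real (Suc (k + ?n)) powr (- (\<rho> + 1)) = exp (- (\<rho> + 1) * ln (real (Suc (k + ?n))))"
            unfolding powr_def by (simp del: of_nat_Suc)
          then show ?thesis by (simp only: exp_add mult_ac)
        qed
        finally show "?f (k + ?n) \<le> b (Suc (k + ?n)) * real (Suc (k + ?n)) powr (- (\<rho> + 1)) * (1 / \<epsilon> * exp (1 / 2 - (1 / \<epsilon> - \<rho> - 1) * h) * exp ((\<rho> + 1) * u))"
          using weight_nonneg[of "Suc (k + ?n)"] unfolding mult.assoc[of "b _"] by (intro mult_left_mono) auto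
      qed
      also have "\<dots> = (\<Sum>k. b (Suc (k + ?n)) * real (Suc (k + ?n)) powr (- (\<rho> + 1))) * (1 / \<epsilon> * exp (1 / 2 - (1 / \<epsilon> - \<rho> - 1) * h) * exp ((\<rho> + 1) * u))"
        using summable_ignore_initial_segment[OF dirichlet_real_summable, of ?n] by (intro suminf_mult2[symmetric]) simp
      also have "\<dots> \<le> dirichlet_const * (1 / \<epsilon> * exp (1 / 2 - (1 / \<epsilon> - \<rho> - 1) * h) * exp ((\<rho> + 1) * u))"
      proof (rule mult_right_mono)
        have "dirichlet_const = (\<Sum>k. b (Suc (k + ?n)) * real (Suc (k + ?n)) powr (- (\<rho> + 1))) + (\<Sum>k<?n. b (Suc k) * real (Suc k) powr (- (\<rho> + 1)))"
          unfolding dirichlet_const_def by (rule suminf_split_initial_segment[OF dirichlet_real_summable])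
        moreover have "(\<Sum>k<?n. b (Suc k) * real (Suc k) powr (- (\<rho> + 1))) \<ge> 0" using weight_nonneg by (intro sum_nonneg) auto
        ultimately show "(\<Sum>k. b (Suc (k + ?n)) * real (Suc (k + ?n)) powr (- (\<rho> + 1))) \<le> dirichlet_const" by linarith
      qed (use eps in auto)
      finally show ?thesis using True by (simp add: T_def mult_ac)
    qed
  qed
  also have "\<dots> = (\<Sum>k\<in>?K. b (Suc k) * (\<integral>u. indicator {..U - h} u * normal_density 0 \<epsilon> (u - ln (real (Suc k))) \<partial>lborel))
      + T * (exp ((\<rho> + 1) * (U - h)) / (\<rho> + 1))"
    using rp by (intro has_bochner_integral_integral_eq has_bochner_integral_add has_bochner_integral_mult_right has_bochner_integral_exp_Iic
      has_bochner_integral_sum has_bochner_integral_integrable normal_density_Iic_le(1)[OF eps(1)]) auto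
  also have "(\<Sum>k\<in>?K. b (Suc k) * (\<integral>u. indicator {..U - h} u * normal_density 0 \<epsilon> (u - ln (real (Suc k))) \<partial>lborel)) \<le> (\<Sum>k\<in>?K. b (Suc k) * 1)"
    by (intro sum_mono mult_left_mono normal_density_Iic_le(2) eps weight_nonneg) auto
  also have "\<dots> = weight_sum b (exp U)" by (simp add: weight_sum_lessThan)
  also have "T * (exp ((\<rho> + 1) * (U - h)) / (\<rho> + 1)) = dirichlet_const * exp (1 / 2) / (\<rho> + 1) * (1 / \<epsilon> * exp ((\<rho> + 1) * U - h / \<epsilon>))"
  proof -
    have "exp (1 / 2 - (1 / \<epsilon> - \<rho> - 1) * h) * exp ((\<rho> + 1) * (U - h)) = exp (1 / 2) * exp ((\<rho> + 1) * U - h / \<epsilon>)"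
      unfolding exp_add[symmetric] by (simp add: algebra_simps)
    then show ?thesis unfolding T_def by (simp add: mult_ac)
  qed
  finally have "A * exp (\<epsilon>\<^sup>2 * \<rho>\<^sup>2 / 2) * (exp (\<rho> * (U - h)) / \<rho>) \<le> weight_sum b (exp U) + 2 * C / \<rho> * exp (\<rho> * (U - h) / 2) / \<epsilon> ^ m
     + dirichlet_const * exp (1 / 2) / (\<rho> + 1) * (1 / \<epsilon> * exp ((\<rho> + 1) * U - h / \<epsilon>))"
    by (simp add: algebra_simps)
  moreover have "A * 1 * (exp (\<rho> * (U - h)) / \<rho>) \<le> A * exp (\<epsilon>\<^sup>2 * \<rho>\<^sup>2 / 2) * (exp (\<rho> * (U - h)) / \<rho>)"
    using rp Ap by (intro mult_right_mono mult_left_mono) auto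
  ultimately show ?thesis by simp
qed

text \<open>At x = exp U the relative errors are of order h from the shift, h^2 from Chebyshev's
  inequality, x^(-\<rho>/2) \<epsilon>^(-m) from the line \<rho> / 2, and essentially the
  exponential of - h / \<epsilon> = - x^(\<eta>/2) from the leakage. The shift dominates, so the
  saving is h itself, whence \<open>\<delta> = \<eta> / 2\<close>.\<close>

lemma weight_sum_power_saving:
  "\<exists>\<delta> C. 0 < \<delta> \<and> \<delta> < \<rho> \<and> C \<ge> 0 \<and> (\<forall>x>0. \<bar>weight_sum b x - A / \<rho> * x powr \<rho>\<bar> \<le> C * x powr (\<rho> - \<delta>))"
proof -
  obtain C :: real and m :: nat where C: "C \<ge> 0"
    "\<And>u \<epsilon>. 0 < \<epsilon> \<Longrightarrow> \<epsilon> \<le> 1 \<Longrightarrow> \<exists>V. (\<lambda>k. b (Suc k) * normal_density 0 \<epsilon> (u - ln (real (Suc k)))) sums V \<and>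
        \<bar>V - A * exp (\<rho> * u + \<epsilon>\<^sup>2 * \<rho>\<^sup>2 / 2)\<bar> \<le> C * exp (\<rho> * u / 2) / \<epsilon> ^ m"
    using smoothed_sum_bound by auto
  note rp = rho_pos and Ap = A_pos
  define B where "B U = weight_sum b (exp U)" for U
  define Z where "Z = dirichlet_const"
  have Z0: "Z \<ge> 0" unfolding Z_def by (rule dirichlet_const_nonneg)
  have up: "B U * (1 - \<epsilon>\<^sup>2 / h\<^sup>2) \<le> A / \<rho> * exp (\<rho> * (U + h) + \<epsilon>\<^sup>2 * \<rho>\<^sup>2 / 2) + 2 * C / \<rho> * exp (\<rho> * (U + h) / 2) / \<epsilon> ^ m"
    if "0 < \<epsilon>" "\<epsilon> \<le> 1" "h > 0" for U \<epsilon> h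
    unfolding B_def by (rule weight_sum_upper, rule C(1), rule C(2), assumption+, (rule that)+)
  have low: "B U \<ge> A / \<rho> * exp (\<rho> * (U - h)) - 2 * C / \<rho> * exp (\<rho> * (U - h) / 2) / \<epsilon> ^ m
       - Z * exp (1 / 2) / (\<rho> + 1) * (1 / \<epsilon> * exp ((\<rho> + 1) * U - h / \<epsilon>))"
    if "0 < \<epsilon>" "\<epsilon> \<le> 1" "h > 0" "1 / \<epsilon> \<ge> \<rho> + 1" for U \<epsilon> h
    unfolding B_def Z_def by (rule weight_sum_lower, rule C(1), rule C(2), assumption+, (rule that)+)
  \<comment> \<open>At \<open>x = exp U\<close> the smoothing width is \<open>\<epsilon> = exp (- \<eta> U)\<close> and the shift is \<open>h = sqrt \<epsilon>\<close>;
     \<open>\<eta>\<close> is so small that the factor \<open>\<epsilon>^(-m)\<close> leaves a power saving.\<close>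
  define \<eta> where "\<eta> = \<rho> / (4 * real (m + 1))"
  have eta: "\<eta> > 0" "\<eta> \<le> \<rho> / 4" "real m * \<eta> \<le> \<rho> / 4"
    using rp by (auto simp: \<eta>_def field_simps)
  \<comment> \<open>\<open>h ^ 4\<close> is \<epsilon>^2, so this is the relative error of the upper
    estimate divided by h. Its limit \<rho> is the derivative of \<open>exp (\<rho> * h)\<close> at
    0, the other contributions to the error being of order h^2; the summand 1 in \<rho> + 1 is
    slack.\<close>
  have "((\<lambda>h. (exp (\<rho> * h + h ^ 4 * \<rho>\<^sup>2 / 2) / (1 - h\<^sup>2) - 1) / h) \<longlongrightarrow> \<rho>) (at_right 0)"
    by real_asymp
  then have "\<forall>\<^sub>F h in at_right 0. (exp (\<rho> * h + h ^ 4 * \<rho>\<^sup>2 / 2) / (1 - h\<^sup>2) - 1) / h < \<rho> + 1"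
    by (rule order_tendstoD) simp
  moreover have "filterlim (\<lambda>U. exp (- (\<eta> * U / 2))) (at_right 0) at_top"
    using eta(1) by real_asymp
  ultimately have ev1: "\<forall>\<^sub>F U in at_top. (exp (\<rho> * exp (- (\<eta> * U / 2)) + exp (- (\<eta> * U / 2)) ^ 4 * \<rho>\<^sup>2 / 2) / (1 - (exp (- (\<eta> * U / 2)))\<^sup>2) - 1) / exp (- (\<eta> * U / 2)) < \<rho> + 1"
    by (rule eventually_compose_filterlim)
  have ev2: "\<forall>\<^sub>F U in at_top. \<eta> * U + (\<rho> + 1) * U - exp (\<eta> * U / 2) \<le> 0"
    using eta(1) rp by real_asymp
  have ev3: "\<forall>\<^sub>F U in at_top. exp (\<eta> * U) \<ge> \<rho> + 2"
    using eta(1) by real_asymp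
  define C2 where "C2 = A / \<rho> * (\<rho> + 1) + 4 * C / \<rho> * exp (\<rho> / 2) + Z * exp (1 / 2) / (\<rho> + 1)"
  define \<delta> where "\<delta> = \<eta> / 2"
  have "\<forall>\<^sub>F U in at_top. \<bar>B U - A / \<rho> * exp (\<rho> * U)\<bar> \<le> C2 * exp ((\<rho> - \<delta>) * U)"
    using ev1 ev2 ev3 eventually_ge_at_top[of 0]
  proof eventually_elim
    case (elim U)
    define h where "h = exp (- (\<eta> * U / 2))"
    define \<epsilon> where "\<epsilon> = h\<^sup>2"
    define E where "E = exp ((\<rho> - \<delta>) * U)"
    have h: "0 < h" "h \<le> 1" using elim eta(1) by (auto simp: h_def)
    have eps_eq: "\<epsilon> = exp (- (\<eta> * U))" by (simp add: \<epsilon>_def h_def power2_eq_square exp_add[symmetric])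
    have inv_eps: "1 / \<epsilon> = exp (\<eta> * U)" by (simp add: eps_eq exp_minus divide_inverse)
    have eps: "0 < \<epsilon>" "\<epsilon> \<le> 1" "1 / \<epsilon> \<ge> \<rho> + 1" "1 / \<epsilon> \<ge> 2"
    proof -
      show "0 < \<epsilon>" "\<epsilon> \<le> 1" using h by (simp_all add: \<epsilon>_def power_le_one)
      show "1 / \<epsilon> \<ge> \<rho> + 1" "1 / \<epsilon> \<ge> 2" using elim(3) rp unfolding inv_eps by linarith+
    qed
    have eps2: "\<epsilon> \<le> 1 / 2" using eps by (simp add: field_simps)
    have E1: "exp (\<rho> * U) * h = E" by (simp add: E_def h_def \<delta>_def exp_add[symmetric] algebra_simps)
    have E2: "exp (\<rho> * U / 2) / \<epsilon> ^ m \<le> E"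
    proof -
      have "1 / \<epsilon> ^ m = exp (real m * (\<eta> * U))"
        using inv_eps by (simp add: exp_of_nat_mult power_one_over[symmetric])
      then have "exp (\<rho> * U / 2) / \<epsilon> ^ m = exp (\<rho> * U / 2) * exp (real m * (\<eta> * U))"
        by (metis divide_inverse inverse_eq_divide)
      also have "\<dots> = exp (\<rho> * U / 2 + real m * (\<eta> * U))" by (rule exp_add[symmetric])
      also have "\<rho> * U / 2 + real m * (\<eta> * U) = (\<rho> / 2 + real m * \<eta>) * U" by (simp add: algebra_simps)
      also have "exp ((\<rho> / 2 + real m * \<eta>) * U) \<le> E"
        unfolding E_def exp_le_cancel_iff
        using eta elim rp by (intro mult_right_mono) (auto simp: \<delta>_def)
      finally show ?thesis .
    qed
    have E3: "1 / \<epsilon> * exp ((\<rho> + 1) * U - h / \<epsilon>) \<le> E"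
    proof -
      have "h / \<epsilon> = exp (\<eta> * U / 2)"
        by (simp add: eps_eq h_def exp_diff[symmetric])
      then have "1 / \<epsilon> * exp ((\<rho> + 1) * U - h / \<epsilon>) = exp (\<eta> * U + (\<rho> + 1) * U - exp (\<eta> * U / 2))"
        unfolding inv_eps by (simp add: exp_add[symmetric] algebra_simps)
      also have "\<dots> \<le> exp 0" using elim(2) by (simp only: exp_le_cancel_iff)
      also have "\<dots> \<le> E" using eta elim rp by (auto simp: E_def \<delta>_def intro!: mult_nonneg_nonneg)
      finally show ?thesis .
    qed
    have upper: "B U \<le> A / \<rho> * exp (\<rho> * U) + C2 * E"
    proof -
      have rat: "\<epsilon>\<^sup>2 / h\<^sup>2 = h\<^sup>2" using h by (simp add: \<epsilon>_def power2_eq_square)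
      have d: "1 - h\<^sup>2 \<ge> 1 / 2" using eps2 by (simp add: \<epsilon>_def)
      have "B U \<le> (A / \<rho> * exp (\<rho> * (U + h) + \<epsilon>\<^sup>2 * \<rho>\<^sup>2 / 2) + 2 * C / \<rho> * exp (\<rho> * (U + h) / 2) / \<epsilon> ^ m) / (1 - h\<^sup>2)"
        using up[OF eps(1,2) h(1), of U] d unfolding rat by (subst pos_le_divide_eq) auto
      also have "\<dots> = A / \<rho> * exp (\<rho> * U) * (exp (\<rho> * h + h ^ 4 * \<rho>\<^sup>2 / 2) / (1 - h\<^sup>2)) +
          2 * C / \<rho> * exp (\<rho> * h / 2) * (exp (\<rho> * U / 2) / \<epsilon> ^ m) * (1 / (1 - h\<^sup>2))"
        by (simp add: \<epsilon>_def add_divide_distrib exp_add distrib_left mult_ac power_mult[symmetric] power2_eq_square[of "h\<^sup>2"] power_add[symmetric])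
      also have "\<dots> \<le> A / \<rho> * exp (\<rho> * U) * (1 + (\<rho> + 1) * h) + 2 * C / \<rho> * exp (\<rho> / 2) * E * 2"
      proof (rule add_mono)
        have "exp (\<rho> * h + h ^ 4 * \<rho>\<^sup>2 / 2) / (1 - h\<^sup>2) \<le> 1 + (\<rho> + 1) * h"
          using elim(1) h by (simp add: h_def[symmetric] pos_divide_less_eq)
        then show "A / \<rho> * exp (\<rho> * U) * (exp (\<rho> * h + h ^ 4 * \<rho>\<^sup>2 / 2) / (1 - h\<^sup>2)) \<le> A / \<rho> * exp (\<rho> * U) * (1 + (\<rho> + 1) * h)"
          using Ap rp by (intro mult_left_mono) auto
        have "1 / (1 - h\<^sup>2) \<le> 2" using d by (simp add: pos_divide_le_eq)
        then show "2 * C / \<rho> * exp (\<rho> * h / 2) * (exp (\<rho> * U / 2) / \<epsilon> ^ m) * (1 / (1 - h\<^sup>2)) \<le> 2 * C / \<rho> * exp (\<rho> / 2) * E * 2"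
          using C rp h d eps by (intro mult_mono E2) (auto simp: E_def)
      qed
      also have "\<dots> = A / \<rho> * exp (\<rho> * U) + A / \<rho> * (\<rho> + 1) * E + 2 * C / \<rho> * exp (\<rho> / 2) * E * 2"
        unfolding E1[symmetric] by (simp add: algebra_simps add_divide_distrib diff_divide_distrib)
      also have "\<dots> \<le> A / \<rho> * exp (\<rho> * U) + C2 * E"
      proof -
        have "Z * exp (1 / 2) / (\<rho> + 1) * E \<ge> 0" using Z0 rp by (simp add: E_def)
        moreover have "2 * C / \<rho> * exp (\<rho> / 2) * E * 2 = 4 * C / \<rho> * exp (\<rho> / 2) * E" by simp
        ultimately show ?thesis unfolding C2_def distrib_right by linarith
      qed
      finally show ?thesis .
    qed
    have lower: "B U \<ge> A / \<rho> * exp (\<rho> * U) - C2 * E"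
    proof -
      have "A / \<rho> * exp (\<rho> * (U - h)) \<ge> A / \<rho> * (exp (\<rho> * U) * (1 - \<rho> * h))"
      proof (intro mult_left_mono)
        have "1 - \<rho> * h \<le> exp (- (\<rho> * h))" using exp_ge_add_one_self[of "- (\<rho> * h)"] by simp
        then have "exp (\<rho> * U) * (1 - \<rho> * h) \<le> exp (\<rho> * U) * exp (- (\<rho> * h))" by (intro mult_left_mono) auto
        then show "exp (\<rho> * U) * (1 - \<rho> * h) \<le> exp (\<rho> * (U - h))" by (simp add: exp_add[symmetric] algebra_simps)
      qed (use Ap rp in auto)
      moreover have "A / \<rho> * (exp (\<rho> * U) * (1 - \<rho> * h)) = A / \<rho> * exp (\<rho> * U) - A / \<rho> * \<rho> * E"
        unfolding E1[symmetric] by (simp add: algebra_simps add_divide_distrib diff_divide_distrib)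
      moreover have "2 * C / \<rho> * exp (\<rho> * (U - h) / 2) / \<epsilon> ^ m \<le> 2 * C / \<rho> * E"
      proof -
        have "exp (\<rho> * (U - h) / 2) / \<epsilon> ^ m \<le> exp (\<rho> * U / 2) / \<epsilon> ^ m"
          using eps h rp by (intro divide_right_mono) auto
        also note E2
        finally have "2 * C / \<rho> * (exp (\<rho> * (U - h) / 2) / \<epsilon> ^ m) \<le> 2 * C / \<rho> * E"
          using C rp by (intro mult_left_mono) auto
        then show ?thesis by simp
      qed
      moreover have "Z * exp (1 / 2) / (\<rho> + 1) * (1 / \<epsilon> * exp ((\<rho> + 1) * U - h / \<epsilon>)) \<le> Z * exp (1 / 2) / (\<rho> + 1) * E"
        using Z0 rp by (intro mult_left_mono E3) auto
      moreover have "A / \<rho> * \<rho> * E + 2 * C / \<rho> * E + Z * exp (1 / 2) / (\<rho> + 1) * E \<le> C2 * E"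
      proof -
        have "2 * C / \<rho> * 1 \<le> 4 * C / \<rho> * exp (\<rho> / 2)" using C rp by (intro mult_mono divide_right_mono) auto
        moreover have "A / \<rho> * \<rho> \<le> A / \<rho> * (\<rho> + 1)" using Ap rp by (intro mult_left_mono) auto
        ultimately have "A / \<rho> * \<rho> + 2 * C / \<rho> + Z * exp (1 / 2) / (\<rho> + 1) \<le> C2"
          unfolding C2_def by linarith
        then have "(A / \<rho> * \<rho> + 2 * C / \<rho> + Z * exp (1 / 2) / (\<rho> + 1)) * E \<le> C2 * E"
          by (intro mult_right_mono) (auto simp: E_def)
        then show ?thesis by (simp only: distrib_right)
      qed
      ultimately show ?thesis using low[OF eps(1,2) h(1) eps(3), of U] by linarith
    qed
    show ?case using upper lower by (simp add: E_def abs_le_iff)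
  qed
  then obtain U0 where U0: "\<And>U. U \<ge> U0 \<Longrightarrow> \<bar>B U - A / \<rho> * exp (\<rho> * U)\<bar> \<le> C2 * exp ((\<rho> - \<delta>) * U)"
    by (auto simp: eventually_at_top_linorder)
  have delta: "\<delta> > 0" "\<delta> < \<rho>" using eta rp by (auto simp: \<delta>_def)
  \<comment> \<open>Enlarged so that the bound holds for every x > 0: beyond exp U0 it contains C2,
    between 1 and exp U0 the crude bounds of both terms, and below 1 the weight sum vanishes while
    x^\<rho> \<le> x^(\<rho> - \<delta>).\<close>
  define C3 where "C3 = \<bar>C2\<bar> + \<bar>B (max U0 0)\<bar> + A / \<rho> * exp (\<rho> * max U0 0) + A / \<rho>"
  have pos: "A / \<rho> * exp (\<rho> * max U0 0) \<ge> 0" "A / \<rho> \<ge> 0" using Ap rp by auto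
  have C3: "C3 \<ge> 0" "C2 \<le> C3" "A / \<rho> \<le> C3" using pos unfolding C3_def by linarith+
  have "\<bar>weight_sum b x - A / \<rho> * x powr \<rho>\<bar> \<le> C3 * x powr (\<rho> - \<delta>)" if x: "x > 0" for x
  proof -
    define U where "U = ln x"
    have xU: "x = exp U" "x powr \<rho> = exp (\<rho> * U)" "x powr (\<rho> - \<delta>) = exp ((\<rho> - \<delta>) * U)"
      using x by (auto simp: U_def powr_def)
    have "\<bar>B U - A / \<rho> * exp (\<rho> * U)\<bar> \<le> C3 * exp ((\<rho> - \<delta>) * U)"
    proof -
      consider "U \<ge> U0" | "0 \<le> U" "U < U0" | "U < 0" by linarith
      then show ?thesis
      proof cases
        case 1
        have "C2 * exp ((\<rho> - \<delta>) * U) \<le> C3 * exp ((\<rho> - \<delta>) * U)"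
          using C3 by (intro mult_right_mono) auto
        then show ?thesis using U0[OF 1] by linarith
      next
        case 2
        have "B U \<le> B (max U0 0)" "B U \<ge> 0"
          unfolding B_def using 2 weight_nonneg by (auto intro!: weight_sum_mono) (auto simp: weight_sum_def intro!: sum_nonneg)
        moreover have "A / \<rho> * exp (\<rho> * U) \<le> A / \<rho> * exp (\<rho> * max U0 0)" "A / \<rho> * exp (\<rho> * U) \<ge> 0"
          using 2 Ap rp by (auto intro!: mult_left_mono divide_right_mono)
        ultimately have "\<bar>B U - A / \<rho> * exp (\<rho> * U)\<bar> \<le> C3"
          using pos unfolding C3_def by linarith
        then have "\<bar>B U - A / \<rho> * exp (\<rho> * U)\<bar> \<le> C3 * 1" by simp
        also have "C3 * 1 \<le> C3 * exp ((\<rho> - \<delta>) * U)" using 2 delta C3 by (intro mult_left_mono) auto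
        finally show ?thesis .
      next
        case 3
        have "nat \<lfloor>exp U\<rfloor> = 0" using 3 by (simp add: floor_less_iff)
        then have "B U = 0" by (simp add: B_def weight_sum_def)
        then have "\<bar>B U - A / \<rho> * exp (\<rho> * U)\<bar> = A / \<rho> * exp (\<rho> * U)" using Ap rp by simp
        also have "\<dots> \<le> C3 * exp ((\<rho> - \<delta>) * U)"
        proof (intro mult_mono)
          show "A / \<rho> \<le> C3" by (rule C3)
          have "\<rho> * U \<le> (\<rho> - \<delta>) * U" using 3 delta by (simp add: left_diff_distrib mult_nonneg_nonpos)
          then show "exp (\<rho> * U) \<le> exp ((\<rho> - \<delta>) * U)" by simp
        qed (use C3 in auto)
        finally show ?thesis .
      qed
    qed
    then show ?thesis unfolding xU(2) xU(3) B_def unfolding xU(1)[symmetric] .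
  qed
  then show ?thesis using delta C3 by blast
qed

end

section \<open>Laplace sums and moments\<close>

text \<open>Summation by parts read as an integral: each weight \<open>w k\<close> is counted on the
  interval from k to x, hence with length x - k.\<close>

lemma weight_sum_has_integral:
  assumes "x \<ge> 0"
  shows "(weight_sum w has_integral (x * weight_sum w x - weight_sum (\<lambda>k. real k * w k) x)) {0..x}"
proof -
  have int: "((\<lambda>t. \<Sum>k\<in>{1..nat \<lfloor>x\<rfloor>}. w k * (if t \<in> {real k..x} then 1 else 0)) has_integral (\<Sum>k\<in>{1..nat \<lfloor>x\<rfloor>}. w k * (x - real k))) {0..x}"
  proof (intro has_integral_sum has_integral_mult_right)
    fix k assume k: "k \<in> {1..nat \<lfloor>x\<rfloor>}"
    have "((\<lambda>t::real. 1::real) has_integral (x - real k)) {real k..x}"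
    proof -
      have "real k \<le> x" using k assms by (auto simp: le_nat_iff le_floor_iff)
      then show ?thesis using has_integral_const_real[of "1::real" "real k" x] by simp
    qed
    then show "((\<lambda>t. if t \<in> {real k..x} then 1 else (0::real)) has_integral (x - real k)) {0..x}"
      by (subst has_integral_restrict) auto
  qed auto
  have val: "(\<Sum>k\<in>{1..nat \<lfloor>x\<rfloor>}. w k * (x - real k)) = x * weight_sum w x - weight_sum (\<lambda>k. real k * w k) x"
    by (simp add: weight_sum_def sum_distrib_left sum_subtractf[symmetric] algebra_simps)
  have eq: "(\<Sum>k\<in>{1..nat \<lfloor>x\<rfloor>}. w k * (if t \<in> {real k..x} then 1 else 0)) = weight_sum w t" if "t \<in> {0..x}" for t
  proof -
    have "nat \<lfloor>t\<rfloor> \<le> nat \<lfloor>x\<rfloor>" using that by (intro nat_mono floor_mono) auto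
    then have "weight_sum w t = (\<Sum>k\<in>{1..nat \<lfloor>x\<rfloor>}. if k \<in> {1..nat \<lfloor>t\<rfloor>} then w k else 0)"
      unfolding weight_sum_def by (subst sum.inter_restrict[symmetric]) (auto intro!: sum.cong)
    also have "\<dots> = (\<Sum>k\<in>{1..nat \<lfloor>x\<rfloor>}. w k * (if t \<in> {real k..x} then 1 else 0))"
      using that by (intro sum.cong) (auto simp: le_nat_iff le_floor_iff)
    finally show ?thesis by simp
  qed
  show ?thesis using has_integral_eq[OF eq int] unfolding val .
qed

text \<open>The sum is x W(x) minus the integral of W from 0 to x, and c - c / (\<kappa> + 1) is c
  \<kappa> / (\<kappa> + 1). Both pieces have error at most C x^(\<kappa> + 1 - \<delta>); for the
  integral this uses \<delta> < \<kappa>, which makes the divisor \<kappa> + 1 - \<delta> exceed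
  1.\<close>

lemma weight_sum_times_id_bound:
  fixes w :: "nat \<Rightarrow> real" and c C \<kappa> \<delta> :: real
  assumes W: "\<And>x. x > 0 \<Longrightarrow> \<bar>weight_sum w x - c * x powr \<kappa>\<bar> \<le> C * x powr (\<kappa> - \<delta>)"
    and "0 < \<delta>" "\<delta> < \<kappa>" "C \<ge> 0" and x: "x > 0"
  shows "\<bar>weight_sum (\<lambda>k. real k * w k) x - c * \<kappa> / (\<kappa> + 1) * x powr (\<kappa> + 1)\<bar> \<le> 2 * C * x powr (\<kappa> + 1 - \<delta>)"
proof -
  have p: "((\<lambda>t. t powr a) has_integral (x powr (a + 1) / (a + 1))) {0..x}" if "a > 0" for a
    using has_integral_powr_from_0[of a x] that x by simp
  define I where "I = x * weight_sum w x - weight_sum (\<lambda>k. real k * w k) x"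
  have h1: "((\<lambda>t. weight_sum w t - c * t powr \<kappa>) has_integral (I - c * (x powr (\<kappa> + 1) / (\<kappa> + 1)))) {0..x}"
    unfolding I_def using assms by (intro has_integral_diff has_integral_mult_right weight_sum_has_integral p) auto
  have h2: "((\<lambda>t. C * t powr (\<kappa> - \<delta>)) has_integral (C * (x powr (\<kappa> - \<delta> + 1) / (\<kappa> - \<delta> + 1)))) {0..x}"
    using assms by (intro has_integral_mult_right p) auto
  have "norm (weight_sum w t - c * t powr \<kappa>) \<le> C * t powr (\<kappa> - \<delta>)" if "t \<in> {0..x}" for t
    using W[of t] that by (cases "t = 0") (auto simp: weight_sum_def)
  then have "norm (integral {0..x} (\<lambda>t. weight_sum w t - c * t powr \<kappa>)) \<le> integral {0..x} (\<lambda>t. C * t powr (\<kappa> - \<delta>))"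
    using h1 h2 by (intro Henstock_Kurzweil_Integration.integral_norm_bound_integral) (auto simp: has_integral_iff)
  then have "\<bar>I - c * (x powr (\<kappa> + 1) / (\<kappa> + 1))\<bar> \<le> C * (x powr (\<kappa> - \<delta> + 1) / (\<kappa> - \<delta> + 1))"
    using h1 h2 by (simp add: has_integral_iff)
  also have "\<kappa> - \<delta> + 1 = \<kappa> + 1 - \<delta>" by simp
  also have "C * (x powr (\<kappa> + 1 - \<delta>) / (\<kappa> + 1 - \<delta>)) \<le> C * (x powr (\<kappa> + 1 - \<delta>) / 1)"
    using assms by (intro mult_left_mono divide_left_mono) auto
  finally have b1: "\<bar>I - c * (x powr (\<kappa> + 1) / (\<kappa> + 1))\<bar> \<le> C * x powr (\<kappa> + 1 - \<delta>)" by simp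
  have "\<bar>x * weight_sum w x - c * (x * x powr \<kappa>)\<bar> = x * \<bar>weight_sum w x - c * x powr \<kappa>\<bar>"
  proof -
    have "x * weight_sum w x - c * (x * x powr \<kappa>) = x * (weight_sum w x - c * x powr \<kappa>)"
      by (simp add: algebra_simps)
    then show ?thesis using x by (simp only: abs_mult abs_of_pos)
  qed
  also have "\<dots> \<le> x * (C * x powr (\<kappa> - \<delta>))" using W[OF x] x by (intro mult_left_mono) auto
  also have "\<dots> = C * x powr (\<kappa> + 1 - \<delta>)"
    using x powr_mult_base[of x "\<kappa> - \<delta>"] by (simp add: algebra_simps)
  finally have b2: "\<bar>x * weight_sum w x - c * x powr (\<kappa> + 1)\<bar> \<le> C * x powr (\<kappa> + 1 - \<delta>)"
    using x powr_mult_base[of x \<kappa>] by (simp add: add.commute)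
  have "weight_sum (\<lambda>k. real k * w k) x - c * \<kappa> / (\<kappa> + 1) * x powr (\<kappa> + 1) =
      (x * weight_sum w x - c * x powr (\<kappa> + 1)) - (I - c * (x powr (\<kappa> + 1) / (\<kappa> + 1)))"
    using assms by (simp add: I_def field_simps)
  then have "\<bar>weight_sum (\<lambda>k. real k * w k) x - c * \<kappa> / (\<kappa> + 1) * x powr (\<kappa> + 1)\<bar> \<le>
      \<bar>x * weight_sum w x - c * x powr (\<kappa> + 1)\<bar> + \<bar>I - c * (x powr (\<kappa> + 1) / (\<kappa> + 1))\<bar>"
    by (simp only: abs_triangle_ineq4)
  also have "\<dots> \<le> C * x powr (\<kappa> + 1 - \<delta>) + C * x powr (\<kappa> + 1 - \<delta>)" by (intro add_mono b1 b2)
  finally show ?thesis by simp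
qed

lemma has_bochner_integral_Gamma:
  fixes a \<beta> :: real assumes "a > 0" "\<beta> > 0"
  shows "has_bochner_integral lborel (\<lambda>x. indicator {0..} x * (x powr (a - 1) * exp (- (\<beta> * x)))) (Gamma a * \<beta> powr (- a))"
proof -
  have "has_bochner_integral lborel (\<lambda>t. indicator {0..} t * t powr (a - 1) / exp t) (Gamma a)"
  proof (rule has_bochner_integral_nn_integral)
    show "(\<integral>\<^sup>+ t. ennreal (indicator {0..} t * t powr (a - 1) / exp t) \<partial>lborel) = ennreal (Gamma a)"
      using Gamma_conv_nn_integral_real[OF assms(1)] by simp
    show "Gamma a \<ge> 0" using assms by (intro Gamma_real_nonneg) auto
  qed auto
  from lborel_has_bochner_integral_real_affine[OF this, of \<beta> 0] assms
  have "has_bochner_integral lborel (\<lambda>t. indicator {0..} (\<beta> * t) * (\<beta> * t) powr (a - 1) / exp (\<beta> * t)) (Gamma a / \<beta>)"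
    by (simp add: divide_inverse mult.commute)
  then have "has_bochner_integral lborel (\<lambda>t. \<beta> powr (1 - a) * (indicator {0..} (\<beta> * t) * (\<beta> * t) powr (a - 1) / exp (\<beta> * t))) (\<beta> powr (1 - a) * (Gamma a / \<beta>))"
    by (intro has_bochner_integral_mult_right) auto
  moreover have "\<beta> powr (1 - a) * (indicator {0..} (\<beta> * t) * (\<beta> * t) powr (a - 1) / exp (\<beta> * t)) = indicator {0..} t * (t powr (a - 1) * exp (- (\<beta> * t)))" for t
  proof (cases "t \<ge> 0")
    case True
    have "\<beta> powr (1 - a) * \<beta> powr (a - 1) = 1" using assms by (simp add: powr_add[symmetric])
    then have "\<beta> powr (1 - a) * (\<beta> * t) powr (a - 1) = t powr (a - 1)"
      using True assms by (simp add: powr_mult mult.assoc[symmetric])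
    then show ?thesis using True assms by (simp add: exp_minus divide_inverse)
  qed (use assms in \<open>auto simp: indicator_def zero_le_mult_iff\<close>)
  moreover have "\<beta> powr (1 - a) * (Gamma a / \<beta>) = Gamma a * \<beta> powr (- a)"
  proof -
    have "\<beta> powr (1 - a) = \<beta> * \<beta> powr (- a)" using assms powr_mult_base[of \<beta> "- a"] by simp
    then show ?thesis using assms by simp
  qed
  ultimately show ?thesis by simp
qed

text \<open>Each \<open>exp (- (\<beta> * k))\<close> is \<beta> times the integral of
  \<open>exp (- (\<beta> * x))\<close> over x \<ge> k; sum and integral are exchanged since all
  terms are non-negative.\<close>

lemma laplace_weight_sum_integral:
  fixes w :: "nat \<Rightarrow> real" and \<beta> :: real
  assumes w: "\<And>k. k \<ge> 1 \<Longrightarrow> w k \<ge> 0" and "\<beta> > 0"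
    and summ: "summable (\<lambda>k. w (Suc k) * exp (- (\<beta> * real (Suc k))))"
  shows "integrable lborel (\<lambda>x. indicator {0..} x * (weight_sum w x * exp (- (\<beta> * x))))"
    and "(\<Sum>k. w (Suc k) * exp (- (\<beta> * real (Suc k)))) = \<beta> * (\<integral>x. indicator {0..} x * (weight_sum w x * exp (- (\<beta> * x))) \<partial>lborel)"
proof -
  define f where "f k x = w (Suc k) * (\<beta> * (indicator {real (Suc k)..} x * exp (- (\<beta> * x))))" for k x
  have exint: "has_bochner_integral lborel (\<lambda>x. indicator {a..} x * exp (- (\<beta> * x))) (exp (- (\<beta> * a)) / \<beta>)" for a :: real
  proof -
    have "has_bochner_integral lborel (\<lambda>x. indicator {..- a} (0 + (-1) * x) * exp (\<beta> * (0 + (-1) * x))) ((exp (\<beta> * (- a)) / \<beta>) /\<^sub>R \<bar>-1\<bar>)"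
      using assms by (intro lborel_has_bochner_integral_real_affine[OF has_bochner_integral_exp_Iic]) auto
    then show ?thesis by (simp add: indicator_def)
  qed
  have fint: "has_bochner_integral lborel (f k) (w (Suc k) * exp (- (\<beta> * real (Suc k))))" for k
  proof -
    have "has_bochner_integral lborel (f k) (w (Suc k) * (\<beta> * (exp (- (\<beta> * real (Suc k))) / \<beta>)))"
      unfolding f_def[abs_def] by (intro has_bochner_integral_mult_right exint)
    then show ?thesis using assms by simp
  qed
  have fsums: "(\<lambda>k. f k x) sums (indicator {0..} x * (weight_sum w x * (\<beta> * exp (- (\<beta> * x)))))" for x
  proof -
    have "(\<lambda>k. f k x) sums (\<Sum>k<nat \<lfloor>x\<rfloor>. f k x)"
    proof (rule sums_finite)
      fix k assume "k \<notin> {..<nat \<lfloor>x\<rfloor>}"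
      then have "\<not> real (Suc k) \<le> x" unfolding lessThan_iff by linarith
      then show "f k x = 0" by (simp add: f_def)
    qed auto
    also have "(\<Sum>k<nat \<lfloor>x\<rfloor>. f k x) = (\<Sum>k<nat \<lfloor>x\<rfloor>. w (Suc k) * (\<beta> * exp (- (\<beta> * x))))"
    proof (rule sum.cong)
      fix k assume "k \<in> {..<nat \<lfloor>x\<rfloor>}"
      then have "real (Suc k) \<le> x" unfolding lessThan_iff by linarith
      then show "f k x = w (Suc k) * (\<beta> * exp (- (\<beta> * x)))" by (simp add: f_def)
    qed auto
    also have "\<dots> = indicator {0..} x * (weight_sum w x * (\<beta> * exp (- (\<beta> * x))))"
      by (cases "x \<ge> 0") (auto simp: weight_sum_lessThan sum_distrib_right)
    finally show ?thesis .
  qed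
  have fnorm: "norm (f k x) = f k x" for k x
    using w[of "Suc k"] assms by (simp add: f_def)
  have f1: "integrable lborel (f k)" for k using fint by (simp add: has_bochner_integral_iff)
  have f2: "AE x in lborel. summable (\<lambda>k. norm (f k x))"
    unfolding fnorm using fsums by (intro AE_I2) (rule sums_summable)
  have "integral\<^sup>L lborel (f k) = w (Suc k) * exp (- (\<beta> * real (Suc k)))" for k
    using fint[of k] by (simp only: has_bochner_integral_iff)
  then have f3: "summable (\<lambda>k. \<integral>x. norm (f k x) \<partial>lborel)"
    unfolding fnorm using summ by (simp only:)
  note isum = sums_integral[OF f1 f2 f3] and iint = integrable_suminf[OF f1 f2 f3]
  have fs: "(\<Sum>k. f k x) = \<beta> * (indicator {0..} x * (weight_sum w x * exp (- (\<beta> * x))))" for x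
    using fsums[of x] by (simp add: sums_iff)
  from iint show "integrable lborel (\<lambda>x. indicator {0..} x * (weight_sum w x * exp (- (\<beta> * x))))"
    unfolding fs using assms by simp
  show "(\<Sum>k. w (Suc k) * exp (- (\<beta> * real (Suc k)))) = \<beta> * (\<integral>x. indicator {0..} x * (weight_sum w x * exp (- (\<beta> * x))) \<partial>lborel)"
    using isum fint unfolding fs by (simp add: has_bochner_integral_iff sums_iff)
qed

text \<open>Putting the two-sided estimate of the partial sums under the Laplace integral gives one
  Gamma integral for the main term and one for the error. The result holds for every \<beta> > 0 and
  not only for small \<beta>, so it can later be summed over all multiples j \<alpha>.\<close>

lemma laplace_weight_sum:
  fixes w :: "nat \<Rightarrow> real" and c C \<kappa> \<delta> \<beta> :: real
  assumes w: "\<And>k. k \<ge> 1 \<Longrightarrow> w k \<ge> 0"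
    and W: "\<And>x. x > 0 \<Longrightarrow> \<bar>weight_sum w x - c * x powr \<kappa>\<bar> \<le> C * x powr (\<kappa> - \<delta>)"
    and "0 < \<delta>" "\<delta> < \<kappa>" "C \<ge> 0" "\<beta> > 0"
  shows "summable (\<lambda>k. w (Suc k) * exp (- (\<beta> * real (Suc k))))"
    and "\<bar>(\<Sum>k. w (Suc k) * exp (- (\<beta> * real (Suc k)))) - c * Gamma (\<kappa> + 1) * \<beta> powr (- \<kappa>)\<bar>
       \<le> C * Gamma (\<kappa> - \<delta> + 1) * \<beta> powr (- (\<kappa> - \<delta>))"
proof -
  \<comment> \<open>A single weight is at most the partial sum ending with it, hence of polynomial
    growth; for summability this is enough.\<close>
  have wle: "w (Suc k) \<le> (\<bar>c\<bar> + C) * real (Suc k) powr \<kappa>" for k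
  proof -
    have "w (Suc k) \<le> weight_sum w (real (Suc k))"
      unfolding weight_sum_def using w by (intro member_le_sum) (auto simp: nat_add_distrib)
    also have "\<dots> \<le> c * real (Suc k) powr \<kappa> + C * real (Suc k) powr (\<kappa> - \<delta>)"
      using W[of "real (Suc k)"] by (simp add: abs_le_iff)
    also have "\<dots> \<le> \<bar>c\<bar> * real (Suc k) powr \<kappa> + C * real (Suc k) powr \<kappa>"
      using assms by (intro add_mono mult_right_mono mult_left_mono powr_mono) auto
    finally show ?thesis by (simp add: distrib_right)
  qed
  show summ: "summable (\<lambda>k. w (Suc k) * exp (- (\<beta> * real (Suc k))))"
  proof (rule summable_comparison_test_ev)
    show "\<forall>\<^sub>F k in sequentially. norm (w (Suc k) * exp (- (\<beta> * real (Suc k)))) \<le> (\<bar>c\<bar> + C) * (1 / real k ^ 2)"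
    proof -
      have "(\<lambda>k. real (Suc k) powr \<kappa> * exp (- (\<beta> * real (Suc k))) * real k ^ 2) \<longlonglongrightarrow> 0"
        using assms by real_asymp
      then have "\<forall>\<^sub>F k in sequentially. real (Suc k) powr \<kappa> * exp (- (\<beta> * real (Suc k))) * real k ^ 2 < 1"
        by (rule order_tendstoD) simp
      then show ?thesis using eventually_gt_at_top[of 0]
      proof eventually_elim
        case (elim k)
        have "norm (w (Suc k) * exp (- (\<beta> * real (Suc k)))) = w (Suc k) * exp (- (\<beta> * real (Suc k)))"
          using w[of "Suc k"] by simp
        also have "\<dots> \<le> ((\<bar>c\<bar> + C) * real (Suc k) powr \<kappa>) * exp (- (\<beta> * real (Suc k)))"
          by (intro mult_right_mono wle) auto
        also have "\<dots> = (\<bar>c\<bar> + C) * (real (Suc k) powr \<kappa> * exp (- (\<beta> * real (Suc k))))"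
          by (rule mult.assoc)
        also have "\<dots> \<le> (\<bar>c\<bar> + C) * (1 / real k ^ 2)"
          using elim assms by (intro mult_left_mono) (auto simp: field_simps)
        finally show ?case .
      qed
    qed
    show "summable (\<lambda>k. (\<bar>c\<bar> + C) * (1 / real k ^ 2))"
      using inverse_power_summable[of 2, where ?'a = real] by (intro summable_mult) (simp add: inverse_eq_divide)
  qed
  have Wint: "integrable lborel (\<lambda>x. indicator {0..} x * (weight_sum w x * exp (- (\<beta> * x))))"
    by (rule laplace_weight_sum_integral(1)[OF w assms(6) summ])
  have eq: "(\<Sum>k. w (Suc k) * exp (- (\<beta> * real (Suc k)))) = \<beta> * (\<integral>x. indicator {0..} x * (weight_sum w x * exp (- (\<beta> * x))) \<partial>lborel)"
    by (rule laplace_weight_sum_integral(2)[OF w assms(6) summ])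
  have G: "has_bochner_integral lborel (\<lambda>x. indicator {0..} x * (x powr a * exp (- (\<beta> * x)))) (Gamma (a + 1) * \<beta> powr (- (a + 1)))" if "a > 0" for a
    using has_bochner_integral_Gamma[of "a + 1" \<beta>] that assms by simp
  have "\<bar>(\<integral>x. indicator {0..} x * (weight_sum w x * exp (- (\<beta> * x))) - c * (indicator {0..} x * (x powr \<kappa> * exp (- (\<beta> * x)))) \<partial>lborel)\<bar>
      \<le> (\<integral>x. C * (indicator {0..} x * (x powr (\<kappa> - \<delta>) * exp (- (\<beta> * x)))) \<partial>lborel)"
    unfolding real_norm_def[symmetric]
  proof (rule Bochner_Integration.integral_norm_bound_integral)
    show "integrable lborel (\<lambda>x. indicator {0..} x * (weight_sum w x * exp (- (\<beta> * x))) - c * (indicator {0..} x * (x powr \<kappa> * exp (- (\<beta> * x)))))"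
      using Wint G[of \<kappa>] assms by (intro Bochner_Integration.integrable_diff integrable_mult_right) (auto simp: has_bochner_integral_iff)
    show "integrable lborel (\<lambda>x. C * (indicator {0..} x * (x powr (\<kappa> - \<delta>) * exp (- (\<beta> * x)))))"
      using G[of "\<kappa> - \<delta>"] assms by (intro integrable_mult_right) (auto simp: has_bochner_integral_iff)
    fix x :: real
    have "\<bar>weight_sum w x - c * x powr \<kappa>\<bar> * exp (- (\<beta> * x)) \<le> C * x powr (\<kappa> - \<delta>) * exp (- (\<beta> * x))" if "x \<ge> 0"
      using W[of x] that by (intro mult_right_mono) (cases "x = 0"; auto simp: weight_sum_def)+
    then show "norm (indicator {0..} x * (weight_sum w x * exp (- (\<beta> * x))) - c * (indicator {0..} x * (x powr \<kappa> * exp (- (\<beta> * x)))))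
        \<le> C * (indicator {0..} x * (x powr (\<kappa> - \<delta>) * exp (- (\<beta> * x))))"
      by (cases "x \<ge> 0") (auto simp: abs_mult_pos left_diff_distrib[symmetric] mult.assoc[symmetric])
  qed
  also have "\<dots> = C * (Gamma (\<kappa> - \<delta> + 1) * \<beta> powr (- (\<kappa> - \<delta> + 1)))"
    using G[of "\<kappa> - \<delta>"] assms by (simp add: has_bochner_integral_iff)
  also have "(\<integral>x. indicator {0..} x * (weight_sum w x * exp (- (\<beta> * x))) - c * (indicator {0..} x * (x powr \<kappa> * exp (- (\<beta> * x)))) \<partial>lborel)
     = (\<integral>x. indicator {0..} x * (weight_sum w x * exp (- (\<beta> * x))) \<partial>lborel) - c * (Gamma (\<kappa> + 1) * \<beta> powr (- (\<kappa> + 1)))"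
    using G[of \<kappa>] Wint assms by (simp add: has_bochner_integral_iff)
  finally have b: "\<beta> * \<bar>(\<integral>x. indicator {0..} x * (weight_sum w x * exp (- (\<beta> * x))) \<partial>lborel) - c * (Gamma (\<kappa> + 1) * \<beta> powr (- (\<kappa> + 1)))\<bar>
     \<le> \<beta> * (C * (Gamma (\<kappa> - \<delta> + 1) * \<beta> powr (- (\<kappa> - \<delta> + 1))))"
    using assms by (intro mult_left_mono) auto
  have pb: "\<beta> * \<beta> powr (- (a + 1)) = \<beta> powr (- a)" for a
    using powr_mult_base[of \<beta> "- (a + 1)"] assms by simp
  show "\<bar>(\<Sum>k. w (Suc k) * exp (- (\<beta> * real (Suc k)))) - c * Gamma (\<kappa> + 1) * \<beta> powr (- \<kappa>)\<bar>
       \<le> C * Gamma (\<kappa> - \<delta> + 1) * \<beta> powr (- (\<kappa> - \<delta>))"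
  proof -
    define X where "X = (\<integral>x. indicator {0..} x * (weight_sum w x * exp (- (\<beta> * x))) \<partial>lborel)"
    define P where "P = \<beta> powr (- (\<kappa> + 1))"
    define Q where "Q = \<beta> powr (- (\<kappa> - \<delta> + 1))"
    have "\<beta> * X - c * Gamma (\<kappa> + 1) * (\<beta> * P) = \<beta> * (X - c * (Gamma (\<kappa> + 1) * P))"
      by (simp only: right_diff_distrib mult_ac)
    then have "\<bar>\<beta> * X - c * Gamma (\<kappa> + 1) * (\<beta> * P)\<bar> = \<beta> * \<bar>X - c * (Gamma (\<kappa> + 1) * P)\<bar>"
      using assms by (simp only: abs_mult abs_of_pos)
    also have "\<dots> \<le> \<beta> * (C * (Gamma (\<kappa> - \<delta> + 1) * Q))"
      using b unfolding X_def P_def Q_def .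
    also have "\<dots> = C * Gamma (\<kappa> - \<delta> + 1) * (\<beta> * Q)" by (simp only: mult_ac)
    finally show ?thesis unfolding eq P_def Q_def pb X_def .
  qed
qed

lemma summable_Suc_powr_neg:
  assumes "s > (1::real)" shows "summable (\<lambda>j. real (Suc j) powr (- s))"
  using summable_real_powr_iff[of "- s"] assms by (subst summable_Suc_iff) simp

text \<open>
  For \<open>q \<ge> 1\<close>, \<open>moment b q \<alpha>\<close> is \<open>(-1)^q\<close> times the \<open>q\<close>-th derivative of \<open>ln f\<^sub>b(e\<^sup>-\<^sup>\<alpha>)\<close>, expanded as a double
  series over the parts \<open>k\<close> and the exponents \<open>j\<close> of the logarithmic series.
\<close>

definition moment_term :: "(nat \<Rightarrow> real) \<Rightarrow> nat \<Rightarrow> real \<Rightarrow> nat \<times> nat \<Rightarrow> real" where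
  "moment_term c q \<alpha> = (\<lambda>(j, k). c (Suc k) * real (Suc k) ^ q * real (Suc j) ^ (q - 1) * exp (- (\<alpha> * real (Suc j) * real (Suc k))))"

definition moment :: "(nat \<Rightarrow> real) \<Rightarrow> nat \<Rightarrow> real \<Rightarrow> real" where
  "moment c q \<alpha> = infsum (moment_term c q \<alpha>) UNIV"

definition laplace_sum :: "(nat \<Rightarrow> real) \<Rightarrow> nat \<Rightarrow> real \<Rightarrow> real" where
  "laplace_sum c q \<beta> = (\<Sum>k. c (Suc k) * real (Suc k) ^ q * exp (- (\<beta> * real (Suc k))))"

section \<open>Consequences of the estimate for the partial sums\<close>

locale power_weights =
  fixes b :: "nat \<Rightarrow> real" and \<rho> A \<delta> C :: real
  assumes weight_nonneg: "\<And>k. k \<ge> 1 \<Longrightarrow> b k \<ge> 0"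
    and rho_pos: "\<rho> > 0" and A_pos: "A > 0" and delta_pos: "\<delta> > 0" and delta_less: "\<delta> < \<rho>" and C_nonneg: "C \<ge> 0"
    and weight_sum_bound: "\<And>x. x > 0 \<Longrightarrow> \<bar>weight_sum b x - A / \<rho> * x powr \<rho>\<bar> \<le> C * x powr (\<rho> - \<delta>)"
begin

text \<open>One summation by parts per step: the factors (\<rho> + q) / (\<rho> + q + 1) telescope
  the constant to A / (\<rho> + q), and each step doubles the error constant.\<close>

lemma power_weight_sum_bound:
  assumes "x > 0"
  shows "\<bar>weight_sum (\<lambda>k. real k ^ q * b k) x - A / (\<rho> + real q) * x powr (\<rho> + real q)\<bar> \<le> 2 ^ q * C * x powr (\<rho> + real q - \<delta>)"
  using assms
proof (induction q arbitrary: x)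
  case 0
  then show ?case using weight_sum_bound by simp
next
  case (Suc q)
  have "\<bar>weight_sum (\<lambda>k. real k * (real k ^ q * b k)) x - A / (\<rho> + real q) * (\<rho> + real q) / (\<rho> + real q + 1) * x powr (\<rho> + real q + 1)\<bar>
     \<le> 2 * (2 ^ q * C) * x powr (\<rho> + real q + 1 - \<delta>)"
    using rho_pos delta_pos delta_less C_nonneg Suc.prems
    by (intro weight_sum_times_id_bound Suc.IH) auto
  moreover have "A / (\<rho> + real q) * (\<rho> + real q) = A" using rho_pos by simp
  ultimately show ?case by (simp add: add_ac mult_ac)
qed

lemma laplace_sum_bound:
  assumes "\<beta> > 0"
  shows "summable (\<lambda>k. b (Suc k) * real (Suc k) ^ q * exp (- (\<beta> * real (Suc k))))"
    and "\<bar>laplace_sum b q \<beta> - A * Gamma (\<rho> + real q) * \<beta> powr (- (\<rho> + real q))\<bar>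
      \<le> 2 ^ q * C * Gamma (\<rho> + real q - \<delta> + 1) * \<beta> powr (- (\<rho> + real q - \<delta>))"
proof -
  note L = laplace_weight_sum[where w = "\<lambda>k. real k ^ q * b k" and c = "A / (\<rho> + real q)" and \<kappa> = "\<rho> + real q" and C = "2 ^ q * C" and \<delta> = \<delta> and \<beta> = \<beta>]
  have prems: "\<And>k. k \<ge> 1 \<Longrightarrow> real k ^ q * b k \<ge> 0" "\<delta> < \<rho> + real q" "2 ^ q * C \<ge> 0"
    using weight_nonneg C_nonneg delta_less by auto
  have eq: "A / (\<rho> + real q) * Gamma (\<rho> + real q + 1) = A * Gamma (\<rho> + real q)"
  proof -
    have "\<rho> + real q \<notin> \<int>\<^sub>\<le>\<^sub>0" using rho_pos by (auto elim!: nonpos_Ints_cases)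
    then show ?thesis using rho_pos by (simp add: Gamma_plus1)
  qed
  show "summable (\<lambda>k. b (Suc k) * real (Suc k) ^ q * exp (- (\<beta> * real (Suc k))))"
    using L(1)[OF prems(1) power_weight_sum_bound delta_pos prems(2,3) assms] by (simp add: mult_ac)
  show "\<bar>laplace_sum b q \<beta> - A * Gamma (\<rho> + real q) * \<beta> powr (- (\<rho> + real q))\<bar>
      \<le> 2 ^ q * C * Gamma (\<rho> + real q - \<delta> + 1) * \<beta> powr (- (\<rho> + real q - \<delta>))"
    using L(2)[OF prems(1) power_weight_sum_bound delta_pos prems(2,3) assms]
    unfolding eq laplace_sum_def by (simp only: mult.commute[of "b _"])
qed

lemma moment_term_nonneg:
  assumes "\<And>k. k \<ge> 1 \<Longrightarrow> c k \<ge> 0" shows "moment_term c q \<alpha> p \<ge> 0"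
  using assms by (cases p) (simp add: moment_term_def)

text \<open>Row j is j^(q-1) times a Laplace sum at \<alpha> j, with main term proportional to
  j^(q-1) (\<alpha> j)^(-(\<rho> + q)) = \<alpha>^(-(\<rho> + q)) j^(-(\<rho> + 1)). The resulting
  power of j does not depend on q, so \<zeta>(\<rho> + 1) appears in every moment; the errors sum to
  \<zeta>(\<rho> + 1 - \<delta>), finite because \<delta> < \<rho>.\<close>

lemma
  assumes "q \<ge> 1" "\<alpha> > 0"
  shows moment_term_summable: "moment_term b q \<alpha> summable_on UNIV"
    and moment_bound: "\<bar>moment b q \<alpha> - A * Gamma (\<rho> + real q) * zeta_real (\<rho> + 1) * \<alpha> powr (- (\<rho> + real q))\<bar>
      \<le> 2 ^ q * C * Gamma (\<rho> + real q - \<delta> + 1) * zeta_real (\<rho> + 1 - \<delta>) * \<alpha> powr (- (\<rho> + real q - \<delta>))"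
proof -
  define g where "g j = real (Suc j) ^ (q - 1) * laplace_sum b q (\<alpha> * real (Suc j))" for j
  define c1 where "c1 = A * Gamma (\<rho> + real q) * \<alpha> powr (- (\<rho> + real q))"
  define c2 where "c2 = 2 ^ q * C * Gamma (\<rho> + real q - \<delta> + 1) * \<alpha> powr (- (\<rho> + real q - \<delta>))"
  have row: "((\<lambda>k. moment_term b q \<alpha> (j, k)) has_sum g j) UNIV" for j
  proof (rule sums_nonneg_imp_has_sum)
    have "(\<lambda>k. b (Suc k) * real (Suc k) ^ q * exp (- ((\<alpha> * real (Suc j)) * real (Suc k)))) sums laplace_sum b q (\<alpha> * real (Suc j))"
      unfolding laplace_sum_def using assms by (intro summable_sums laplace_sum_bound(1)) auto
    then have "(\<lambda>k. real (Suc j) ^ (q - 1) * (b (Suc k) * real (Suc k) ^ q * exp (- ((\<alpha> * real (Suc j)) * real (Suc k))))) sums g j"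
      unfolding g_def by (rule sums_mult)
    then show "(\<lambda>k. moment_term b q \<alpha> (j, k)) sums g j"
      by (simp add: moment_term_def mult_ac)
  qed (rule moment_term_nonneg[OF weight_nonneg])
  have pw: "real (Suc j) ^ (q - 1) * (\<alpha> * real (Suc j)) powr (- (s + real q)) = \<alpha> powr (- (s + real q)) * real (Suc j) powr (- (s + 1))" for j s
  proof -
    have "real (Suc j) ^ (q - 1) = real (Suc j) powr (real q - 1)"
      using assms by (subst powr_realpow[symmetric]) auto
    moreover have "(\<alpha> * real (Suc j)) powr (- (s + real q)) = \<alpha> powr (- (s + real q)) * real (Suc j) powr (- (s + real q))"
      using assms by (simp add: powr_mult)
    moreover have "real (Suc j) powr (real q - 1) * real (Suc j) powr (- (s + real q)) = real (Suc j) powr (- (s + 1))"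
    proof -
      have "(real q - 1) + - (s + real q) = - (s + 1)" by simp
      then show ?thesis unfolding powr_add[symmetric] by (rule arg_cong)
    qed
    ultimately show ?thesis by (simp only: mult_ac)
  qed
  have gb: "\<bar>g j - c1 * real (Suc j) powr (- (\<rho> + 1))\<bar> \<le> c2 * real (Suc j) powr (- (\<rho> + 1 - \<delta>))" for j
  proof -
    have "real (Suc j) ^ (q - 1) * \<bar>laplace_sum b q (\<alpha> * real (Suc j)) - A * Gamma (\<rho> + real q) * (\<alpha> * real (Suc j)) powr (- (\<rho> + real q))\<bar>
      \<le> real (Suc j) ^ (q - 1) * (2 ^ q * C * Gamma (\<rho> + real q - \<delta> + 1) * (\<alpha> * real (Suc j)) powr (- (\<rho> + real q - \<delta>)))"
      using assms by (intro mult_left_mono laplace_sum_bound(2)) auto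
    also have "\<dots> = 2 ^ q * C * Gamma (\<rho> + real q - \<delta> + 1) * (real (Suc j) ^ (q - 1) * (\<alpha> * real (Suc j)) powr (- ((\<rho> - \<delta>) + real q)))"
      by (simp add: algebra_simps del: of_nat_Suc)
    also have "\<dots> = c2 * real (Suc j) powr (- (\<rho> + 1 - \<delta>))"
      unfolding pw c2_def by (simp add: algebra_simps del: of_nat_Suc)
    finally have "\<bar>real (Suc j) ^ (q - 1) * (laplace_sum b q (\<alpha> * real (Suc j)) - A * Gamma (\<rho> + real q) * (\<alpha> * real (Suc j)) powr (- (\<rho> + real q)))\<bar> \<le> \<dots>"
      by (simp add: abs_mult del: of_nat_Suc)
    moreover have "real (Suc j) ^ (q - 1) * (laplace_sum b q (\<alpha> * real (Suc j)) - A * Gamma (\<rho> + real q) * (\<alpha> * real (Suc j)) powr (- (\<rho> + real q)))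
      = g j - A * Gamma (\<rho> + real q) * (real (Suc j) ^ (q - 1) * (\<alpha> * real (Suc j)) powr (- (\<rho> + real q)))"
      by (simp add: g_def algebra_simps del: of_nat_Suc)
    moreover have "A * Gamma (\<rho> + real q) * (real (Suc j) ^ (q - 1) * (\<alpha> * real (Suc j)) powr (- (\<rho> + real q))) = c1 * real (Suc j) powr (- (\<rho> + 1))"
      unfolding pw c1_def by (simp only: mult_ac)
    ultimately show ?thesis by (simp only:)
  qed
  have z: "(\<lambda>j. real (Suc j) powr (- s)) sums zeta_real s" if "s > 1" for s
    using summable_Suc_powr_neg[OF that] unfolding zeta_real_def
    by (simp add: sums_iff powr_minus_divide)
  have z1: "(\<lambda>j. c1 * real (Suc j) powr (- (\<rho> + 1))) sums (c1 * zeta_real (\<rho> + 1))"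
    and z2: "(\<lambda>j. c2 * real (Suc j) powr (- (\<rho> + 1 - \<delta>))) sums (c2 * zeta_real (\<rho> + 1 - \<delta>))"
    using rho_pos delta_less by (intro sums_mult z; linarith)+
  have dsum: "summable (\<lambda>j. norm (g j - c1 * real (Suc j) powr (- (\<rho> + 1))))"
    by (rule summable_comparison_test[OF _ sums_summable[OF z2]]) (use gb in auto)
  have "summable (\<lambda>j. (g j - c1 * real (Suc j) powr (- (\<rho> + 1))) + c1 * real (Suc j) powr (- (\<rho> + 1)))"
    by (intro summable_add summable_norm_cancel[OF dsum] sums_summable[OF z1])
  then have gsum: "summable g" by simp
  have g0: "g j \<ge> 0" for j
    by (rule has_sum_nonneg[OF row]) (rule moment_term_nonneg[OF weight_nonneg])
  have ghs: "(g has_sum suminf g) UNIV"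
    using gsum g0 by (intro sums_nonneg_imp_has_sum) (auto simp: sums_iff)
  have "moment_term b q \<alpha> summable_on (UNIV \<times> UNIV)"
    by (rule summable_on_SigmaI[OF row]) (use ghs in \<open>auto intro: moment_term_nonneg weight_nonneg has_sum_imp_summable\<close>)
  then show summ: "moment_term b q \<alpha> summable_on UNIV" by simp
  have "(moment_term b q \<alpha> has_sum suminf g) (UNIV \<times> UNIV)"
    using summ by (intro has_sum_SigmaI[OF row ghs]) auto
  then have m: "moment b q \<alpha> = suminf g" by (simp add: moment_def infsumI)
  have "\<bar>suminf (\<lambda>j. g j - c1 * real (Suc j) powr (- (\<rho> + 1)))\<bar> \<le> (\<Sum>j. c2 * real (Suc j) powr (- (\<rho> + 1 - \<delta>)))"
    using dsum gb z2 by (intro order_trans[OF summable_rabs suminf_le]) (auto simp: sums_iff)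
  also have "suminf (\<lambda>j. g j - c1 * real (Suc j) powr (- (\<rho> + 1))) = suminf g - c1 * zeta_real (\<rho> + 1)"
    using z1 gsum by (subst suminf_diff[symmetric]) (auto simp: sums_iff)
  also have "(\<Sum>j. c2 * real (Suc j) powr (- (\<rho> + 1 - \<delta>))) = c2 * zeta_real (\<rho> + 1 - \<delta>)"
    using z2 by (simp only: sums_iff)
  finally show "\<bar>moment b q \<alpha> - A * Gamma (\<rho> + real q) * zeta_real (\<rho> + 1) * \<alpha> powr (- (\<rho> + real q))\<bar>
      \<le> 2 ^ q * C * Gamma (\<rho> + real q - \<delta> + 1) * zeta_real (\<rho> + 1 - \<delta>) * \<alpha> powr (- (\<rho> + real q - \<delta>))"
    unfolding m c1_def c2_def by (simp only: mult_ac)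
qed

lemma zeta_real_pos: "s > 1 \<Longrightarrow> zeta_real s > 0"
  unfolding zeta_real_def
  using summable_Suc_powr_neg[of s] by (intro suminf_pos) (auto simp: powr_minus_divide)

lemma moment_asymptotic:
  assumes "q \<ge> 1"
  shows "((\<lambda>\<alpha>. \<alpha> powr (\<rho> + real q) * moment b q \<alpha>) \<longlongrightarrow> A * Gamma (\<rho> + real q) * zeta_real (\<rho> + 1)) (at_right 0)"
proof (rule Lim_transform)
  define c where "c = A * Gamma (\<rho> + real q) * zeta_real (\<rho> + 1)"
  define E where "E = 2 ^ q * C * Gamma (\<rho> + real q - \<delta> + 1) * zeta_real (\<rho> + 1 - \<delta>)"
  show "((\<lambda>\<alpha>. A * Gamma (\<rho> + real q) * zeta_real (\<rho> + 1)) \<longlongrightarrow> A * Gamma (\<rho> + real q) * zeta_real (\<rho> + 1)) (at_right 0)"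
    by simp
  show "((\<lambda>\<alpha>. \<alpha> powr (\<rho> + real q) * moment b q \<alpha> - A * Gamma (\<rho> + real q) * zeta_real (\<rho> + 1)) \<longlongrightarrow> 0) (at_right 0)"
    unfolding c_def[symmetric]
  proof (rule Lim_null_comparison)
    show "\<forall>\<^sub>F \<alpha> in at_right 0. norm (\<alpha> powr (\<rho> + real q) * moment b q \<alpha> - c) \<le> E * \<alpha> powr \<delta>"
      using eventually_at_right_less[of 0]
    proof eventually_elim
      case (elim \<alpha>)
      have one: "\<alpha> powr (\<rho> + real q) * \<alpha> powr (- (\<rho> + real q)) = 1" using elim by (simp add: powr_add[symmetric])
      have "\<alpha> powr (\<rho> + real q) * \<bar>moment b q \<alpha> - c * \<alpha> powr (- (\<rho> + real q))\<bar> \<le> \<alpha> powr (\<rho> + real q) * (E * \<alpha> powr (- (\<rho> + real q - \<delta>)))"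
        unfolding c_def E_def by (intro mult_left_mono moment_bound assms elim) auto
      also have "\<dots> = E * (\<alpha> powr (\<rho> + real q) * \<alpha> powr (- (\<rho> + real q - \<delta>)))" by (simp only: mult_ac)
      also have "\<alpha> powr (\<rho> + real q) * \<alpha> powr (- (\<rho> + real q - \<delta>)) = \<alpha> powr \<delta>" by (simp add: powr_add[symmetric])
      also have "\<alpha> powr (\<rho> + real q) * \<bar>moment b q \<alpha> - c * \<alpha> powr (- (\<rho> + real q))\<bar> = \<bar>\<alpha> powr (\<rho> + real q) * (moment b q \<alpha> - c * \<alpha> powr (- (\<rho> + real q)))\<bar>"
        by (simp add: abs_mult)
      also have "\<alpha> powr (\<rho> + real q) * (moment b q \<alpha> - c * \<alpha> powr (- (\<rho> + real q))) = \<alpha> powr (\<rho> + real q) * moment b q \<alpha> - c"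
        using one by (simp add: right_diff_distrib mult.left_commute[of _ c])
      finally show ?case by simp
    qed
    show "((\<lambda>\<alpha>. E * \<alpha> powr \<delta>) \<longlongrightarrow> 0) (at_right 0)"
      using delta_pos by real_asymp
  qed
qed

end

section \<open>The weight beyond a cutoff\<close>

text \<open>The Laplace integral for the weights beyond m, after the substitution x = (w + y) /
  \<alpha>: the cutoff moves to y = 0, the factor \<open>exp (- w)\<close> comes out, and what
  remains depends only on increments of the partial sums past the cutoff.\<close>

lemma tail_sum_integral:
  fixes b :: "nat \<Rightarrow> real" and \<alpha> :: real and m :: nat
  assumes b: "\<And>k. k \<ge> 1 \<Longrightarrow> b k \<ge> 0" and "\<alpha> > 0"
    and summ: "summable (\<lambda>k. b (Suc k) * exp (- (\<alpha> * real (Suc k))))"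
  defines "w \<equiv> \<alpha> * real m"
  shows "(\<Sum>k. (if Suc k \<le> m then 0 else b (Suc k)) * exp (- (\<alpha> * real (Suc k)))) =
     exp (- w) * (\<integral>y. indicator {0..} y * ((weight_sum b ((w + y) / \<alpha>) - weight_sum b (w / \<alpha>)) * exp (- y)) \<partial>lborel)"
proof -
  define b' where "b' k = (if k \<le> m then 0 else b k)" for k
  have b': "b' k \<ge> 0" if "k \<ge> 1" for k using b that by (simp add: b'_def)
  have summ': "summable (\<lambda>k. b' (Suc k) * exp (- (\<alpha> * real (Suc k))))"
    by (rule summable_comparison_test'[OF summ, of 0]) (use b in \<open>auto simp: b'_def\<close>)
  have wa: "w / \<alpha> = real m" using assms by (simp add: w_def)
  have W: "weight_sum b' ((w + y) / \<alpha>) = indicator {0..} y * (weight_sum b ((w + y) / \<alpha>) - weight_sum b (w / \<alpha>))" for y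
  proof (cases "y \<ge> 0")
    case True
    define N where "N = nat \<lfloor>(w + y) / \<alpha>\<rfloor>"
    have "real m \<le> (w + y) / \<alpha>" using True assms by (simp add: w_def field_simps)
    then have N: "m \<le> N" unfolding N_def by linarith
    have "weight_sum b ((w + y) / \<alpha>) - weight_sum b (w / \<alpha>) = sum b {1..N} - sum b {1..m}"
      unfolding wa by (simp add: weight_sum_def N_def)
    also have "\<dots> = sum b ({1..N} - {1..m})" using N by (subst sum_diff) auto
    also have "\<dots> = sum b' {1..N}"
      by (rule sum.mono_neutral_cong_left) (auto simp: b'_def)
    finally show ?thesis using True by (simp add: weight_sum_def N_def)
  next
    case False
    have "(w + y) / \<alpha> < real m" using False assms by (simp add: w_def field_simps)
    then have "nat \<lfloor>(w + y) / \<alpha>\<rfloor> \<le> m" by linarith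
    then have "weight_sum b' ((w + y) / \<alpha>) = 0" by (auto simp: weight_sum_def b'_def intro!: sum.neutral)
    then show ?thesis using False by simp
  qed
  have "(\<Sum>k. b' (Suc k) * exp (- (\<alpha> * real (Suc k)))) = \<alpha> * (\<integral>x. indicator {0..} x * (weight_sum b' x * exp (- (\<alpha> * x))) \<partial>lborel)"
    by (rule laplace_weight_sum_integral(2)[OF b' assms(2) summ'])
  also have "(\<integral>x. indicator {0..} x * (weight_sum b' x * exp (- (\<alpha> * x))) \<partial>lborel) =
     (1 / \<alpha>) * (\<integral>y. indicator {0..} (w / \<alpha> + (1 / \<alpha>) * y) * (weight_sum b' (w / \<alpha> + (1 / \<alpha>) * y) * exp (- (\<alpha> * (w / \<alpha> + (1 / \<alpha>) * y)))) \<partial>lborel)"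
    using assms by (subst lborel_integral_real_affine[where c = "1 / \<alpha>" and t = "w / \<alpha>"]) auto
  also have "(\<lambda>y. indicator {0..} (w / \<alpha> + (1 / \<alpha>) * y) * (weight_sum b' (w / \<alpha> + (1 / \<alpha>) * y) * exp (- (\<alpha> * (w / \<alpha> + (1 / \<alpha>) * y))))) =
     (\<lambda>y. exp (- w) * (indicator {0..} y * ((weight_sum b ((w + y) / \<alpha>) - weight_sum b (w / \<alpha>)) * exp (- y))))"
  proof
    fix y
    have e: "w / \<alpha> + (1 / \<alpha>) * y = (w + y) / \<alpha>" by (simp add: add_divide_distrib)
    have e2: "\<alpha> * ((w + y) / \<alpha>) = w + y" using assms by simp
    have ex: "exp (- (w + y)) = exp (- w) * exp (- y)" unfolding exp_add[symmetric] by simp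
    have ind: "indicator {0..} ((w + y) / \<alpha>) = (1::real)" if "y \<ge> 0" using that assms by (simp add: w_def)
    show "indicator {0..} (w / \<alpha> + (1 / \<alpha>) * y) * (weight_sum b' (w / \<alpha> + (1 / \<alpha>) * y) * exp (- (\<alpha> * (w / \<alpha> + (1 / \<alpha>) * y)))) =
       exp (- w) * (indicator {0..} y * ((weight_sum b ((w + y) / \<alpha>) - weight_sum b (w / \<alpha>)) * exp (- y)))"
      unfolding e e2 W ex by (cases "y \<ge> 0") (use ind in auto)
  qed
  finally show ?thesis using assms(2) by (simp add: b'_def)
qed

text \<open>Follows from ln (1 + x) \<le> x. The factor (1 + x)^\<rho> on the right lets one bound
  serve for exponents below and above 1; it supplies the dominating function in
  \<open>tail_sum_asymptotic\<close>.\<close>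

lemma one_plus_powr_minus_one_le:
  fixes x \<rho> :: real
  assumes "x \<ge> 0" "\<rho> \<ge> 0"
  shows "0 \<le> (1 + x) powr \<rho> - 1" "(1 + x) powr \<rho> - 1 \<le> \<rho> * x * (1 + x) powr \<rho>"
proof -
  show "0 \<le> (1 + x) powr \<rho> - 1" using assms by (simp add: ge_one_powr_ge_zero)
  have "1 - \<rho> * ln (1 + x) \<le> exp (- (\<rho> * ln (1 + x)))"
    using exp_ge_add_one_self[of "- (\<rho> * ln (1 + x))"] by simp
  moreover have "ln (1 + x) \<le> x" using assms by (intro ln_add_one_self_le_self) auto
  then have "\<rho> * ln (1 + x) \<le> \<rho> * x" using assms by (intro mult_left_mono)
  ultimately have "1 - \<rho> * x \<le> (1 + x) powr (- \<rho>)" using assms by (simp add: powr_def)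
  then have "(1 - \<rho> * x) * (1 + x) powr \<rho> \<le> (1 + x) powr (- \<rho>) * (1 + x) powr \<rho>"
    by (intro mult_right_mono) auto
  also have "\<dots> = 1" using assms by (simp add: powr_add[symmetric])
  finally show "(1 + x) powr \<rho> - 1 \<le> \<rho> * x * (1 + x) powr \<rho>" by (simp add: algebra_simps)
qed

context power_weights
begin

definition tail_sum :: "nat \<Rightarrow> real \<Rightarrow> real" where
  "tail_sum m \<alpha> = (\<Sum>k. (if Suc k \<le> m then 0 else b (Suc k)) * exp (- (\<alpha> * real (Suc k))))"

lemma weight_exp_summable:
  "\<beta> > 0 \<Longrightarrow> summable (\<lambda>k. b (Suc k) * exp (- (\<beta> * real (Suc k))))"
  using laplace_sum_bound(1)[of \<beta> 0] by simp

text \<open>With w = \<alpha> m, the increment of the partial sums from w / \<alpha> to (w + y) /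
  \<alpha> is about A y w^(\<rho> - 1) \<alpha>^(-\<rho>), and y \<open>exp (- y)\<close> has
  integral 1. The increment is smaller than the partial sum by a factor of order 1 / w, so the
  saving \<alpha>^\<delta> must beat w; this is the assumption \<open>err\<close>.\<close>

lemma tail_sum_asymptotic:
  fixes \<alpha> :: "nat \<Rightarrow> real" and m :: "nat \<Rightarrow> nat"
  assumes pos: "\<And>n. \<alpha> n > 0"
    and w_lim: "filterlim (\<lambda>n. \<alpha> n * real (m n)) at_top sequentially"
    and err: "(\<lambda>n. \<alpha> n powr \<delta> * (\<alpha> n * real (m n))) \<longlonglongrightarrow> 0"
  shows "(\<lambda>n. tail_sum (m n) (\<alpha> n) * exp (\<alpha> n * real (m n)) * \<alpha> n powr \<rho> / (\<alpha> n * real (m n)) powr (\<rho> - 1)) \<longlonglongrightarrow> A"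
proof -
  define w where "w n = \<alpha> n * real (m n)" for n
  define F where "F n y = indicator {0..} y * ((weight_sum b ((w n + y) / \<alpha> n) - weight_sum b (w n / \<alpha> n)) * exp (- y)) * (\<alpha> n powr \<rho> / w n powr (\<rho> - 1))" for n y
  have tail_eq: "tail_sum (m n) (\<alpha> n) * exp (w n) * \<alpha> n powr \<rho> / w n powr (\<rho> - 1) = (\<integral>y. F n y \<partial>lborel)" for n
  proof -
    define X where "X = (\<integral>y. indicator {0..} y * ((weight_sum b ((w n + y) / \<alpha> n) - weight_sum b (w n / \<alpha> n)) * exp (- y)) \<partial>lborel)"
    have "tail_sum (m n) (\<alpha> n) = exp (- w n) * X"
      unfolding tail_sum_def w_def X_def
      by (rule tail_sum_integral[OF weight_nonneg pos weight_exp_summable[OF pos]])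
    then have "tail_sum (m n) (\<alpha> n) * exp (w n) = X" by (simp add: exp_minus)
    moreover have "(\<integral>y. F n y \<partial>lborel) = X * (\<alpha> n powr \<rho> / w n powr (\<rho> - 1))"
      unfolding F_def X_def by (rule integral_mult_left_zero)
    ultimately show ?thesis by simp
  qed
  \<comment> \<open>The main term (A / \<rho>) x^\<rho> differenced between the two points and
    normalised like F; it tends to A y by the first-order expansion of (1 + y / w)^\<rho>.\<close>
  define M where "M n y = A / \<rho> * (w n * ((1 + y / w n) powr \<rho> - 1))" for n y
  have approx: "\<bar>(weight_sum b ((w n + y) / \<alpha> n) - weight_sum b (w n / \<alpha> n)) * (\<alpha> n powr \<rho> / w n powr (\<rho> - 1)) - M n y\<bar>
      \<le> 2 * C * (\<alpha> n powr \<delta> * w n) * (1 + y) powr \<rho>" if y: "y \<ge> 0" and wn: "w n \<ge> 1" for n y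
  proof -
    define g where "g = \<alpha> n powr \<rho> / w n powr (\<rho> - 1)"
    have a0: "\<alpha> n > 0" by (rule pos)
    have g0: "g \<ge> 0" by (simp add: g_def)
    have pw: "((w n + z) / \<alpha> n) powr s * g = \<alpha> n powr (\<rho> - s) * w n powr (s - \<rho> + 1) * (1 + z / w n) powr s" if "z \<ge> 0" for s z
    proof -
      have "w n + z = w n * (1 + z / w n)" using wn by (simp add: field_simps)
      then have "((w n + z) / \<alpha> n) powr s = w n powr s * (1 + z / w n) powr s / \<alpha> n powr s"
        using wn that a0 by (simp add: powr_mult powr_divide)
      moreover have "\<alpha> n powr (\<rho> - s) = \<alpha> n powr \<rho> / \<alpha> n powr s" by (rule powr_diff)
      moreover have "w n powr (s - \<rho> + 1) = w n powr s / w n powr (\<rho> - 1)"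
        by (subst powr_diff[symmetric]) (simp add: algebra_simps)
      ultimately show ?thesis by (simp add: g_def)
    qed
    have e1: "\<bar>weight_sum b ((w n + z) / \<alpha> n) * g - A / \<rho> * (w n * (1 + z / w n) powr \<rho>)\<bar> \<le> C * (\<alpha> n powr \<delta> * w n) * (1 + y) powr \<rho>"
      if z: "z = 0 \<or> z = y" for z
    proof -
      have z0: "z \<ge> 0" "z \<le> y" using z y by auto
      have "\<bar>weight_sum b ((w n + z) / \<alpha> n) - A / \<rho> * ((w n + z) / \<alpha> n) powr \<rho>\<bar> * g \<le> C * ((w n + z) / \<alpha> n) powr (\<rho> - \<delta>) * g"
        using wn z0 a0 g0 by (intro mult_right_mono weight_sum_bound) auto
      also have "\<dots> = C * (\<alpha> n powr \<delta> * w n powr (1 - \<delta>) * (1 + z / w n) powr (\<rho> - \<delta>))"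
        using pw[OF z0(1), of "\<rho> - \<delta>"] by (simp add: mult_ac add.commute)
      also have "\<dots> \<le> C * (\<alpha> n powr \<delta> * w n powr 1 * (1 + y) powr \<rho>)"
      proof (intro mult_left_mono mult_mono)
        show "w n powr (1 - \<delta>) \<le> w n powr 1" using wn delta_pos by (intro powr_mono) auto
        have "z / w n \<le> z / 1" using wn z0 by (intro divide_left_mono) auto
        then have "1 + z / w n \<le> 1 + y" using z0 by simp
        then have "(1 + z / w n) powr (\<rho> - \<delta>) \<le> (1 + y) powr (\<rho> - \<delta>)"
          using delta_less z0 wn by (intro powr_mono2) auto
        also have "\<dots> \<le> (1 + y) powr \<rho>" using y delta_pos by (intro powr_mono) auto
        finally show "(1 + z / w n) powr (\<rho> - \<delta>) \<le> (1 + y) powr \<rho>" .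
      qed (use C_nonneg wn in auto)
      finally have "\<bar>(weight_sum b ((w n + z) / \<alpha> n) - A / \<rho> * ((w n + z) / \<alpha> n) powr \<rho>) * g\<bar> \<le> C * (\<alpha> n powr \<delta> * w n) * (1 + y) powr \<rho>"
        using g0 wn by (simp add: abs_mult)
      moreover have "(weight_sum b ((w n + z) / \<alpha> n) - A / \<rho> * ((w n + z) / \<alpha> n) powr \<rho>) * g =
          weight_sum b ((w n + z) / \<alpha> n) * g - A / \<rho> * (w n * (1 + z / w n) powr \<rho>)"
        using pw[OF z0(1), of \<rho>] wn a0 unfolding left_diff_distrib mult.assoc by simp
      ultimately show ?thesis by (simp only:)
    qed
    have "(weight_sum b ((w n + y) / \<alpha> n) - weight_sum b (w n / \<alpha> n)) * g - M n y =
      (weight_sum b ((w n + y) / \<alpha> n) * g - A / \<rho> * (w n * (1 + y / w n) powr \<rho>)) - (weight_sum b ((w n + 0) / \<alpha> n) * g - A / \<rho> * (w n * (1 + 0 / w n) powr \<rho>))"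
      by (simp add: M_def algebra_simps add_divide_distrib diff_divide_distrib)
    then have "\<bar>(weight_sum b ((w n + y) / \<alpha> n) - weight_sum b (w n / \<alpha> n)) * g - M n y\<bar> \<le>
      \<bar>weight_sum b ((w n + y) / \<alpha> n) * g - A / \<rho> * (w n * (1 + y / w n) powr \<rho>)\<bar> + \<bar>weight_sum b ((w n + 0) / \<alpha> n) * g - A / \<rho> * (w n * (1 + 0 / w n) powr \<rho>)\<bar>"
      by (simp only: abs_triangle_ineq4)
    also have "\<dots> \<le> C * (\<alpha> n powr \<delta> * w n) * (1 + y) powr \<rho> + C * (\<alpha> n powr \<delta> * w n) * (1 + y) powr \<rho>"
      by (intro add_mono e1) auto
    also have "\<dots> = 2 * C * (\<alpha> n powr \<delta> * w n) * (1 + y) powr \<rho>" by simp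
    finally show ?thesis unfolding g_def .
  qed
  have M_lim: "(\<lambda>n. M n y) \<longlonglongrightarrow> A * y" for y
  proof -
    have "((\<lambda>x::real. A / \<rho> * (x * ((1 + y / x) powr \<rho> - 1))) \<longlongrightarrow> A * y) at_top"
      using rho_pos by real_asymp
    from filterlim_compose[OF this w_lim] show ?thesis by (simp add: M_def w_def)
  qed
  have ev1: "\<forall>\<^sub>F n in sequentially. w n \<ge> 1"
    using w_lim unfolding w_def filterlim_at_top by blast
  have ev2: "\<forall>\<^sub>F n in sequentially. \<alpha> n powr \<delta> * w n \<le> 1"
    using order_tendstoD(2)[OF err, of 1] by (auto simp: w_def elim: eventually_mono)
  \<comment> \<open>The domination holds only once w n \<ge> 1 and \<alpha>^\<delta> w \<le> 1.
    Dominated convergence is therefore applied to the sequence shifted by N, and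
    \<open>LIMSEQ_offset\<close> removes the shift.\<close>
  obtain N where N: "\<And>n. n \<ge> N \<Longrightarrow> w n \<ge> 1 \<and> \<alpha> n powr \<delta> * w n \<le> 1"
    using eventually_conj[OF ev1 ev2] unfolding eventually_sequentially by blast
  define Dm where "Dm y = (A + 2 * C) * (indicator {0..} y * ((1 + y) powr (\<rho> + 1) * exp (- y)))" for y
  have Dint: "integrable lborel Dm"
  proof -
    have "has_bochner_integral lborel (\<lambda>x. indicator {0..} x * (x powr (\<rho> + 2 - 1) * exp (- (1 * x)))) (Gamma (\<rho> + 2) * 1 powr (- (\<rho> + 2)))"
      using rho_pos by (intro has_bochner_integral_Gamma) auto
    from lborel_integrable_real_affine[OF integrable.intros[OF this], of 1 1]
    have "integrable lborel (\<lambda>y. indicator {0..} (1 + y) * ((1 + y) powr (\<rho> + 1) * exp (- (1 + y))))" by (simp add: add.commute)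
    then have "integrable lborel (\<lambda>y. exp 1 * (indicator {0..} (1 + y) * ((1 + y) powr (\<rho> + 1) * exp (- (1 + y)))))" by (rule integrable_mult_right)
    then have "integrable lborel (\<lambda>y. indicator {0..} y * ((1 + y) powr (\<rho> + 1) * exp (- y)))"
    proof (rule Bochner_Integration.integrable_bound)
      show "AE y in lborel. norm (indicator {0..} y * ((1 + y) powr (\<rho> + 1) * exp (- y))) \<le> norm (exp 1 * (indicator {0..} (1 + y) * ((1 + y) powr (\<rho> + 1) * exp (- (1 + y)))))"
      proof (intro AE_I2)
        fix y :: real
        have "exp 1 * exp (- (1 + y)) = exp (- y)" unfolding exp_add[symmetric] by simp
        moreover have "exp 1 * (1 + y) powr (\<rho> + 1) * exp (- (1 + y)) = (exp 1 * exp (- (1 + y))) * (1 + y) powr (\<rho> + 1)"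
          by (simp only: mult_ac)
        ultimately have "exp 1 * (1 + y) powr (\<rho> + 1) * exp (- (1 + y)) = (1 + y) powr (\<rho> + 1) * exp (- y)"
          by (simp only: mult.commute)
        then show "norm (indicator {0..} y * ((1 + y) powr (\<rho> + 1) * exp (- y))) \<le> norm (exp 1 * (indicator {0..} (1 + y) * ((1 + y) powr (\<rho> + 1) * exp (- (1 + y)))))"
          by (cases "y \<ge> 0") (auto simp: indicator_def mult_ac)
      qed
    qed auto
    then show ?thesis unfolding Dm_def by simp
  qed
  have F_eq: "F n y = indicator {0..} y * exp (- y) * ((weight_sum b ((w n + y) / \<alpha> n) - weight_sum b (w n / \<alpha> n)) * (\<alpha> n powr \<rho> / w n powr (\<rho> - 1)))" for n y
    by (simp add: F_def mult_ac)
  have wm: "weight_sum b \<in> borel_measurable borel"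
    by (rule borel_measurable_mono) (auto intro!: monoI weight_sum_mono weight_nonneg)
  have "(\<lambda>n. \<integral>y. F (n + N) y \<partial>lborel) \<longlonglongrightarrow> (\<integral>y. indicator {0..} y * (A * y * exp (- y)) \<partial>lborel)"
  proof (rule integral_dominated_convergence[OF _ _ Dint])
    show "(\<lambda>y. indicator {0..} y * (A * y * exp (- y))) \<in> borel_measurable lborel" by measurable
    show "F (n + N) \<in> borel_measurable lborel" for n
      unfolding F_def[abs_def] using wm by measurable
    show "AE y in lborel. (\<lambda>n. F (n + N) y) \<longlonglongrightarrow> indicator {0..} y * (A * y * exp (- y))"
    proof (intro AE_I2 LIMSEQ_ignore_initial_segment)
      fix y :: real
      show "(\<lambda>n. F n y) \<longlonglongrightarrow> indicator {0..} y * (A * y * exp (- y))"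
      proof (cases "y \<ge> 0")
        case True
        have "(\<lambda>n. (weight_sum b ((w n + y) / \<alpha> n) - weight_sum b (w n / \<alpha> n)) * (\<alpha> n powr \<rho> / w n powr (\<rho> - 1)) - M n y) \<longlonglongrightarrow> 0"
        proof (rule Lim_null_comparison)
          show "\<forall>\<^sub>F n in sequentially. norm ((weight_sum b ((w n + y) / \<alpha> n) - weight_sum b (w n / \<alpha> n)) * (\<alpha> n powr \<rho> / w n powr (\<rho> - 1)) - M n y) \<le> 2 * C * (\<alpha> n powr \<delta> * w n) * (1 + y) powr \<rho>"
            using ev1 by eventually_elim (use approx[OF True] in simp)
          show "(\<lambda>n. 2 * C * (\<alpha> n powr \<delta> * w n) * (1 + y) powr \<rho>) \<longlonglongrightarrow> 0"
            using tendsto_mult_left_zero[OF tendsto_mult_right_zero[OF err, of "2 * C"], of "(1 + y) powr \<rho>"] by (simp add: w_def)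
        qed
        from tendsto_add[OF this M_lim[of y]]
        have "(\<lambda>n. (weight_sum b ((w n + y) / \<alpha> n) - weight_sum b (w n / \<alpha> n)) * (\<alpha> n powr \<rho> / w n powr (\<rho> - 1))) \<longlonglongrightarrow> A * y" by simp
        from tendsto_mult_left[OF this, of "indicator {0..} y * exp (- y)"] show ?thesis
          unfolding F_eq by (simp add: mult_ac)
      qed (simp add: F_def)
    qed
    show "AE y in lborel. norm (F (n + N) y) \<le> Dm y" for n
    proof (intro AE_I2)
      fix y :: real
      define i where "i = n + N"
      have i: "w i \<ge> 1" "\<alpha> i powr \<delta> * w i \<le> 1" using N[of i] by (auto simp: i_def)
      show "norm (F (n + N) y) \<le> Dm y"
      proof (cases "y \<ge> 0")
        case True
        have yw: "y / w i \<ge> 0" "y / w i \<le> y" using True i by (auto simp: field_simps mult_le_cancel_left1)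
        have M0: "M i y \<ge> 0" using one_plus_powr_minus_one_le(1)[OF yw(1), of \<rho>] rho_pos A_pos i
          by (simp add: M_def)
        have "M i y \<le> A / \<rho> * (w i * (\<rho> * (y / w i) * (1 + y / w i) powr \<rho>))"
          unfolding M_def using one_plus_powr_minus_one_le(2)[OF yw(1), of \<rho>] rho_pos A_pos i
          by (intro mult_left_mono) auto
        also have "\<dots> = A * (y * (1 + y / w i) powr \<rho>)" using i rho_pos by simp
        also have "\<dots> \<le> A * ((1 + y) * (1 + y) powr \<rho>)"
          using yw rho_pos A_pos True by (intro mult_left_mono mult_mono powr_mono2) auto
        also have "(1 + y) * (1 + y) powr \<rho> = (1 + y) powr (\<rho> + 1)"
          using True powr_mult_base[of "1 + y" \<rho>] by (simp add: add.commute)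
        finally have M1: "M i y \<le> A * (1 + y) powr (\<rho> + 1)" .
        have "2 * C * (\<alpha> i powr \<delta> * w i) * (1 + y) powr \<rho> \<le> 2 * C * 1 * (1 + y) powr (\<rho> + 1)"
          using C_nonneg i True by (intro mult_mono powr_mono) auto
        then have "\<bar>(weight_sum b ((w i + y) / \<alpha> i) - weight_sum b (w i / \<alpha> i)) * (\<alpha> i powr \<rho> / w i powr (\<rho> - 1))\<bar> \<le> A * (1 + y) powr (\<rho> + 1) + 2 * C * (1 + y) powr (\<rho> + 1)"
          using approx[OF True i(1)] M0 M1 by linarith
        then have "exp (- y) * \<bar>(weight_sum b ((w i + y) / \<alpha> i) - weight_sum b (w i / \<alpha> i)) * (\<alpha> i powr \<rho> / w i powr (\<rho> - 1))\<bar> \<le> exp (- y) * (A * (1 + y) powr (\<rho> + 1) + 2 * C * (1 + y) powr (\<rho> + 1))"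
          by (intro mult_left_mono) auto
        moreover have "norm (indicator {0..} y * exp (- y) * Y) = exp (- y) * \<bar>Y\<bar>" for Y :: real
          using True by (simp add: abs_mult)
        moreover have "Dm y = exp (- y) * (A * (1 + y) powr (\<rho> + 1) + 2 * C * (1 + y) powr (\<rho> + 1))"
          using True by (simp add: Dm_def algebra_simps)
        ultimately show ?thesis unfolding i_def[symmetric] F_eq by (simp only:)
      qed (simp add: F_def Dm_def)
    qed
  qed
  then have "(\<lambda>n. \<integral>y. F n y \<partial>lborel) \<longlonglongrightarrow> (\<integral>y. indicator {0..} y * (A * y * exp (- y)) \<partial>lborel)"
    by (rule LIMSEQ_offset)
  also have "(\<integral>y. indicator {0..} y * (A * y * exp (- y)) \<partial>lborel) = A"
  proof -
    have "has_bochner_integral lborel (\<lambda>x. indicator {0..} x * (x powr (2 - 1) * exp (- (1 * x)))) (Gamma 2 * 1 powr (- 2 :: real))"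
      by (intro has_bochner_integral_Gamma) auto
    moreover have "(\<lambda>x::real. indicator {0..} x * (x powr (2 - 1) * exp (- (1 * x)))) = (\<lambda>x. indicator {0..} x * (x * exp (- x)))"
      by (rule ext) (simp add: indicator_def)
    moreover have "Gamma (2::real) = 1" using Gamma_fact[of 1, where ?'a = real] by (simp add: numeral_2_eq_2)
    ultimately have "has_bochner_integral lborel (\<lambda>x::real. A * (indicator {0..} x * (x * exp (- x)))) (A * 1)"
      by (intro has_bochner_integral_mult_right) (simp only: powr_one_eq_one mult_1_right)
    then have "(\<integral>x. A * (indicator {0..} x * (x * exp (- x))) \<partial>(lborel :: real measure)) = A * 1"
      by (rule has_bochner_integral_integral_eq)
    then show ?thesis by (simp add: mult_ac)
  qed
  finally show ?thesis unfolding w_def[symmetric] tail_eq .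
qed

section \<open>The saddle point\<close>

text \<open>Termwise, \<open>exp (- x z) - exp (- y z) \<le> (y - x) z exp (- r z)\<close>, and the
  additional factor z = j k turns a term of the first moment into one of the second. This gives
  continuity and monotonicity without differentiating the double series.\<close>

lemma moment_lipschitz:
  assumes "0 < r" "r \<le> x" "x \<le> y"
  shows "moment b 1 y \<le> moment b 1 x" "moment b 1 x - moment b 1 y \<le> (y - x) * moment b 2 r"
proof -
  have s: "moment_term b 1 x summable_on UNIV" "moment_term b 1 y summable_on UNIV" "moment_term b 2 r summable_on UNIV"
    using assms by (auto intro!: moment_term_summable)
  have t1: "moment_term b 1 y p \<le> moment_term b 1 x p" for p
  proof (cases p)
    case (Pair j k)
    have "x * real (Suc j) * real (Suc k) \<le> y * real (Suc j) * real (Suc k)"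
      using assms by (intro mult_right_mono) auto
    then show ?thesis using weight_nonneg[of "Suc k"]
      unfolding Pair moment_term_def prod.case by (intro mult_left_mono) auto
  qed
  have t2: "moment_term b 1 x p \<le> (y - x) * moment_term b 2 r p + moment_term b 1 y p" for p
  proof (cases p)
    case (Pair j k)
    define z where "z = real (Suc j) * real (Suc k)"
    have z: "z \<ge> 0" by (simp add: z_def)
    have "1 - (y - x) * z \<le> exp (- ((y - x) * z))" using exp_ge_add_one_self[of "- ((y - x) * z)"] by simp
    then have "(1 - exp (- ((y - x) * z))) * exp (- (x * z)) \<le> (y - x) * z * exp (- (x * z))"
      by (intro mult_right_mono) auto
    also have "\<dots> \<le> (y - x) * z * exp (- (r * z))"
      using assms z by (intro mult_left_mono) (auto intro: mult_right_mono)
    also have "(1 - exp (- ((y - x) * z))) * exp (- (x * z)) = exp (- (x * z)) - exp (- (y * z))"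
      unfolding left_diff_distrib exp_add[symmetric] by (simp add: algebra_simps)
    finally have "b (Suc k) * real (Suc k) * (exp (- (x * z)) - exp (- (y * z))) \<le> b (Suc k) * real (Suc k) * ((y - x) * z * exp (- (r * z)))"
      using weight_nonneg[of "Suc k"] by (intro mult_left_mono) auto
    then show ?thesis
      unfolding Pair moment_term_def prod.case z_def by (simp add: algebra_simps power2_eq_square del: of_nat_Suc)
  qed
  show "moment b 1 y \<le> moment b 1 x"
    unfolding moment_def using s t1 by (intro infsum_mono) auto
  have "moment b 1 x \<le> infsum (\<lambda>p. (y - x) * moment_term b 2 r p + moment_term b 1 y p) UNIV"
    unfolding moment_def using s t2 by (intro infsum_mono summable_on_add summable_on_cmult_right) auto
  also have "\<dots> = (y - x) * moment b 2 r + moment b 1 y"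
    unfolding moment_def using s by (subst infsum_add) (auto intro: summable_on_cmult_right simp: infsum_cmult_right)
  finally show "moment b 1 x - moment b 1 y \<le> (y - x) * moment b 2 r" by simp
qed

lemma moment_continuous: "continuous_on {0<..} (moment b 1)"
proof (rule continuous_at_imp_continuous_on, safe)
  fix a :: real assume a: "0 < a"
  have "(moment b 1 \<longlongrightarrow> moment b 1 a) (at a)"
  proof (rule LIM_zero_cancel, rule Lim_null_comparison)
    have "\<forall>\<^sub>F x in at a. x > a / 2"
      using a by (intro order_tendstoD(1)[OF tendsto_ident_at]) auto
    then show "\<forall>\<^sub>F x in at a. norm (moment b 1 x - moment b 1 a) \<le> \<bar>x - a\<bar> * moment b 2 (a / 2)"
    proof eventually_elim
      case (elim x)
      show ?case
        using moment_lipschitz[of "a / 2" x a] moment_lipschitz[of "a / 2" a x] a elim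
        by (cases "x \<le> a") (auto simp: abs_if)
    qed
    have "((\<lambda>x. \<bar>x - a\<bar> * moment b 2 (a / 2)) \<longlongrightarrow> \<bar>a - a\<bar> * moment b 2 (a / 2)) (at a)"
      by (intro tendsto_intros)
    then show "((\<lambda>x. \<bar>x - a\<bar> * moment b 2 (a / 2)) \<longlongrightarrow> 0) (at a)" by simp
  qed
  then show "isCont (moment b 1) a" by (simp add: isCont_def)
qed

definition mean_const :: real where "mean_const = A * Gamma (\<rho> + 1) * zeta_real (\<rho> + 1)"

lemma mean_const_pos: "mean_const > 0"
  unfolding mean_const_def using A_pos rho_pos by (intro mult_pos_pos Gamma_real_pos zeta_real_pos) auto

definition mean_err :: real where
  "mean_err = 2 * C * Gamma (\<rho> + 1 - \<delta> + 1) * zeta_real (\<rho> + 1 - \<delta>)"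

lemma mean_bound:
  "\<alpha> > 0 \<Longrightarrow> \<bar>moment b 1 \<alpha> - mean_const * \<alpha> powr (- (\<rho> + 1))\<bar> \<le> mean_err * \<alpha> powr (- (\<rho> + 1 - \<delta>))"
  using moment_bound[of 1 \<alpha>] by (simp add: mean_const_def mean_err_def)

text \<open>Intermediate value theorem: \<open>mean_bound\<close> forces the first moment to
  infinity at 0 and, being valid for every \<alpha> > 0, also to 0 at infinity.\<close>

lemma saddle_point_exists:
  assumes "N > 0"
  shows "\<exists>\<alpha>>0. moment b 1 \<alpha> = N"
proof -
  have up: "\<forall>\<^sub>F \<alpha> in at_right 0. moment b 1 \<alpha> > N"
  proof -
    have "\<forall>\<^sub>F \<alpha> in at_right 0. mean_const * \<alpha> powr (- (\<rho> + 1)) - mean_err * \<alpha> powr (- (\<rho> + 1 - \<delta>)) > N"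
    proof -
      have "filterlim (\<lambda>\<alpha>. mean_const * \<alpha> powr (- (\<rho> + 1)) - mean_err * \<alpha> powr (- (\<rho> + 1 - \<delta>))) at_top (at_right 0)"
      proof -
        have "((\<lambda>\<alpha>. mean_const - mean_err * \<alpha> powr \<delta>) \<longlongrightarrow> mean_const) (at_right 0)"
          using delta_pos by real_asymp
        moreover have "filterlim (\<lambda>\<alpha>::real. \<alpha> powr (- (\<rho> + 1))) at_top (at_right 0)"
          using rho_pos by real_asymp
        ultimately have "filterlim (\<lambda>\<alpha>. (mean_const - mean_err * \<alpha> powr \<delta>) * \<alpha> powr (- (\<rho> + 1))) at_top (at_right 0)"
          using mean_const_pos by (intro filterlim_tendsto_pos_mult_at_top)
        moreover have "(mean_const - mean_err * \<alpha> powr \<delta>) * \<alpha> powr (- (\<rho> + 1)) = mean_const * \<alpha> powr (- (\<rho> + 1)) - mean_err * \<alpha> powr (- (\<rho> + 1 - \<delta>))" for \<alpha>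
        proof -
          have "\<delta> + - (\<rho> + 1) = - (\<rho> + 1 - \<delta>)" by simp
          then show ?thesis unfolding left_diff_distrib mult.assoc powr_add[symmetric] by (simp only:)
        qed
        ultimately show ?thesis by simp
      qed
      then show ?thesis by (auto simp: filterlim_at_top_dense)
    qed
    then show ?thesis using eventually_at_right_less[of 0]
      by eventually_elim (use mean_bound in \<open>force simp: abs_le_iff\<close>)
  qed
  have "eventually (\<lambda>\<alpha>. \<alpha> > 0 \<and> moment b 1 \<alpha> > N) (at_right 0)"
    using up eventually_at_right_less[of 0] by eventually_elim auto
  then obtain x where x: "x > 0" "moment b 1 x > N"
    using eventually_happens[of _ "at_right (0::real)"] trivial_limit_at_right_real by blast
  have low: "\<forall>\<^sub>F \<alpha> in at_top. moment b 1 \<alpha> < N"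
  proof -
    have "((\<lambda>\<alpha>. mean_const * \<alpha> powr (- (\<rho> + 1)) + mean_err * \<alpha> powr (- (\<rho> + 1 - \<delta>))) \<longlongrightarrow> mean_const * 0 + mean_err * 0) at_top"
      using rho_pos delta_less by (intro tendsto_intros tendsto_neg_powr filterlim_ident) auto
    then have "\<forall>\<^sub>F \<alpha> in at_top. mean_const * \<alpha> powr (- (\<rho> + 1)) + mean_err * \<alpha> powr (- (\<rho> + 1 - \<delta>)) < N"
      using assms by (intro order_tendstoD(2)) auto
    then show ?thesis using eventually_gt_at_top[of 0]
      by eventually_elim (use mean_bound in \<open>force simp: abs_le_iff\<close>)
  qed
  obtain y where y: "y > 0" "moment b 1 y < N"
    using eventually_happens[OF eventually_conj[OF low eventually_gt_at_top[of 0]]] by auto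
  have "connected (moment b 1 ` {0<..})"
    by (intro connected_continuous_image moment_continuous connected_Ioi)
  then have "N \<in> moment b 1 ` {0<..}"
    by (rule connectedD_interval[of _ "moment b 1 y" "moment b 1 x"]) (use x y in auto)
  then show ?thesis by auto
qed

text \<open>By the mean estimate (\<alpha> / a)^(\<rho> + 1), called x in the proof, differs from 1
  by O(\<alpha>^\<delta>), and taking the root only brings it closer to 1. The rate is what matters:
  the deviation is later multiplied by a quantity of logarithmic size.\<close>

lemma saddle_point_asymptotics:
  fixes \<alpha> :: "nat \<Rightarrow> real"
  assumes "\<And>n. n \<ge> 1 \<Longrightarrow> \<alpha> n > 0" "\<And>n. n \<ge> 1 \<Longrightarrow> moment b 1 (\<alpha> n) = real n"
  shows "\<alpha> \<longlonglongrightarrow> 0"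
    and "\<exists>K. \<forall>n\<ge>1. \<bar>\<alpha> n / scaling \<rho> A n - 1\<bar> \<le> K * \<alpha> n powr \<delta>"
proof -
  show "\<alpha> \<longlonglongrightarrow> 0"
  proof (rule order_tendstoI)
    fix x :: real assume "x < 0"
    show "\<forall>\<^sub>F n in sequentially. x < \<alpha> n"
      using eventually_ge_at_top[of 1] by eventually_elim (use assms(1) \<open>x < 0\<close> in force)
  next
    fix x :: real assume x: "0 < x"
    have "\<forall>\<^sub>F n in sequentially. real n > moment b 1 x"
      using filterlim_real_sequentially by (simp add: filterlim_at_top_dense)
    then show "\<forall>\<^sub>F n in sequentially. \<alpha> n < x"
      using eventually_ge_at_top[of 1]
    proof eventually_elim
      case (elim n)
      show ?case
      proof (rule ccontr)
        assume "\<not> \<alpha> n < x"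
        then have "moment b 1 (\<alpha> n) \<le> moment b 1 x" using x by (intro moment_lipschitz(1)[of x]) auto
        then show False using assms(2)[of n] elim by simp
      qed
    qed
  qed
  show "\<exists>K. \<forall>n\<ge>1. \<bar>\<alpha> n / scaling \<rho> A n - 1\<bar> \<le> K * \<alpha> n powr \<delta>"
  proof (intro exI[of _ "mean_err / mean_const"] allI impI)
    fix n :: nat assume n: "n \<ge> 1"
    define a where "a = \<alpha> n"
    have a: "a > 0" "moment b 1 a = real n" using assms n by (auto simp: a_def)
    have sc: "scaling \<rho> A n = (mean_const / real n) powr (1 / (\<rho> + 1))"
      by (simp add: scaling_def mean_const_def)
    define x where "x = real n * a powr (\<rho> + 1) / mean_const"
    have x0: "x > 0" using n a mean_const_pos by (simp add: x_def)
    have "a = (a powr (\<rho> + 1)) powr (1 / (\<rho> + 1))" using a rho_pos by (simp add: powr_powr)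
    then have "a / scaling \<rho> A n = (a powr (\<rho> + 1)) powr (1 / (\<rho> + 1)) / (mean_const / real n) powr (1 / (\<rho> + 1))"
      unfolding sc by simp
    also have "\<dots> = (a powr (\<rho> + 1) / (mean_const / real n)) powr (1 / (\<rho> + 1))"
      by (rule powr_divide[symmetric])
    also have "a powr (\<rho> + 1) / (mean_const / real n) = x" by (simp add: x_def)
    finally have ratio: "a / scaling \<rho> A n = x powr (1 / (\<rho> + 1))" .
    have le1: "\<bar>x powr p - 1\<bar> \<le> \<bar>x - 1\<bar>" if "0 \<le> p" "p \<le> 1" for p
    proof (cases "x \<ge> 1")
      case True
      have "x powr p \<le> x powr 1" using True that by (intro powr_mono) auto
      moreover have "x powr p \<ge> 1" using True that by (intro ge_one_powr_ge_zero) auto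
      ultimately show ?thesis using True by simp
    next
      case False
      have "x powr p \<ge> x powr 1" using False x0 that by (intro powr_mono') auto
      moreover have "x powr p \<le> 1" using False x0 that by (intro powr_le1) auto
      ultimately show ?thesis using False x0 by simp
    qed
    have one: "a powr (\<rho> + 1) * a powr (- (\<rho> + 1)) = 1" using a by (simp add: powr_add[symmetric])
    have "x - 1 = a powr (\<rho> + 1) * (moment b 1 a - mean_const * a powr (- (\<rho> + 1))) / mean_const"
      using one mean_const_pos a(2) by (simp add: x_def right_diff_distrib diff_divide_distrib mult.left_commute[of _ mean_const] mult.commute)
    then have "\<bar>x - 1\<bar> = a powr (\<rho> + 1) * \<bar>moment b 1 a - mean_const * a powr (- (\<rho> + 1))\<bar> / mean_const"
      using mean_const_pos by (simp add: abs_mult)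
    also have "\<dots> \<le> a powr (\<rho> + 1) * (mean_err * a powr (- (\<rho> + 1 - \<delta>))) / mean_const"
      using mean_bound[OF a(1)] mean_const_pos by (intro divide_right_mono mult_left_mono) auto
    also have "\<dots> = mean_err / mean_const * (a powr (\<rho> + 1) * a powr (- (\<rho> + 1 - \<delta>)))" by simp
    also have "a powr (\<rho> + 1) * a powr (- (\<rho> + 1 - \<delta>)) = a powr \<delta>" by (simp add: powr_add[symmetric])
    finally have "\<bar>x - 1\<bar> \<le> mean_err / mean_const * a powr \<delta>" .
    moreover have "\<bar>x powr (1 / (\<rho> + 1)) - 1\<bar> \<le> \<bar>x - 1\<bar>" using rho_pos by (intro le1) auto
    ultimately show "\<bar>\<alpha> n / scaling \<rho> A n - 1\<bar> \<le> mean_err / mean_const * \<alpha> n powr \<delta>"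
      using ratio unfolding a_def by linarith
  qed
qed

end

section \<open>The logarithm of the generating function\<close>

lemma has_sum_difference:
  fixes f g :: "'a \<Rightarrow> 'b :: real_normed_vector"
  assumes "(f has_sum a) S" "(g has_sum b) S"
  shows "((\<lambda>x. f x - g x) has_sum (a - b)) S"
  using has_sum_add[OF assms(1), of "\<lambda>x. - g x" "- b"] assms(2) by (simp add: has_sum_uminus)

lemma
  fixes f g :: "'a \<Rightarrow> 'b :: real_normed_vector"
  assumes "f summable_on S" "g summable_on S"
  shows summable_on_difference: "(\<lambda>x. f x - g x) summable_on S"
    and infsum_difference: "infsum (\<lambda>x. f x - g x) S = infsum f S - infsum g S"
  using has_sum_difference[OF has_sum_infsum[OF assms(1)] has_sum_infsum[OF assms(2)]]
  by (auto simp: summable_on_def infsumI)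

lemma iexp_quadratic_approx:
  "norm (exp (- (\<i> * complex_of_real x)) - 1 + \<i> * x + x\<^sup>2 / 2) \<le> \<bar>x\<bar> ^ 3 / 6"
proof -
  have "exp (- (\<i> * complex_of_real x)) - 1 + \<i> * x + x\<^sup>2 / 2 = exp (\<i> * complex_of_real (- x)) - (\<Sum>k\<le>2. (\<i> * complex_of_real (- x)) ^ k / fact k)"
    by (simp add: numeral_2_eq_2) (simp add: complex_eq_iff power2_eq_square)
  moreover have "norm (exp (\<i> * complex_of_real (- x)) - (\<Sum>k\<le>2. (\<i> * complex_of_real (- x)) ^ k / fact k)) \<le> \<bar>x\<bar> ^ 3 / 6"
    using iexp_approx1[of "- x" 2] by (simp add: fact_numeral)
  ultimately show ?thesis by (simp only:)
qed

text \<open>The cubic remainder is at most x^2 / 6 here, and 1/2 - 1/6 = 1/3.\<close>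

lemma one_minus_cos_ge:
  fixes x :: real assumes "\<bar>x\<bar> \<le> 1" shows "1 - cos x \<ge> x\<^sup>2 / 3"
proof -
  have "\<bar>Re (exp (- (\<i> * complex_of_real x)) - 1 + \<i> * x + x\<^sup>2 / 2)\<bar> \<le> \<bar>x\<bar> ^ 3 / 6"
    using abs_Re_le_cmod iexp_quadratic_approx by (rule order_trans)
  then have "\<bar>cos x - 1 + x\<^sup>2 / 2\<bar> \<le> \<bar>x\<bar> ^ 3 / 6" by (simp add: Re_exp power2_eq_square)
  moreover have "\<bar>x\<bar> ^ 3 \<le> x\<^sup>2"
    using assms mult_left_mono[of "\<bar>x\<bar>" 1 "x\<^sup>2"] by (simp add: power2_eq_square power3_eq_cube abs_mult_self_eq)
  ultimately show ?thesis by linarith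
qed

text \<open>The series of - ln (1 - exp (- k \<tau>)) over j, left unsummed and indexed like
  \<open>moment_term\<close>: differentiation in \<tau> multiplies a term by - j k, so the Taylor
  expansion can be made term by term.\<close>

definition log_gf_term :: "(nat \<Rightarrow> real) \<Rightarrow> complex \<Rightarrow> nat \<times> nat \<Rightarrow> complex" where
  "log_gf_term c \<tau> = (\<lambda>(j, k). of_real (c (Suc k) / real (Suc j)) * exp (- (\<tau> * of_real (real (Suc j) * real (Suc k)))))"

definition log_gf :: "(nat \<Rightarrow> real) \<Rightarrow> complex \<Rightarrow> complex" where
  "log_gf c \<tau> = infsum (log_gf_term c \<tau>) UNIV"

text \<open>This is the quantity \<open>g(\<alpha>) - Re g(\<alpha> + i\<theta>)\<close> of \<open>(M\<^sub>3)\<close>.\<close>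

definition cos_defect :: "(nat \<Rightarrow> real) \<Rightarrow> real \<Rightarrow> real \<Rightarrow> real" where
  "cos_defect c \<alpha> \<theta> = (\<Sum>k. c (Suc k) * exp (- (\<alpha> * real (Suc k))) * (1 - cos (\<theta> * real (Suc k))))"

section \<open>Estimates uniform in the truncated weights\<close>

context power_weights
begin

text \<open>The weights b, their restriction to sizes up to m and the rest beyond m all occur below;
  domination by b gives them summability and upper bounds at once.\<close>

definition subweight :: "(nat \<Rightarrow> real) \<Rightarrow> bool" where
  "subweight c \<longleftrightarrow> (\<forall>k\<ge>1. 0 \<le> c k \<and> c k \<le> b k)"

lemma subweight_diff: "subweight c \<Longrightarrow> subweight (\<lambda>k. b k - c k)"
  by (auto simp: subweight_def)

lemma subweight_self: "subweight b"
  using weight_nonneg by (auto simp: subweight_def)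

lemma subweight_moment_term:
  assumes "subweight c"
  shows "0 \<le> moment_term c q \<alpha> p" "moment_term c q \<alpha> p \<le> moment_term b q \<alpha> p"
  using assms by (auto simp: moment_term_def subweight_def split: prod.split intro!: mult_right_mono)

lemma subweight_moment_summable:
  assumes "subweight c" "q \<ge> 1" "\<alpha> > 0"
  shows "moment_term c q \<alpha> summable_on UNIV"
  by (rule summable_on_comparison_test[OF moment_term_summable[OF assms(2,3)]])
     (use subweight_moment_term[OF assms(1)] in auto)

lemma subweight_moment:
  assumes "subweight c" "q \<ge> 1" "\<alpha> > 0"
  shows "0 \<le> moment c q \<alpha>" "moment c q \<alpha> \<le> moment b q \<alpha>"
  unfolding moment_def
  using assms subweight_moment_term[OF assms(1)]
  by (auto intro!: infsum_nonneg infsum_mono subweight_moment_summable moment_term_summable)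

lemma moment_diff:
  assumes "subweight c" "q \<ge> 1" "\<alpha> > 0"
  shows "moment (\<lambda>k. b k - c k) q \<alpha> = moment b q \<alpha> - moment c q \<alpha>"
proof -
  have "moment_term (\<lambda>k. b k - c k) q \<alpha> = (\<lambda>p. moment_term b q \<alpha> p - moment_term c q \<alpha> p)"
    by (auto simp: moment_term_def fun_eq_iff algebra_simps)
  then show ?thesis
    unfolding moment_def using assms
    by (simp add: infsum_difference subweight_moment_summable moment_term_summable)
qed

lemma log_gf_term_abs_summable:
  assumes "subweight c" "Re \<tau> > 0"
  shows "(\<lambda>p. norm (log_gf_term c \<tau> p)) summable_on UNIV"
proof (rule summable_on_comparison_test[OF moment_term_summable[of 1 "Re \<tau>"]])
  fix p :: "nat \<times> nat"
  obtain j k where p: "p = (j, k)" by (cases p)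
  have c: "0 \<le> c (Suc k)" "c (Suc k) \<le> b (Suc k)" using assms by (auto simp: subweight_def)
  have "norm (log_gf_term c \<tau> p) = c (Suc k) / real (Suc j) * exp (- (Re \<tau> * real (Suc j) * real (Suc k)))"
    using c by (simp add: p log_gf_term_def norm_mult norm_divide mult.assoc del: of_nat_Suc)
  also have "\<dots> \<le> (b (Suc k) * real (Suc k)) * exp (- (Re \<tau> * real (Suc j) * real (Suc k)))"
  proof (rule mult_right_mono)
    have "c (Suc k) / real (Suc j) \<le> c (Suc k) / 1" using c by (intro divide_left_mono) auto
    also have "\<dots> \<le> b (Suc k) * 1" using c by simp
    also have "\<dots> \<le> b (Suc k) * real (Suc k)" using c by (intro mult_left_mono) auto
    finally show "c (Suc k) / real (Suc j) \<le> b (Suc k) * real (Suc k)" .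
  qed auto
  finally show "norm (log_gf_term c \<tau> p) \<le> moment_term b 1 (Re \<tau>) p"
    by (simp add: p moment_term_def)
qed (use assms in auto)

lemma log_gf_term_summable:
  assumes "subweight c" "Re \<tau> > 0"
  shows "log_gf_term c \<tau> summable_on UNIV"
  using log_gf_term_abs_summable[OF assms] by (rule abs_summable_summable)

text \<open>The third-order remainder of the imaginary exponential, applied to every term of the
  double series. The bound is in terms of the third moment of b rather than of c, so it is uniform
  in c.\<close>

lemma log_gf_taylor:
  assumes c: "subweight c" and "\<alpha> > 0"
  shows "norm (log_gf c (Complex \<alpha> \<theta>) - log_gf c (of_real \<alpha>) + \<i> * \<theta> * moment c 1 \<alpha> + \<theta>\<^sup>2 / 2 * moment c 2 \<alpha>)
     \<le> \<bar>\<theta>\<bar> ^ 3 / 6 * moment b 3 \<alpha>"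
proof -
  define R where "R p = log_gf_term c (Complex \<alpha> \<theta>) p - log_gf_term c (of_real \<alpha>) p
     + \<i> * \<theta> * of_real (moment_term c 1 \<alpha> p) + of_real (\<theta>\<^sup>2 / 2) * of_real (moment_term c 2 \<alpha> p)" for p
  have s: "log_gf_term c (Complex \<alpha> \<theta>) summable_on UNIV" "log_gf_term c (of_real \<alpha>) summable_on UNIV"
    using assms by (auto intro!: log_gf_term_summable)
  have m: "moment_term c q \<alpha> summable_on UNIV" if "q \<ge> 1" for q using subweight_moment_summable[OF c that assms(2)] .
  have mc: "((\<lambda>p. complex_of_real (moment_term c q \<alpha> p)) has_sum of_real (moment c q \<alpha>)) UNIV" if "q \<ge> 1" for q
    unfolding moment_def by (intro has_sum_of_real has_sum_infsum m that)
  have Rsum: "(R has_sum (log_gf c (Complex \<alpha> \<theta>) - log_gf c (of_real \<alpha>) + \<i> * \<theta> * of_real (moment c 1 \<alpha>) + of_real (\<theta>\<^sup>2 / 2) * of_real (moment c 2 \<alpha>))) UNIV"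
    unfolding R_def log_gf_def
    by (intro has_sum_add has_sum_difference has_sum_cmult_right has_sum_infsum s mc) simp_all
  have "infsum R UNIV = log_gf c (Complex \<alpha> \<theta>) - log_gf c (of_real \<alpha>) + \<i> * \<theta> * moment c 1 \<alpha> + \<theta>\<^sup>2 / 2 * moment c 2 \<alpha>"
    using infsumI[OF Rsum] by simp
  moreover have "norm (infsum R UNIV) \<le> infsum (\<lambda>p. \<bar>\<theta>\<bar> ^ 3 / 6 * moment_term c 3 \<alpha> p) UNIV"
  proof (rule norm_infsum_le)
    have "R summable_on UNIV" using Rsum by (auto simp: summable_on_def)
    then show "(R has_sum infsum R UNIV) UNIV" by (rule has_sum_infsum)
    have "(\<lambda>p. \<bar>\<theta>\<bar> ^ 3 / 6 * moment_term c 3 \<alpha> p) summable_on UNIV"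
      using m[of 3] by (intro summable_on_cmult_right) auto
    then show "((\<lambda>p. \<bar>\<theta>\<bar> ^ 3 / 6 * moment_term c 3 \<alpha> p) has_sum infsum (\<lambda>p. \<bar>\<theta>\<bar> ^ 3 / 6 * moment_term c 3 \<alpha> p) UNIV) UNIV"
      by (rule has_sum_infsum)
    fix p :: "nat \<times> nat"
    obtain j k where p: "p = (j, k)" by (cases p)
    define z where "z = real (Suc j) * real (Suc k)"
    define E where "E = exp (- (\<alpha> * z))"
    define g where "g = c (Suc k) / real (Suc j)"
    have g0: "g \<ge> 0" using c by (simp add: g_def subweight_def)
    have cexp: "exp (- (Complex \<alpha> \<theta> * of_real z)) = of_real E * exp (- (\<i> * of_real (\<theta> * z)))"
    proof -
      have "- (Complex \<alpha> \<theta> * of_real z) = of_real (- (\<alpha> * z)) + - (\<i> * of_real (\<theta> * z))"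
        by (simp add: complex_eq_iff)
      then show ?thesis unfolding E_def exp_of_real[symmetric] by (simp only: exp_add)
    qed
    have rexp: "exp (- (of_real \<alpha> * of_real z)) = complex_of_real E"
      unfolding E_def exp_of_real[symmetric] by simp
    have m1: "moment_term c 1 \<alpha> p = g * E * z" 
      by (simp add: p moment_term_def g_def E_def z_def mult_ac del: of_nat_Suc)
    have m2: "moment_term c 2 \<alpha> p = g * E * z\<^sup>2"
      by (simp add: p moment_term_def g_def E_def z_def mult_ac power2_eq_square del: of_nat_Suc)
    have m3: "moment_term c 3 \<alpha> p = g * E * z ^ 3"
      by (simp add: p moment_term_def g_def E_def z_def mult_ac power2_eq_square power3_eq_cube del: of_nat_Suc)
    have l1: "log_gf_term c (Complex \<alpha> \<theta>) p = of_real g * (of_real E * exp (- (\<i> * of_real (\<theta> * z))))"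
      unfolding p log_gf_term_def prod.case g_def[symmetric] z_def[symmetric] cexp ..
    have l2: "log_gf_term c (of_real \<alpha>) p = of_real g * of_real E"
      unfolding p log_gf_term_def prod.case g_def[symmetric] z_def[symmetric] rexp ..
    have "R p = of_real (g * E) * (exp (- (\<i> * of_real (\<theta> * z))) - 1 + \<i> * of_real (\<theta> * z) + (of_real (\<theta> * z))\<^sup>2 / 2)"
      unfolding R_def m1 m2 l1 l2 by (simp add: algebra_simps power2_eq_square)
    then have "norm (R p) = (g * E) * norm (exp (- (\<i> * of_real (\<theta> * z))) - 1 + \<i> * of_real (\<theta> * z) + (of_real (\<theta> * z))\<^sup>2 / 2)"
      using g0 by (simp add: norm_mult E_def)
    also have "\<dots> \<le> (g * E) * (\<bar>\<theta> * z\<bar> ^ 3 / 6)"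
      using g0 iexp_quadratic_approx[of "\<theta> * z"] by (intro mult_left_mono) (auto simp: E_def)
    also have "\<dots> = \<bar>\<theta>\<bar> ^ 3 / 6 * moment_term c 3 \<alpha> p"
      unfolding m3 by (simp add: abs_mult power_mult_distrib z_def)
    finally show "norm (R p) \<le> \<bar>\<theta>\<bar> ^ 3 / 6 * moment_term c 3 \<alpha> p" .
  qed
  moreover have "infsum (\<lambda>p. \<bar>\<theta>\<bar> ^ 3 / 6 * moment_term c 3 \<alpha> p) UNIV = \<bar>\<theta>\<bar> ^ 3 / 6 * moment c 3 \<alpha>"
    unfolding moment_def by (rule infsum_cmult_right) (use m[of 3] in auto)
  moreover have "\<bar>\<theta>\<bar> ^ 3 / 6 * moment c 3 \<alpha> \<le> \<bar>\<theta>\<bar> ^ 3 / 6 * moment b 3 \<alpha>"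
    using subweight_moment(2)[OF c, of 3 \<alpha>] assms by (intro mult_left_mono) auto
  ultimately show ?thesis by simp
qed

lemma cos_defect_summable:
  assumes c: "subweight c" and "\<alpha> > 0"
  shows "summable (\<lambda>k. c (Suc k) * exp (- (\<alpha> * real (Suc k))) * (1 - cos (\<theta> * real (Suc k))))"
proof (rule summable_comparison_test')
  show "summable (\<lambda>k. 2 * (b (Suc k) * real (Suc k) ^ 0 * exp (- (\<alpha> * real (Suc k)))))"
    by (intro summable_mult laplace_sum_bound(1) assms)
  fix k :: nat
  have "0 \<le> c (Suc k)" "c (Suc k) \<le> b (Suc k)" using assms by (auto simp: subweight_def)
  moreover have "\<bar>1 - cos (\<theta> * real (Suc k))\<bar> \<le> 2"
    using cos_ge_minus_one[of "\<theta> * real (Suc k)"] cos_le_one[of "\<theta> * real (Suc k)"] by linarith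
  ultimately have "c (Suc k) * exp (- (\<alpha> * real (Suc k))) * \<bar>1 - cos (\<theta> * real (Suc k))\<bar> \<le> b (Suc k) * exp (- (\<alpha> * real (Suc k))) * 2"
    by (intro mult_mono) auto
  then show "norm (c (Suc k) * exp (- (\<alpha> * real (Suc k))) * (1 - cos (\<theta> * real (Suc k)))) \<le> 2 * (b (Suc k) * real (Suc k) ^ 0 * exp (- (\<alpha> * real (Suc k))))"
    using \<open>0 \<le> c (Suc k)\<close> by (simp add: abs_mult mult_ac)
qed

text \<open>The real part of each term of the double series is largest at \<theta> = 0, so all rows
  but the one with exponent j = 1 (index 0) may be discarded; that row is the quantity in
  (M3).\<close>

lemma Re_log_gf_diff_le:
  assumes c: "subweight c" and "\<alpha> > 0"
  shows "Re (log_gf c (Complex \<alpha> \<theta>)) - Re (log_gf c (of_real \<alpha>)) \<le> - cos_defect c \<alpha> \<theta>"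
proof -
  define h where "h p = Re (log_gf_term c (of_real \<alpha>) p - log_gf_term c (Complex \<alpha> \<theta>) p)" for p
  have s: "(\<lambda>p. log_gf_term c (of_real \<alpha>) p - log_gf_term c (Complex \<alpha> \<theta>) p) summable_on UNIV"
    using assms by (intro summable_on_difference log_gf_term_summable) auto
  have "(h has_sum Re (infsum (\<lambda>p. log_gf_term c (of_real \<alpha>) p - log_gf_term c (Complex \<alpha> \<theta>) p) UNIV)) UNIV"
    unfolding h_def by (intro has_sum_Re has_sum_infsum s)
  moreover have "infsum (\<lambda>p. log_gf_term c (of_real \<alpha>) p - log_gf_term c (Complex \<alpha> \<theta>) p) UNIV = log_gf c (of_real \<alpha>) - log_gf c (Complex \<alpha> \<theta>)"
    unfolding log_gf_def using assms by (intro infsum_difference log_gf_term_summable) auto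
  ultimately have hs: "(h has_sum (Re (log_gf c (of_real \<alpha>)) - Re (log_gf c (Complex \<alpha> \<theta>)))) UNIV" by simp
  have hval: "h (j, k) = c (Suc k) / real (Suc j) * exp (- (\<alpha> * (real (Suc j) * real (Suc k)))) * (1 - cos (\<theta> * (real (Suc j) * real (Suc k))))" for j k
    unfolding h_def log_gf_term_def
    by (simp add: Re_exp right_diff_distrib del: of_nat_Suc)
  have h0: "h p \<ge> 0" for p
  proof -
    obtain j k where p: "p = (j, k)" by (cases p)
    show ?thesis using c unfolding p hval by (intro mult_nonneg_nonneg) (auto simp: subweight_def)
  qed
  have "cos_defect c \<alpha> \<theta> \<le> Re (log_gf c (of_real \<alpha>)) - Re (log_gf c (Complex \<alpha> \<theta>))"
    unfolding cos_defect_def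
  proof (rule suminf_le_const[OF cos_defect_summable[OF assms]])
    fix n
    have "(\<Sum>k<n. c (Suc k) * exp (- (\<alpha> * real (Suc k))) * (1 - cos (\<theta> * real (Suc k)))) = sum h (Pair 0 ` {..<n})"
      by (subst sum.reindex) (auto simp: hval inj_on_def)
    also have "\<dots> \<le> Re (log_gf c (of_real \<alpha>)) - Re (log_gf c (Complex \<alpha> \<theta>))"
      by (rule has_sum_mono2[OF has_sum_finite hs]) (use h0 in auto)
    finally show "(\<Sum>k<n. c (Suc k) * exp (- (\<alpha> * real (Suc k))) * (1 - cos (\<theta> * real (Suc k)))) \<le> Re (log_gf c (of_real \<alpha>)) - Re (log_gf c (Complex \<alpha> \<theta>))" .
  qed
  then show ?thesis by simp
qed

text \<open>Because 1 - cos is at most 2, discarding weights costs the defect at most twice their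
  Laplace sum. For the tail beyond the cutoff this sum stays bounded, so the lower bound from (M3)
  survives the truncation.\<close>

lemma cos_defect_ge_diff:
  assumes c: "subweight c" and "\<alpha> > 0"
  shows "cos_defect c \<alpha> \<theta> \<ge> cos_defect b \<alpha> \<theta> - 2 * laplace_sum (\<lambda>k. b k - c k) 0 \<alpha>"
proof -
  have s: "summable (\<lambda>k. (b (Suc k) - c (Suc k)) * exp (- (\<alpha> * real (Suc k))))"
    by (rule summable_comparison_test'[OF laplace_sum_bound(1)[OF assms(2), of 0], of 0])
       (use c in \<open>auto simp: subweight_def intro!: mult_right_mono\<close>)
  have sb: "summable (\<lambda>k. b (Suc k) * exp (- (\<alpha> * real (Suc k))) * (1 - cos (\<theta> * real (Suc k))))"
    and sc: "summable (\<lambda>k. c (Suc k) * exp (- (\<alpha> * real (Suc k))) * (1 - cos (\<theta> * real (Suc k))))"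
    by (rule cos_defect_summable[OF subweight_self assms(2)], rule cos_defect_summable[OF assms])
  have "cos_defect b \<alpha> \<theta> - cos_defect c \<alpha> \<theta> = (\<Sum>k. (b (Suc k) - c (Suc k)) * exp (- (\<alpha> * real (Suc k))) * (1 - cos (\<theta> * real (Suc k))))"
    unfolding cos_defect_def suminf_diff[OF sb sc] by (intro arg_cong[where f = suminf] ext) (simp add: algebra_simps)
  also have "\<dots> \<le> (\<Sum>k. (b (Suc k) - c (Suc k)) * exp (- (\<alpha> * real (Suc k))) * 2)"
  proof (rule suminf_le)
    show "summable (\<lambda>k. (b (Suc k) - c (Suc k)) * exp (- (\<alpha> * real (Suc k))) * 2)" by (rule summable_mult2[OF s])
    show "summable (\<lambda>k. (b (Suc k) - c (Suc k)) * exp (- (\<alpha> * real (Suc k))) * (1 - cos (\<theta> * real (Suc k))))"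
      using cos_defect_summable[OF subweight_diff[OF c] assms(2)] by simp
    fix k
    have "1 - cos (\<theta> * real (Suc k)) \<le> 2" using cos_ge_minus_one[of "\<theta> * real (Suc k)"] by linarith
    then show "(b (Suc k) - c (Suc k)) * exp (- (\<alpha> * real (Suc k))) * (1 - cos (\<theta> * real (Suc k))) \<le> (b (Suc k) - c (Suc k)) * exp (- (\<alpha> * real (Suc k))) * 2"
      using c by (intro mult_left_mono) (auto simp: subweight_def)
  qed
  also have "\<dots> = 2 * laplace_sum (\<lambda>k. b k - c k) 0 \<alpha>"
    unfolding laplace_sum_def using suminf_mult2[OF s, of 2] by simp
  finally show ?thesis by simp
qed

text \<open>Parts with 1 / (2 \<alpha>) < k \<le> 1 / \<alpha> suffice: for them |\<theta>| k \<le>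
  1, so 1 - cos is at least a constant times (\<theta> / \<alpha>)^2,
  \<open>exp (- \<alpha> k)\<close> is at least \<open>exp (- 1)\<close>, and their total weight has
  order \<alpha>^(-\<rho>). Hence the assumption that c agrees with b up to 1 / \<alpha>.\<close>

lemma cos_defect_central:
  "\<exists>\<kappa>>0. \<forall>\<^sub>F \<alpha> in at_right 0. \<forall>c \<theta>. subweight c \<longrightarrow> (\<forall>k\<ge>1. real k \<le> 1 / \<alpha> \<longrightarrow> c k = b k) \<longrightarrow> \<bar>\<theta>\<bar> \<le> \<alpha> \<longrightarrow>
     cos_defect c \<alpha> \<theta> \<ge> \<kappa> * (\<theta>\<^sup>2 * \<alpha> powr (- (\<rho> + 2)))"
proof -
  \<comment> \<open>Leading coefficient of the weight between 1 / (2 \<alpha>) and 1 / \<alpha>; for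
    small \<alpha> the error terms use up at most half of it.\<close>
  define a where "a = A / \<rho> * (1 - (1 / 2) powr \<rho>)"
  have half: "(1 / 2 :: real) powr \<rho> < 1" using rho_pos powr_less_mono2[of \<rho> "1 / 2" 1] by simp
  have a: "a > 0" unfolding a_def using half A_pos rho_pos by simp
  have ev: "\<forall>\<^sub>F \<alpha> in at_right 0. 2 * C * \<alpha> powr \<delta> \<le> a / 2"
  proof -
    have "((\<lambda>\<alpha>. 2 * C * \<alpha> powr \<delta>) \<longlongrightarrow> 0) (at_right 0)" using delta_pos by real_asymp
    then have "\<forall>\<^sub>F \<alpha> in at_right 0. 2 * C * \<alpha> powr \<delta> < a / 2" by (rule order_tendstoD) (use a in auto)
    then show ?thesis by (auto elim: eventually_mono)
  qed
  show ?thesis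
  \<comment> \<open>\<open>exp (- 1)\<close> bounds \<open>exp (- \<alpha> k)\<close> from below,
    1/12 is the 1/3 of \<open>one_minus_cos_ge\<close> times (1/2)^2 from k > 1 / (2 \<alpha>), and
    a / 2 is the guaranteed weight.\<close>
  proof (intro exI[of _ "exp (- 1) / 12 * (a / 2)"] conjI)
    show "\<forall>\<^sub>F \<alpha> in at_right 0. \<forall>c \<theta>. subweight c \<longrightarrow> (\<forall>k\<ge>1. real k \<le> 1 / \<alpha> \<longrightarrow> c k = b k) \<longrightarrow> \<bar>\<theta>\<bar> \<le> \<alpha> \<longrightarrow>
     cos_defect c \<alpha> \<theta> \<ge> exp (- 1) / 12 * (a / 2) * (\<theta>\<^sup>2 * \<alpha> powr (- (\<rho> + 2)))"
      using ev eventually_at_right_less[of 0]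
    proof eventually_elim
      case (elim \<alpha>)
      show ?case
      proof (intro allI impI)
        fix c \<theta> assume c: "subweight c" and cb: "\<forall>k\<ge>1. real k \<le> 1 / \<alpha> \<longrightarrow> c k = b k" and th: "\<bar>\<theta>\<bar> \<le> \<alpha>"
        define N1 N2 where "N1 = nat \<lfloor>1 / (2 * \<alpha>)\<rfloor>" and "N2 = nat \<lfloor>1 / \<alpha>\<rfloor>"
        have "1 / (2 * \<alpha>) \<le> 1 / \<alpha>" using elim by (simp add: field_simps)
        then have N12: "N1 \<le> N2" unfolding N1_def N2_def by (intro nat_mono floor_mono)
        have B: "weight_sum b (1 / \<alpha>) - weight_sum b (1 / (2 * \<alpha>)) \<ge> a / 2 * \<alpha> powr (- \<rho>)"
        proof -
          have p1: "(1 / \<alpha>) powr s = \<alpha> powr (- s)" for s using elim by (simp add: powr_divide powr_minus_divide)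
          have p2: "(1 / (2 * \<alpha>)) powr s = (1 / 2) powr s * \<alpha> powr (- s)" for s
            using elim powr_mult[of "1 / 2" "1 / \<alpha>" s] by (simp add: p1)
          have b1: "weight_sum b (1 / \<alpha>) \<ge> A / \<rho> * \<alpha> powr (- \<rho>) - C * \<alpha> powr (- (\<rho> - \<delta>))"
            using weight_sum_bound[of "1 / \<alpha>"] elim unfolding p1 by (simp add: abs_le_iff)
          have "weight_sum b (1 / (2 * \<alpha>)) \<le> A / \<rho> * ((1 / 2) powr \<rho> * \<alpha> powr (- \<rho>)) + C * ((1 / 2) powr (\<rho> - \<delta>) * \<alpha> powr (- (\<rho> - \<delta>)))"
            using weight_sum_bound[of "1 / (2 * \<alpha>)"] elim unfolding p2 by (simp add: abs_le_iff)
          also have "\<dots> \<le> A / \<rho> * ((1 / 2) powr \<rho> * \<alpha> powr (- \<rho>)) + C * (1 * \<alpha> powr (- (\<rho> - \<delta>)))"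
            using C_nonneg delta_less by (intro add_left_mono mult_left_mono mult_right_mono powr_le1) auto
          finally have b2: "weight_sum b (1 / (2 * \<alpha>)) \<le> A / \<rho> * ((1 / 2) powr \<rho> * \<alpha> powr (- \<rho>)) + C * \<alpha> powr (- (\<rho> - \<delta>))" by simp
          have "\<alpha> powr (- (\<rho> - \<delta>)) = \<alpha> powr \<delta> * \<alpha> powr (- \<rho>)" by (simp add: powr_add[symmetric])
          then have "2 * (C * \<alpha> powr (- (\<rho> - \<delta>))) = 2 * C * \<alpha> powr \<delta> * \<alpha> powr (- \<rho>)" by simp
          also have "\<dots> \<le> a / 2 * \<alpha> powr (- \<rho>)" using elim by (intro mult_right_mono) auto
          finally have b3: "2 * (C * \<alpha> powr (- (\<rho> - \<delta>))) \<le> a / 2 * \<alpha> powr (- \<rho>)" .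
          have "a * \<alpha> powr (- \<rho>) = A / \<rho> * \<alpha> powr (- \<rho>) - A / \<rho> * ((1 / 2) powr \<rho> * \<alpha> powr (- \<rho>))"
            by (simp add: a_def algebra_simps diff_divide_distrib)
          moreover have "a * \<alpha> powr (- \<rho>) = a / 2 * \<alpha> powr (- \<rho>) + a / 2 * \<alpha> powr (- \<rho>)" by simp
          ultimately show ?thesis using b1 b2 b3 by linarith
        qed
        define K where "K = {N1..<N2}"
        have "exp (- 1) / 12 * (a / 2) * (\<theta>\<^sup>2 * \<alpha> powr (- (\<rho> + 2))) = (a / 2 * \<alpha> powr (- \<rho>)) * (exp (- 1) * ((\<theta> / (2 * \<alpha>))\<^sup>2 / 3))"
        proof -
          have "\<alpha> powr (- (\<rho> + 2)) = \<alpha> powr (- \<rho>) * \<alpha> powr (- 2)" by (simp add: powr_add[symmetric])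
          also have "\<alpha> powr (- 2) = 1 / \<alpha>\<^sup>2" using elim by (simp add: powr_minus_divide)
          finally show ?thesis by (simp add: power_divide power_mult_distrib)
        qed
        also have "\<dots> \<le> (weight_sum b (1 / \<alpha>) - weight_sum b (1 / (2 * \<alpha>))) * (exp (- 1) * ((\<theta> / (2 * \<alpha>))\<^sup>2 / 3))"
          by (intro mult_right_mono B) auto
        also have "weight_sum b (1 / \<alpha>) - weight_sum b (1 / (2 * \<alpha>)) = (\<Sum>k\<in>K. b (Suc k))"
          unfolding weight_sum_lessThan N1_def[symmetric] N2_def[symmetric] K_def using N12
          by (metis sum_diff_nat_ivl lessThan_atLeast0 le0)
        also have "(\<Sum>k\<in>K. b (Suc k)) * (exp (- 1) * ((\<theta> / (2 * \<alpha>))\<^sup>2 / 3)) = (\<Sum>k\<in>K. b (Suc k) * (exp (- 1) * ((\<theta> / (2 * \<alpha>))\<^sup>2 / 3)))"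
          by (rule sum_distrib_right)
        also have "\<dots> \<le> (\<Sum>k\<in>K. c (Suc k) * exp (- (\<alpha> * real (Suc k))) * (1 - cos (\<theta> * real (Suc k))))"
        proof (rule sum_mono)
          fix k assume k: "k \<in> K"
          have k1: "real (Suc k) > 1 / (2 * \<alpha>)" using k unfolding K_def N1_def by auto linarith
          have k2: "real (Suc k) \<le> 1 / \<alpha>" using k unfolding K_def N2_def by auto linarith
          have ak: "\<alpha> * real (Suc k) \<le> 1" using k2 elim by (simp add: field_simps)
          have "\<bar>\<theta> * real (Suc k)\<bar> \<le> \<alpha> * real (Suc k)" using th by (simp add: abs_mult mult_right_mono)
          then have "1 - cos (\<theta> * real (Suc k)) \<ge> (\<theta> * real (Suc k))\<^sup>2 / 3" using ak by (intro one_minus_cos_ge) auto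
          moreover have "(\<theta> * real (Suc k))\<^sup>2 \<ge> (\<theta> / (2 * \<alpha>))\<^sup>2"
          proof -
            have "\<bar>\<theta>\<bar> * (1 / (2 * \<alpha>)) \<le> \<bar>\<theta>\<bar> * real (Suc k)" using k1 by (intro mult_left_mono) auto
            then have "\<bar>\<theta> / (2 * \<alpha>)\<bar> \<le> \<bar>\<theta> * real (Suc k)\<bar>" using elim by (simp add: abs_mult)
            then show ?thesis by (rule abs_le_square_iff[THEN iffD1])
          qed
          ultimately have t: "(\<theta> / (2 * \<alpha>))\<^sup>2 / 3 \<le> 1 - cos (\<theta> * real (Suc k))" by linarith
          have "exp (- 1) * ((\<theta> / (2 * \<alpha>))\<^sup>2 / 3) \<le> exp (- (\<alpha> * real (Suc k))) * (1 - cos (\<theta> * real (Suc k)))"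
            using ak by (intro mult_mono t) auto
          then have "b (Suc k) * (exp (- 1) * ((\<theta> / (2 * \<alpha>))\<^sup>2 / 3)) \<le> b (Suc k) * (exp (- (\<alpha> * real (Suc k))) * (1 - cos (\<theta> * real (Suc k))))"
            using weight_nonneg[of "Suc k"] by (intro mult_left_mono) auto
          also have "b (Suc k) = c (Suc k)" using cb k2 by simp
          finally show "b (Suc k) * (exp (- 1) * ((\<theta> / (2 * \<alpha>))\<^sup>2 / 3)) \<le> c (Suc k) * exp (- (\<alpha> * real (Suc k))) * (1 - cos (\<theta> * real (Suc k)))"
            using \<open>b (Suc k) = c (Suc k)\<close> by (simp add: mult.assoc)
        qed
        also have "\<dots> \<le> cos_defect c \<alpha> \<theta>"
          unfolding cos_defect_def
          by (rule sum_le_suminf[OF cos_defect_summable[OF c elim(2)]]) (use c in \<open>auto simp: K_def subweight_def\<close>)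
        finally show "cos_defect c \<alpha> \<theta> \<ge> exp (- 1) / 12 * (a / 2) * (\<theta>\<^sup>2 * \<alpha> powr (- (\<rho> + 2)))" .
      qed
    qed
  qed (use a in auto)
qed

section \<open>The local limit theorem\<close>

definition var_const :: real where "var_const = A * Gamma (\<rho> + 2) * zeta_real (\<rho> + 1)"

text \<open>For admissible weights this is the characteristic function of n - N, where N has the law
  proportional to p_c(N) \<open>exp (- \<alpha> N)\<close>; Cauchy's formula integrates it over one
  period.\<close>

definition char_ratio :: "(nat \<Rightarrow> real) \<Rightarrow> real \<Rightarrow> nat \<Rightarrow> real \<Rightarrow> complex" where
  "char_ratio c \<alpha> n \<theta> = exp (log_gf c (Complex \<alpha> \<theta>) - log_gf c (of_real \<alpha>) + \<i> * of_real (real n * \<theta>))"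

lemma norm_char_ratio:
  assumes "subweight c" "\<alpha> > 0"
  shows "norm (char_ratio c \<alpha> n \<theta>) \<le> exp (- cos_defect c \<alpha> \<theta>)"
  using Re_log_gf_diff_le[OF assms, of \<theta>] by (simp add: char_ratio_def)

lemma log_gf_lipschitz:
  assumes c: "subweight c" and "\<alpha> > 0"
  shows "norm (log_gf c (Complex \<alpha> x) - log_gf c (Complex \<alpha> y)) \<le> \<bar>x - y\<bar> * moment c 1 \<alpha>"
proof (rule norm_infsum_le)
  show "((\<lambda>p. log_gf_term c (Complex \<alpha> x) p - log_gf_term c (Complex \<alpha> y) p) has_sum (log_gf c (Complex \<alpha> x) - log_gf c (Complex \<alpha> y))) UNIV"
    unfolding log_gf_def using assms by (intro has_sum_difference has_sum_infsum log_gf_term_summable) auto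
  show "((\<lambda>p. \<bar>x - y\<bar> * moment_term c 1 \<alpha> p) has_sum (\<bar>x - y\<bar> * moment c 1 \<alpha>)) UNIV"
    unfolding moment_def using assms by (intro has_sum_cmult_right has_sum_infsum subweight_moment_summable) auto
  fix p :: "nat \<times> nat"
  obtain j k where p: "p = (j, k)" by (cases p)
  define z where "z = real (Suc j) * real (Suc k)"
  define E where "E = exp (- (\<alpha> * z))"
  define g where "g = c (Suc k) / real (Suc j)"
  have g0: "g \<ge> 0" using c by (simp add: g_def subweight_def)
  have z0: "z \<ge> 0" by (simp add: z_def)
  have cexp: "exp (- (Complex \<alpha> t * of_real z)) = of_real E * exp (- (\<i> * of_real (t * z)))" for t
  proof -
    have "- (Complex \<alpha> t * of_real z) = of_real (- (\<alpha> * z)) + - (\<i> * of_real (t * z))"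
      by (simp add: complex_eq_iff)
    then show ?thesis unfolding E_def exp_of_real[symmetric] by (simp only: exp_add)
  qed
  have l: "log_gf_term c (Complex \<alpha> t) p = of_real g * (of_real E * exp (- (\<i> * of_real (t * z))))" for t
    unfolding p log_gf_term_def prod.case g_def[symmetric] z_def[symmetric] cexp ..
  have split: "exp (- (\<i> * of_real (x * z))) = exp (- (\<i> * of_real (y * z))) * exp (\<i> * complex_of_real ((y - x) * z))"
    unfolding exp_add[symmetric] by (rule arg_cong[where f = exp]) (simp add: algebra_simps)
  have "log_gf_term c (Complex \<alpha> x) p - log_gf_term c (Complex \<alpha> y) p =
     of_real (g * E) * (exp (- (\<i> * of_real (y * z))) * (exp (\<i> * complex_of_real ((y - x) * z)) - 1))"
    unfolding l split by (simp add: algebra_simps)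
  then have "norm (log_gf_term c (Complex \<alpha> x) p - log_gf_term c (Complex \<alpha> y) p) = (g * E) * norm (exp (\<i> * complex_of_real ((y - x) * z)) - 1)"
    using g0 by (simp add: norm_mult E_def)
  also have "\<dots> \<le> (g * E) * \<bar>(y - x) * z\<bar>"
    using iexp_approx1[of "(y - x) * z" 0] g0 by (intro mult_left_mono) (auto simp: E_def)
  also have "\<dots> = \<bar>x - y\<bar> * (g * E * z)"
    using z0 by (simp add: abs_mult abs_minus_commute)
  also have "g * E * z = moment_term c 1 \<alpha> p"
    by (simp add: p moment_term_def g_def E_def z_def mult_ac del: of_nat_Suc)
  finally show "norm (log_gf_term c (Complex \<alpha> x) p - log_gf_term c (Complex \<alpha> y) p) \<le> \<bar>x - y\<bar> * moment_term c 1 \<alpha> p" .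
qed

lemma log_gf_continuous:
  assumes c: "subweight c" and "\<alpha> > 0"
  shows "continuous_on UNIV (\<lambda>\<theta>. log_gf c (Complex \<alpha> \<theta>))"
proof (rule continuous_at_imp_continuous_on, rule ballI)
  fix a :: real
  have "((\<lambda>\<theta>. log_gf c (Complex \<alpha> \<theta>)) \<longlongrightarrow> log_gf c (Complex \<alpha> a)) (at a)"
  proof (rule LIM_zero_cancel, rule Lim_null_comparison)
    show "\<forall>\<^sub>F x in at a. norm (log_gf c (Complex \<alpha> x) - log_gf c (Complex \<alpha> a)) \<le> \<bar>x - a\<bar> * moment c 1 \<alpha>"
      using log_gf_lipschitz[OF assms] by simp
    have "((\<lambda>x. \<bar>x - a\<bar> * moment c 1 \<alpha>) \<longlongrightarrow> \<bar>a - a\<bar> * moment c 1 \<alpha>) (at a)"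
      by (intro tendsto_intros)
    then show "((\<lambda>x. \<bar>x - a\<bar> * moment c 1 \<alpha>) \<longlongrightarrow> 0) (at a)" by simp
  qed
  then show "isCont (\<lambda>\<theta>. log_gf c (Complex \<alpha> \<theta>)) a" by (simp add: isCont_def)
qed

lemma char_ratio_continuous:
  assumes c: "subweight c" and "\<alpha> > 0"
  shows "continuous_on UNIV (char_ratio c \<alpha> n)"
  unfolding char_ratio_def[abs_def]
  by (intro continuous_intros log_gf_continuous assms)

text \<open>Dominated convergence after the substitution \<theta> = v \<open>e n\<close>, where 1 /
  \<open>e n\<close> has the order of the standard deviation. Since \<alpha> n is the saddle point
  of b, the linear term left over for c is the mean of the discarded weights; \<open>d1\<close> and
  \<open>d2\<close> say that the mean and variance lost are negligible against standard deviation
  and variance. The case c = b serves the denominator of the probability, the truncated weights its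
  numerator.\<close>

lemma local_limit_integral:
  fixes \<alpha> :: "nat \<Rightarrow> real" and c :: "nat \<Rightarrow> nat \<Rightarrow> real" and K \<epsilon> C2 :: real
  assumes pos: "\<And>n. \<alpha> n > 0" and lim: "\<alpha> \<longlonglongrightarrow> 0"
    and saddle: "\<And>n. n \<ge> 1 \<Longrightarrow> moment b 1 (\<alpha> n) = real n"
    and c: "\<And>n. subweight (c n)"
    and cb: "\<forall>\<^sub>F n in sequentially. \<forall>k\<ge>1. real k \<le> 1 / \<alpha> n \<longrightarrow> c n k = b k"
    and tail: "\<forall>\<^sub>F n in sequentially. laplace_sum (\<lambda>k. b k - c n k) 0 (\<alpha> n) \<le> K"
    and d1: "(\<lambda>n. \<alpha> n powr (1 + \<rho> / 2) * moment (\<lambda>k. b k - c n k) 1 (\<alpha> n)) \<longlonglongrightarrow> 0"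
    and d2: "(\<lambda>n. \<alpha> n powr (2 + \<rho>) * moment (\<lambda>k. b k - c n k) 2 (\<alpha> n)) \<longlonglongrightarrow> 0"
    and eps: "\<epsilon> > 0" "C2 > 0"
    and M3: "\<forall>\<^sub>F \<alpha> in at_right 0. \<forall>\<theta>. \<alpha> < \<bar>\<theta>\<bar> \<longrightarrow> \<bar>\<theta>\<bar> \<le> pi \<longrightarrow> cos_defect b \<alpha> \<theta> \<ge> C2 * \<alpha> powr (- \<epsilon>)"
  defines "e \<equiv> \<lambda>n. \<alpha> n powr (1 + \<rho> / 2)"
  shows "(\<lambda>n. \<integral>v. indicator {- pi / e n..pi / e n} v *\<^sub>R char_ratio (c n) (\<alpha> n) n (v * e n) \<partial>lborel)
      \<longlonglongrightarrow> (\<integral>v. exp (of_real (- (var_const / 2 * v\<^sup>2))) \<partial>lborel)"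
proof -
  have lim0: "filterlim \<alpha> (at_right 0) sequentially"
    unfolding filterlim_at using lim pos by (auto intro!: always_eventually simp: less_imp_neq[symmetric])
  have e_pos: "e n > 0" for n using pos[of n] by (simp add: e_def)
  have e2: "(e n)\<^sup>2 = \<alpha> n powr (2 + \<rho>)" for n
    using pos[of n] unfolding e_def power2_eq_square powr_add[symmetric] by simp
  obtain \<kappa> where kappa: "\<kappa> > 0" and central: "\<forall>\<^sub>F \<alpha> in at_right 0. \<forall>c \<theta>. subweight c \<longrightarrow> (\<forall>k\<ge>1. real k \<le> 1 / \<alpha> \<longrightarrow> c k = b k) \<longrightarrow> \<bar>\<theta>\<bar> \<le> \<alpha> \<longrightarrow>
     cos_defect c \<alpha> \<theta> \<ge> \<kappa> * (\<theta>\<^sup>2 * \<alpha> powr (- (\<rho> + 2)))"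
    using cos_defect_central by blast
  \<comment> \<open>Off the central arc the integrand is at most a constant times
    \<open>exp (- (C2 * \<alpha> powr (- \<epsilon>)))\<close>. There |\<theta>| \<le> pi gives 1 +
    v^2 \<le> 1 + pi^2 \<alpha>^(-(2 + \<rho>)), a power that the exponential absorbs.\<close>
  have small: "\<forall>\<^sub>F \<alpha> in at_right 0. (1 + pi\<^sup>2 * \<alpha> powr (- (2 + \<rho>))) * exp (- (C2 * \<alpha> powr (- \<epsilon>))) \<le> 1"
  proof -
    have "((\<lambda>\<alpha>::real. (1 + pi\<^sup>2 * \<alpha> powr (- (2 + \<rho>))) * exp (- (C2 * \<alpha> powr (- \<epsilon>)))) \<longlongrightarrow> 0) (at_right 0)"
      using eps rho_pos by real_asymp
    from order_tendstoD(2)[OF this, of 1] show ?thesis by (auto elim: eventually_mono)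
  qed
  \<comment> \<open>The summands 1 + 1 / \<kappa> come from the central arc, where exp (- \<kappa>
    v^2) \<le> 1 / (1 + \<kappa> v^2) \<le> (1 + 1 / \<kappa>) / (1 + v^2); the summand
    \<open>exp (2 * K)\<close> is the loss by truncation off that arc.\<close>
  define Dm where "Dm v = (1 + 1 / \<kappa> + exp (2 * K)) * (1 / (1 + v\<^sup>2))" for v :: real
  have Dint: "integrable lborel Dm"
    unfolding Dm_def by (intro integrable_mult_right integrable_inverse_one_plus_square)
  have bound: "\<forall>\<^sub>F n in sequentially. \<forall>v. \<bar>v * e n\<bar> \<le> pi \<longrightarrow> norm (char_ratio (c n) (\<alpha> n) n (v * e n)) \<le> Dm v"
    using cb tail eventually_compose_filterlim[OF central lim0] eventually_compose_filterlim[OF M3 lim0] eventually_compose_filterlim[OF small lim0]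
  proof eventually_elim
    case (elim n)
    show ?case
    proof (intro allI impI)
      fix v :: real assume v: "\<bar>v * e n\<bar> \<le> pi"
      define \<theta> where "\<theta> = v * e n"
      have v1: "1 + v\<^sup>2 > 0" by (simp add: add_pos_nonneg)
      have nb: "norm (char_ratio (c n) (\<alpha> n) n \<theta>) \<le> exp (- cos_defect (c n) (\<alpha> n) \<theta>)"
        by (rule norm_char_ratio[OF c pos])
      have parts: "(1 + 1 / \<kappa>) * (1 / (1 + v\<^sup>2)) \<le> Dm v" "exp (2 * K) * (1 / (1 + v\<^sup>2)) \<le> Dm v"
        unfolding Dm_def using kappa v1 by (intro mult_right_mono; simp)+
      show "norm (char_ratio (c n) (\<alpha> n) n (v * e n)) \<le> Dm v"
      proof (cases "\<bar>\<theta>\<bar> \<le> \<alpha> n")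
        case True
        have "\<kappa> * (\<theta>\<^sup>2 * \<alpha> n powr (- (\<rho> + 2))) \<le> cos_defect (c n) (\<alpha> n) \<theta>"
          using elim(3) c elim(1) True by blast
        also have "\<theta>\<^sup>2 * \<alpha> n powr (- (\<rho> + 2)) = v\<^sup>2 * (\<alpha> n powr (2 + \<rho>) * \<alpha> n powr (- (\<rho> + 2)))"
          by (simp add: \<theta>_def power_mult_distrib e2)
        also have "\<alpha> n powr (2 + \<rho>) * \<alpha> n powr (- (\<rho> + 2)) = 1"
          using pos[of n] by (simp add: powr_add[symmetric])
        finally have "exp (- cos_defect (c n) (\<alpha> n) \<theta>) \<le> exp (- (\<kappa> * v\<^sup>2))" by simp
        also have "\<dots> \<le> 1 / (1 + \<kappa> * v\<^sup>2)"
        proof -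
          have "1 + \<kappa> * v\<^sup>2 \<le> exp (\<kappa> * v\<^sup>2)" by (rule exp_ge_add_one_self)
          moreover have "1 + \<kappa> * v\<^sup>2 > 0" using kappa by (simp add: add_pos_nonneg)
          ultimately have "1 / exp (\<kappa> * v\<^sup>2) \<le> 1 / (1 + \<kappa> * v\<^sup>2)" by (intro divide_left_mono) auto
          then show ?thesis by (simp add: exp_minus divide_inverse)
        qed
        also have "\<dots> \<le> (1 + 1 / \<kappa>) * (1 / (1 + v\<^sup>2))"
        proof -
          have "1 + v\<^sup>2 \<le> (1 + 1 / \<kappa>) * (1 + \<kappa> * v\<^sup>2)"
            using kappa by (simp add: field_simps)
          moreover have "1 + \<kappa> * v\<^sup>2 > 0" using kappa by (simp add: add_pos_nonneg)
          ultimately show ?thesis using v1 by (simp add: divide_le_eq pos_le_divide_eq mult.commute)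
        qed
        finally show ?thesis using nb parts(1) unfolding \<theta>_def by linarith
      next
        case False
        have "cos_defect b (\<alpha> n) \<theta> \<ge> C2 * \<alpha> n powr (- \<epsilon>)"
          using elim(4) False v by (simp add: \<theta>_def)
        moreover have "cos_defect (c n) (\<alpha> n) \<theta> \<ge> cos_defect b (\<alpha> n) \<theta> - 2 * laplace_sum (\<lambda>k. b k - c n k) 0 (\<alpha> n)"
          by (rule cos_defect_ge_diff[OF c pos])
        ultimately have "- cos_defect (c n) (\<alpha> n) \<theta> \<le> 2 * K + - (C2 * \<alpha> n powr (- \<epsilon>))"
          using elim(2) by linarith
        then have "exp (- cos_defect (c n) (\<alpha> n) \<theta>) \<le> exp (2 * K) * exp (- (C2 * \<alpha> n powr (- \<epsilon>)))"
          unfolding exp_add[symmetric] by simp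
        also have "\<dots> \<le> exp (2 * K) * (1 / (1 + v\<^sup>2))"
        proof (rule mult_left_mono)
          have "v\<^sup>2 * \<alpha> n powr (2 + \<rho>) = (v * e n)\<^sup>2" by (simp add: power_mult_distrib e2)
          also have "\<dots> \<le> pi\<^sup>2" using v by (intro abs_le_square_iff[THEN iffD1]) simp
          finally have "v\<^sup>2 * \<alpha> n powr (2 + \<rho>) * \<alpha> n powr (- (2 + \<rho>)) \<le> pi\<^sup>2 * \<alpha> n powr (- (2 + \<rho>))"
            by (rule mult_right_mono) simp
          moreover have "\<alpha> n powr (2 + \<rho>) * \<alpha> n powr (- (2 + \<rho>)) = 1" using pos[of n] by (simp add: powr_add[symmetric])
          ultimately have "1 + v\<^sup>2 \<le> 1 + pi\<^sup>2 * \<alpha> n powr (- (2 + \<rho>))" by (simp add: mult.assoc)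
          then have "(1 + v\<^sup>2) * exp (- (C2 * \<alpha> n powr (- \<epsilon>))) \<le> (1 + pi\<^sup>2 * \<alpha> n powr (- (2 + \<rho>))) * exp (- (C2 * \<alpha> n powr (- \<epsilon>)))"
            by (rule mult_right_mono) simp
          also note elim(5)
          finally show "exp (- (C2 * \<alpha> n powr (- \<epsilon>))) \<le> 1 / (1 + v\<^sup>2)"
            using v1 by (simp add: pos_le_divide_eq mult.commute)
        qed simp
        finally show ?thesis using nb parts(2) unfolding \<theta>_def by linarith
      qed
    qed
  qed
  have ptw: "(\<lambda>n. char_ratio (c n) (\<alpha> n) n (v * e n)) \<longlonglongrightarrow> exp (of_real (- (var_const / 2 * v\<^sup>2)))" for v
  proof -
    \<comment> \<open>The Taylor remainder. Cubed, \<open>e n\<close> is \<alpha>^(3 + 3 \<rho> /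
      2), while the third moment grows like \<alpha>^(-(\<rho> + 3)); a factor \<alpha>^(\<rho> / 2)
      is left over.\<close>
    define T where "T n = log_gf (c n) (Complex (\<alpha> n) (v * e n)) - log_gf (c n) (of_real (\<alpha> n)) + \<i> * of_real (v * e n) * of_real (moment (c n) 1 (\<alpha> n))
        + of_real ((v * e n)\<^sup>2 / 2 * moment (c n) 2 (\<alpha> n))" for n
    have T: "T \<longlonglongrightarrow> 0"
    proof (rule Lim_null_comparison)
      show "\<forall>\<^sub>F n in sequentially. norm (T n) \<le> \<bar>v\<bar> ^ 3 / 6 * (\<alpha> n powr (\<rho> / 2) * (\<alpha> n powr (\<rho> + 3) * moment b 3 (\<alpha> n)))"
      proof (intro always_eventually allI)
        fix n
        have "norm (T n) \<le> \<bar>v * e n\<bar> ^ 3 / 6 * moment b 3 (\<alpha> n)"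
          unfolding T_def using log_gf_taylor[where c = "c n" and \<alpha> = "\<alpha> n" and \<theta> = "v * e n", OF c pos] by simp
        also have "\<bar>v * e n\<bar> ^ 3 = \<bar>v\<bar> ^ 3 * e n ^ 3" using e_pos[of n] by (simp add: abs_mult power_mult_distrib)
        also have "e n ^ 3 = \<alpha> n powr (\<rho> / 2) * \<alpha> n powr (\<rho> + 3)"
          unfolding power3_eq_cube e_def powr_add[symmetric] by (simp add: add.commute)
        finally show "norm (T n) \<le> \<bar>v\<bar> ^ 3 / 6 * (\<alpha> n powr (\<rho> / 2) * (\<alpha> n powr (\<rho> + 3) * moment b 3 (\<alpha> n)))" by (simp add: mult_ac)
      qed
      have "((\<lambda>\<alpha>. \<alpha> powr (\<rho> / 2)) \<longlongrightarrow> 0) (at_right 0)" using rho_pos by real_asymp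
      from filterlim_compose[OF this lim0] have "(\<lambda>n. \<alpha> n powr (\<rho> / 2)) \<longlonglongrightarrow> 0" .
      moreover have "(\<lambda>n. \<alpha> n powr (\<rho> + 3) * moment b 3 (\<alpha> n)) \<longlonglongrightarrow> A * Gamma (\<rho> + 3) * zeta_real (\<rho> + 1)"
        using filterlim_compose[OF moment_asymptotic[of 3] lim0] by simp
      ultimately have "(\<lambda>n. \<bar>v\<bar> ^ 3 / 6 * (\<alpha> n powr (\<rho> / 2) * (\<alpha> n powr (\<rho> + 3) * moment b 3 (\<alpha> n)))) \<longlonglongrightarrow> \<bar>v\<bar> ^ 3 / 6 * (0 * (A * Gamma (\<rho> + 3) * zeta_real (\<rho> + 1)))"
        by (rule tendsto_mult_left[OF tendsto_mult])
      then show "(\<lambda>n. \<bar>v\<bar> ^ 3 / 6 * (\<alpha> n powr (\<rho> / 2) * (\<alpha> n powr (\<rho> + 3) * moment b 3 (\<alpha> n)))) \<longlonglongrightarrow> 0" by simp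
    qed
    define d where "d n = (\<lambda>k. b k - c n k)" for n
    have d1': "(\<lambda>n. e n * moment (d n) 1 (\<alpha> n)) \<longlonglongrightarrow> 0" and d2': "(\<lambda>n. \<alpha> n powr (2 + \<rho>) * moment (d n) 2 (\<alpha> n)) \<longlonglongrightarrow> 0"
      using d1 d2 by (simp_all only: d_def e_def)
    have m2: "(\<lambda>n. \<alpha> n powr (2 + \<rho>) * moment b 2 (\<alpha> n)) \<longlonglongrightarrow> var_const"
      using filterlim_compose[OF moment_asymptotic[of 2] lim0] by (simp add: var_const_def add.commute)
    have "(\<lambda>n. T n + \<i> * of_real (v * (e n * moment (d n) 1 (\<alpha> n))) - of_real (v\<^sup>2 / 2 * (\<alpha> n powr (2 + \<rho>) * moment b 2 (\<alpha> n) - \<alpha> n powr (2 + \<rho>) * moment (d n) 2 (\<alpha> n))))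
        \<longlonglongrightarrow> 0 + \<i> * of_real (v * 0) - of_real (v\<^sup>2 / 2 * (var_const - 0))"
      using d1' d2' by (intro tendsto_add tendsto_diff tendsto_mult_left tendsto_of_real T m2)
    then have "(\<lambda>n. T n + \<i> * of_real (v * (e n * moment (d n) 1 (\<alpha> n))) - of_real (v\<^sup>2 / 2 * (\<alpha> n powr (2 + \<rho>) * moment b 2 (\<alpha> n) - \<alpha> n powr (2 + \<rho>) * moment (d n) 2 (\<alpha> n))))
        \<longlonglongrightarrow> of_real (- (var_const / 2 * v\<^sup>2))" by (simp add: mult_ac)
    \<comment> \<open>The saddle point equation enters here: n minus the mean of c is the mean of b
      - c. It is available for n \<ge> 1, so the identity holds only eventually.\<close>
    moreover have "\<forall>\<^sub>F n in sequentially. T n + \<i> * of_real (v * (e n * moment (d n) 1 (\<alpha> n))) - of_real (v\<^sup>2 / 2 * (\<alpha> n powr (2 + \<rho>) * moment b 2 (\<alpha> n) - \<alpha> n powr (2 + \<rho>) * moment (d n) 2 (\<alpha> n)))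
        = log_gf (c n) (Complex (\<alpha> n) (v * e n)) - log_gf (c n) (of_real (\<alpha> n)) + \<i> * of_real (real n * (v * e n))"
      using eventually_ge_at_top[of 1]
    proof eventually_elim
      case (elim n)
      have m1: "moment (d n) 1 (\<alpha> n) = real n - moment (c n) 1 (\<alpha> n)"
        unfolding d_def using moment_diff[OF c, of 1] pos saddle elim by simp
      have m2: "moment (d n) 2 (\<alpha> n) = moment b 2 (\<alpha> n) - moment (c n) 2 (\<alpha> n)"
        unfolding d_def using moment_diff[OF c, of 2] pos by simp
      show ?case unfolding T_def m1 m2 power_mult_distrib e2 by (simp add: algebra_simps)
    qed
    ultimately have "(\<lambda>n. log_gf (c n) (Complex (\<alpha> n) (v * e n)) - log_gf (c n) (of_real (\<alpha> n)) + \<i> * of_real (real n * (v * e n))) \<longlonglongrightarrow> of_real (- (var_const / 2 * v\<^sup>2))"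
      by (rule Lim_transform_eventually)
    then show ?thesis unfolding char_ratio_def by (rule tendsto_exp)
  qed
  obtain N where N: "\<And>n v. n \<ge> N \<Longrightarrow> \<bar>v * e n\<bar> \<le> pi \<Longrightarrow> norm (char_ratio (c n) (\<alpha> n) n (v * e n)) \<le> Dm v"
    using bound unfolding eventually_sequentially by blast
  have range: "v \<in> {- pi / e n..pi / e n} \<longleftrightarrow> \<bar>v * e n\<bar> \<le> pi" for v n
    using e_pos[of n] by (auto simp: abs_le_iff field_simps)
  define F where "F n v = indicator {- pi / e n..pi / e n} v *\<^sub>R char_ratio (c n) (\<alpha> n) n (v * e n)" for n v
  have "(\<lambda>n. \<integral>v. F (n + N) v \<partial>lborel) \<longlonglongrightarrow> (\<integral>v. exp (of_real (- (var_const / 2 * v\<^sup>2))) \<partial>lborel)"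
  proof (rule integral_dominated_convergence[OF _ _ Dint])
    show "(\<lambda>v. exp (complex_of_real (- (var_const / 2 * v\<^sup>2)))) \<in> borel_measurable lborel" by measurable
    show "F (n + N) \<in> borel_measurable lborel" for n
    proof -
      have "continuous_on UNIV (\<lambda>v. char_ratio (c (n + N)) (\<alpha> (n + N)) (n + N) (v * e (n + N)))"
        by (rule continuous_on_compose2[OF char_ratio_continuous[OF c pos]]) (auto intro!: continuous_intros)
      then have "(\<lambda>v. char_ratio (c (n + N)) (\<alpha> (n + N)) (n + N) (v * e (n + N))) \<in> borel_measurable borel"
        by (rule borel_measurable_continuous_onI)
      then show ?thesis unfolding F_def[abs_def] by simp
    qed
    show "AE v in lborel. (\<lambda>n. F (n + N) v) \<longlonglongrightarrow> exp (of_real (- (var_const / 2 * v\<^sup>2)))"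
    proof (intro AE_I2 LIMSEQ_ignore_initial_segment)
      fix v :: real
      have "((\<lambda>\<alpha>. \<alpha> powr (1 + \<rho> / 2)) \<longlongrightarrow> 0) (at_right 0)" using rho_pos by real_asymp
      from filterlim_compose[OF this lim0] have "e \<longlonglongrightarrow> 0" unfolding e_def .
      then have "(\<lambda>n. \<bar>v * e n\<bar>) \<longlonglongrightarrow> \<bar>v * 0\<bar>" by (intro tendsto_intros)
      then have "\<forall>\<^sub>F n in sequentially. \<bar>v * e n\<bar> < pi" by (intro order_tendstoD(2)[of _ "\<bar>v * 0\<bar>"]) auto
      then have "\<forall>\<^sub>F n in sequentially. char_ratio (c n) (\<alpha> n) n (v * e n) = F n v"
        by eventually_elim (use range in \<open>auto simp: F_def indicator_def\<close>)
      with ptw[of v] show "(\<lambda>n. F n v) \<longlonglongrightarrow> exp (of_real (- (var_const / 2 * v\<^sup>2)))"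
        by (rule Lim_transform_eventually)
    qed
    show "AE v in lborel. norm (F (n + N) v) \<le> Dm v" for n
    proof (intro AE_I2)
      fix v :: real
      have "Dm v \<ge> 0" unfolding Dm_def using kappa by (intro mult_nonneg_nonneg) (auto simp: add_nonneg_nonneg)
      then show "norm (F (n + N) v) \<le> Dm v"
        using N[of "n + N" v] range[of v "n + N"] by (auto simp: F_def indicator_def)
    qed
  qed
  then show ?thesis unfolding F_def by (rule LIMSEQ_offset)
qed

end

section \<open>Coefficients of the generating function\<close>

text \<open>Cauchy's formula on the circle z = r \<open>exp (- i \<theta>)\<close>. This orientation
  makes z = \<open>exp (- \<tau>)\<close> with \<tau> = \<alpha> + i \<theta> and r =
  \<open>exp (- \<alpha>)\<close>, the variable of \<open>log_gf\<close>.\<close>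

lemma fps_expansion_nth_circle:
  fixes F :: "complex \<Rightarrow> complex"
  assumes hol: "F holomorphic_on ball 0 1" and r: "0 < r" "r < 1"
  shows "((\<lambda>\<theta>. F (of_real r * exp (- (\<i> * of_real \<theta>))) * exp (\<i> * of_real (real n * \<theta>)))
      has_integral (2 * pi * (fps_nth (fps_expansion F 0) n * of_real (r ^ n)))) {-pi..pi}"
proof -
  define a where "a = fps_nth (fps_expansion F 0) n"
  define H where "H \<theta> = F (of_real r * exp (- (\<i> * of_real \<theta>))) * exp (\<i> * of_real (real n * \<theta>))" for \<theta> :: real
  \<comment> \<open>The reflection turns the parameter range of \<open>circlepath\<close> into \<open>{-pi..pi}\<close>.\<close>
  define G where "G z = F (- z)" for z
  have Ghol: "G holomorphic_on ball 0 1"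
  proof -
    have m: "(\<lambda>z::complex. - z) holomorphic_on ball 0 1" by (intro holomorphic_intros)
    have "(\<lambda>z::complex. - z) ` ball 0 1 \<subseteq> ball 0 1" by auto
    from holomorphic_on_compose_gen[OF m hol this] show ?thesis
      by (simp add: G_def[abs_def] o_def)
  qed
  have dG: "(deriv ^^ n) G 0 = (-1) ^ n * (deriv ^^ n) F 0"
    using higher_deriv_compose_linear[where f = F and T = "ball 0 1" and S = "ball 0 1" and z = 0 and u = "-1" and n = n] hol
    unfolding G_def by simp
  have "((\<lambda>u. G u / (u - 0) ^ Suc n) has_contour_integral (2 * pi * \<i> / fact n * (deriv ^^ n) G 0)) (circlepath 0 r)"
  proof (rule Cauchy_has_contour_integral_higher_derivative_circlepath)
    show "continuous_on (cball 0 r) G"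
      using r by (intro holomorphic_on_imp_continuous_on holomorphic_on_subset[OF Ghol]) auto
    show "G holomorphic_on ball 0 r"
      using r by (intro holomorphic_on_subset[OF Ghol]) auto
  qed (use r in auto)
  also have "2 * pi * \<i> / fact n * (deriv ^^ n) G 0 = 2 * pi * \<i> * ((-1) ^ n * a)"
    by (simp add: dG a_def fps_expansion_def)
  finally have "((\<lambda>t. G (circlepath 0 r t) / (circlepath 0 r t) ^ Suc n * vector_derivative (circlepath 0 r) (at t within {0..1})) has_integral (2 * pi * \<i> * ((-1) ^ n * a))) {0..1}"
    by (simp add: has_contour_integral_def)
  then have "((\<lambda>t. 2 * pi * \<i> * ((-1) ^ n / of_real (r ^ n) * H (- 2 * pi * t + pi))) has_integral (2 * pi * \<i> * ((-1) ^ n * a))) {0..1}"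
  proof (rule has_integral_eq[rotated])
    fix t :: real assume t: "t \<in> {0..1}"
    define u where "u = of_real r * exp (2 * of_real pi * \<i> * of_real t)"
    have u: "circlepath 0 r t = u" by (simp add: circlepath_def part_circlepath_def linepath_def u_def mult_ac)
    have u0: "u \<noteq> 0" using r by (simp add: u_def)
    have vd: "vector_derivative (circlepath 0 r) (at t within {0..1}) = 2 * pi * \<i> * u"
      using t by (subst vector_derivative_circlepath01) (auto simp: u_def)
    have e1: "of_real r * exp (- (\<i> * of_real (- 2 * pi * t + pi))) = - u"
    proof -
      have "- (\<i> * of_real (- 2 * pi * t + pi)) = 2 * of_real pi * \<i> * of_real t + - (\<i> * of_real pi)"
        by (simp add: algebra_simps)
      then have "exp (- (\<i> * of_real (- 2 * pi * t + pi))) = exp (2 * of_real pi * \<i> * of_real t) * exp (- (\<i> * of_real pi))"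
        by (simp only: exp_add)
      also have "exp (- (\<i> * of_real pi)) = -1" by (simp add: exp_minus)
      finally show ?thesis by (simp add: u_def)
    qed
    have e2: "exp (\<i> * of_real (real n * (- 2 * pi * t + pi))) * u ^ n = (-1) ^ n * of_real (r ^ n)"
    proof -
      have "exp (\<i> * of_real (real n * (- 2 * pi * t + pi))) = exp (\<i> * of_real (- 2 * pi * t + pi)) ^ n"
        by (subst exp_of_nat_mult[symmetric]) (simp add: algebra_simps)
      then have "exp (\<i> * of_real (real n * (- 2 * pi * t + pi))) * u ^ n = (exp (\<i> * of_real (- 2 * pi * t + pi)) * u) ^ n"
        by (simp only: power_mult_distrib)
      also have "exp (\<i> * of_real (- 2 * pi * t + pi)) * u = of_real r * (exp (\<i> * of_real (- 2 * pi * t + pi)) * exp (2 * of_real pi * \<i> * of_real t))"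
        by (simp add: u_def)
      also have "exp (\<i> * of_real (- 2 * pi * t + pi)) * exp (2 * of_real pi * \<i> * of_real t) = exp (\<i> * of_real pi)"
        unfolding exp_add[symmetric] by (rule arg_cong[where f = exp]) (simp add: algebra_simps)
      also have "exp (\<i> * of_real pi) = -1" by simp
      finally show ?thesis by (simp add: power_mult_distrib[symmetric])
    qed
    have "H (- 2 * pi * t + pi) = F (- u) * exp (\<i> * of_real (real n * (- 2 * pi * t + pi)))"
      unfolding H_def e1 ..
    also have "\<dots> = F (- u) * ((-1) ^ n * of_real (r ^ n) / u ^ n)"
      using e2 u0 by (simp add: field_simps)
    finally have "(-1) ^ n / of_real (r ^ n) * H (- 2 * pi * t + pi) = ((-1) ^ n * (-1) ^ n) * (F (- u) / u ^ n)"
      using r by (simp add: mult_ac)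
    also have "(-1) ^ n * (-1) ^ n = (1 :: complex)" by (simp add: power_mult_distrib[symmetric])
    finally show "G (circlepath 0 r t) / circlepath 0 r t ^ Suc n * vector_derivative (circlepath 0 r) (at t within {0..1})
        = 2 * pi * \<i> * ((-1) ^ n / of_real (r ^ n) * H (- 2 * pi * t + pi))"
      unfolding u vd G_def using u0 by simp
  qed
  then have "((\<lambda>t. 1 / (2 * pi * \<i> * ((-1) ^ n / of_real (r ^ n))) * (2 * pi * \<i> * ((-1) ^ n / of_real (r ^ n) * H (- 2 * pi * t + pi)))) has_integral
      (1 / (2 * pi * \<i> * ((-1) ^ n / of_real (r ^ n))) * (2 * pi * \<i> * ((-1) ^ n * a)))) {0..1}"
    by (rule has_integral_mult_right)
  then have I1: "((\<lambda>t. H (- 2 * pi * t + pi)) has_integral (a * of_real (r ^ n))) {0..1}"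
    using r by (simp add: field_simps)
  have "continuous_on {-pi..pi} H"
  proof -
    have "continuous_on {-pi..pi} (\<lambda>\<theta>. F (of_real r * exp (- (\<i> * of_real \<theta>))))"
      using r by (intro continuous_on_compose2[OF holomorphic_on_imp_continuous_on[OF hol]] continuous_intros)
        (auto simp: norm_mult)
    then show ?thesis unfolding H_def by (intro continuous_intros)
  qed
  then have "H integrable_on {-pi..pi}" by (rule integrable_continuous_real)
  then obtain I where I: "(H has_integral I) (cbox (-pi) pi)" by (auto simp: integrable_on_def)
  have "((\<lambda>t. H (- 2 * pi * t + pi)) has_integral (1 / (2 * pi)) *\<^sub>R I) {0..1}"
  proof -
    have "(\<lambda>x. 1 / 2 - x / (2 * pi)) ` {-pi..pi} = {0..1}"
    proof (intro antisym subsetI)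
      fix t :: real assume "t \<in> {0..1}"
      then have "pi - 2 * pi * t \<in> {-pi..pi}" "t = 1 / 2 - (pi - 2 * pi * t) / (2 * pi)"
        by (auto simp: field_simps)
      then show "t \<in> (\<lambda>x. 1 / 2 - x / (2 * pi)) ` {-pi..pi}" by (rule rev_image_eqI)
    qed (auto simp: field_simps)
    then show ?thesis using has_integral_affinity[OF I, of "- 2 * pi" pi] by simp
  qed
  from has_integral_unique[OF this I1] have "I = 2 * pi * (a * of_real (r ^ n))"
    by (simp add: scaleR_conv_of_real field_simps)
  with I show ?thesis unfolding H_def a_def by simp
qed

context power_weights
begin

text \<open>The logarithm of the product is a series of holomorphic functions, dominated near x by 2
  \<open>b k\<close> r^k with r midway between |x| and 1. Writing r as
  \<open>exp (- \<beta>)\<close> reduces summability to the Laplace sum of b, and exponentials of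
  partial sums are partial products.\<close>

lemma subweight_gf:
  assumes c: "subweight c"
  shows weighted_gf_holomorphic: "weighted_gf c holomorphic_on ball 0 1"
    and weighted_gf_exp: "norm x < 1 \<Longrightarrow> \<exists>L. (\<lambda>k. - of_real (c (Suc k)) * Ln (1 - x ^ Suc k)) sums L \<and> weighted_gf c x = exp L"
proof -
  define f where "f k x = - of_real (c (Suc k)) * Ln (1 - x ^ Suc k)" for k and x :: complex
  have pos: "Re (1 - x ^ Suc k) > 0" if "norm x < 1" for x :: complex and k
  proof -
    have "norm (x ^ Suc k) < 1" unfolding norm_power using that by (intro le_less_trans[OF power_Suc_le_self]) auto
    then show ?thesis using complex_Re_le_cmod[of "x ^ Suc k"] by simp
  qed
  have fdiff: "f k field_differentiable (at x)" if "norm x < 1" for x k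
  proof -
    have "1 - x ^ Suc k \<notin> \<real>\<^sub>\<le>\<^sub>0" using pos[OF that, of k] by (auto simp: complex_nonpos_Reals_iff)
    then show ?thesis unfolding f_def[abs_def]
      by (intro field_differentiable_mult field_differentiable_const field_differentiable_compose[of "\<lambda>x. 1 - x ^ Suc k" _ Ln, unfolded o_def]
         field_differentiable_within_Ln field_differentiable_diff field_differentiable_power field_differentiable_ident)
  qed
  have bnd: "\<exists>d h. 0 < d \<and> summable h \<and> range h \<subseteq> \<real>\<^sub>\<ge>\<^sub>0 \<and> (\<forall>\<^sub>F n in sequentially. \<forall>y\<in>ball x d \<inter> ball 0 1. cmod (f n y) \<le> cmod (h n))"
    if x: "x \<in> ball 0 1" for x
  proof -
    define r where "r = (norm x + 1) / 2"
    have r: "0 < r" "r < 1" "norm x < r" using x by (auto simp: r_def add_nonneg_pos)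
    define h where "h k = complex_of_real (2 * (b (Suc k) * exp (- (- ln r * real (Suc k)))))" for k
    have rp: "exp (- (- ln r * real (Suc k))) = r ^ Suc k" for k
      using r by (simp add: exp_of_nat_mult[symmetric] mult.commute flip: exp_of_nat_mult del: of_nat_Suc) (metis exp_ln exp_of_nat_mult of_nat_Suc mult.commute power_Suc)
    have "summable (\<lambda>k. 2 * (b (Suc k) * exp (- (- ln r * real (Suc k)))))"
      using laplace_sum_bound(1)[of "- ln r" 0] r by (intro summable_mult) simp
    then have "summable h" unfolding h_def by (subst summable_of_real_iff)
    moreover have "range h \<subseteq> \<real>\<^sub>\<ge>\<^sub>0"
      unfolding h_def using weight_nonneg by (auto simp del: of_real_mult)
    moreover have "\<forall>\<^sub>F n in sequentially. \<forall>y\<in>ball x (r - norm x) \<inter> ball 0 1. cmod (f n y) \<le> cmod (h n)"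
    proof -
      have "(\<lambda>n. r ^ Suc n) \<longlonglongrightarrow> 0" using r by (intro LIMSEQ_Suc LIMSEQ_power_zero) auto
      then have "\<forall>\<^sub>F n in sequentially. r ^ Suc n < 1 / 2" by (rule order_tendstoD) simp
      then show ?thesis
      proof eventually_elim
        case (elim n)
        show ?case
        proof
          fix y assume y: "y \<in> ball x (r - norm x) \<inter> ball 0 1"
          have "norm y \<le> norm x + dist x y" using norm_triangle_sub[of y x] by (simp add: dist_norm norm_minus_commute)
          then have "norm y < r" using y by simp
          then have yp: "norm (y ^ Suc n) \<le> r ^ Suc n" unfolding norm_power by (intro power_mono) auto
          then have "norm (Ln (1 + (- (y ^ Suc n)))) \<le> 2 * norm (- (y ^ Suc n))"
            using elim by (intro norm_Ln_le) simp
          then have "norm (Ln (1 - y ^ Suc n)) \<le> 2 * r ^ Suc n" using yp by simp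
          moreover have "0 \<le> c (Suc n)" "c (Suc n) \<le> b (Suc n)" using c by (auto simp: subweight_def)
          ultimately have "c (Suc n) * norm (Ln (1 - y ^ Suc n)) \<le> b (Suc n) * (2 * r ^ Suc n)"
            by (intro mult_mono) auto
          moreover have "norm (f n y) = c (Suc n) * norm (Ln (1 - y ^ Suc n))"
            using \<open>0 \<le> c (Suc n)\<close> unfolding f_def norm_mult norm_minus_cancel norm_of_real by simp
          moreover have "norm (h n) = b (Suc n) * (2 * r ^ Suc n)"
            unfolding h_def rp norm_of_real using weight_nonneg[of "Suc n"] r by (simp add: abs_mult)
          ultimately show "cmod (f n y) \<le> cmod (h n)" by simp
        qed
      qed
    qed
    ultimately show ?thesis using r by (intro exI[of _ "r - norm x"] exI[of _ h]) auto
  qed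
  obtain g where g: "\<forall>x\<in>ball 0 1. ((\<lambda>n. f n x) sums g x) \<and> g field_differentiable (at x)"
  proof (rule series_differentiable_comparison_complex[of "ball (0::complex) 1" f])
    show "f n field_differentiable (at x)" if "x \<in> ball 0 1" for n x using fdiff that by simp
  qed (use bnd in auto)
  have gf: "weighted_gf c x = exp (g x)" if x: "norm x < 1" for x
  proof -
    have "(\<lambda>n. \<Sum>k\<le>n. f k x) \<longlonglongrightarrow> g x"
      using g x sums_def_le by (metis dist_0_norm mem_ball)
    then have "(\<lambda>n. exp (\<Sum>k\<le>n. f k x)) \<longlonglongrightarrow> exp (g x)" by (rule tendsto_exp)
    moreover have "exp (\<Sum>k\<le>n. f k x) = (\<Prod>k\<le>n. (1 - x ^ Suc k) powr (- of_real (c (Suc k))))" for n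
    proof -
      have "1 - x ^ Suc k \<noteq> 0" for k
      proof
        assume e: "1 - x ^ Suc k = 0"
        show False using pos[OF x, of k] unfolding e by simp
      qed
      then show ?thesis by (simp add: exp_sum f_def powr_def del: power_Suc)
    qed
    ultimately have "(\<lambda>k. (1 - x ^ Suc k) powr (- of_real (c (Suc k)))) has_prod exp (g x)"
      unfolding has_prod_def raw_has_prod_def by simp
    then show ?thesis unfolding weighted_gf_def by (rule has_prod_unique[symmetric])
  qed
  have "(\<lambda>x. exp (g x)) holomorphic_on ball 0 1"
    using g by (intro holomorphic_on_exp' ) (auto simp: holomorphic_on_open field_differentiable_def)
  then show "weighted_gf c holomorphic_on ball 0 1"
    by (rule holomorphic_transform) (use gf in auto)
  show "\<exists>L. (\<lambda>k. - of_real (c (Suc k)) * Ln (1 - x ^ Suc k)) sums L \<and> weighted_gf c x = exp L" if "norm x < 1"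
    using gf[OF that] g that unfolding f_def by auto
qed

text \<open>The double series is summed over j first: with z = \<open>exp (- \<tau>) ^ k\<close> the
  inner sum is the logarithmic series of - Ln (1 - z). Unconditional summability permits this
  order.\<close>

lemma log_gf_sums:
  assumes c: "subweight c" and tau: "Re \<tau> > 0"
  shows "(\<lambda>k. - of_real (c (Suc k)) * Ln (1 - exp (- \<tau>) ^ Suc k)) sums log_gf c \<tau>"
proof -
  have "(log_gf_term c \<tau> has_sum log_gf c \<tau>) (UNIV \<times> UNIV)"
    unfolding log_gf_def using log_gf_term_summable[OF assms] by simp
  then have "((\<lambda>(k, j). log_gf_term c \<tau> (j, k)) has_sum log_gf c \<tau>) (UNIV \<times> UNIV)"
    by (subst (asm) has_sum_swap) simp
  then have "((\<lambda>k. - of_real (c (Suc k)) * Ln (1 - exp (- \<tau>) ^ Suc k)) has_sum log_gf c \<tau>) UNIV"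
  proof (rule has_sum_SigmaD)
    fix k :: nat
    define z where "z = exp (- \<tau>) ^ Suc k"
    have z: "norm z < 1"
      unfolding z_def norm_power using tau by (intro le_less_trans[OF power_Suc_le_self]) auto
    have tm: "log_gf_term c \<tau> (j, k) = - of_real (c (Suc k)) * (- (z ^ Suc j) / of_nat (Suc j))" for j
    proof -
      have "exp (- (\<tau> * of_real (real (Suc j) * real (Suc k)))) = z ^ Suc j"
        unfolding z_def power_mult[symmetric] exp_of_nat_mult[symmetric]
        by (rule arg_cong[where f = exp]) (simp add: algebra_simps)
      then show ?thesis by (simp add: log_gf_term_def del: of_nat_Suc power_Suc)
    qed
    have "(\<lambda>n. - ((- (- z)) ^ n) / of_nat n) sums ln (1 + (- z))"
      using z by (intro Ln_series') simp
    then have "(\<lambda>n. - (z ^ Suc n) / of_nat (Suc n)) sums Ln (1 - z)"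
      by (subst sums_Suc_iff) simp
    then have s: "(\<lambda>j. log_gf_term c \<tau> (j, k)) sums (- of_real (c (Suc k)) * Ln (1 - z))"
      unfolding tm by (rule sums_mult)
    have "summable (\<lambda>j. norm (log_gf_term c \<tau> (j, k)))"
    proof (rule summable_comparison_test')
      show "summable (\<lambda>j. c (Suc k) * norm z ^ Suc j)"
        using z by (intro summable_mult summable_Suc_iff[THEN iffD2] summable_geometric) auto
      fix j :: nat
      have c0: "c (Suc k) \<ge> 0" using c by (simp add: subweight_def)
      have "norm (log_gf_term c \<tau> (j, k)) = c (Suc k) * (norm z ^ Suc j / real (Suc j))"
        unfolding tm using c0 by (simp add: norm_mult norm_divide norm_power del: of_nat_Suc power_Suc)
      also have "\<dots> \<le> c (Suc k) * (norm z ^ Suc j / 1)"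
        using c0 by (intro mult_left_mono divide_left_mono) auto
      finally show "norm (norm (log_gf_term c \<tau> (j, k))) \<le> c (Suc k) * norm z ^ Suc j" by simp
    qed
    from norm_summable_imp_has_sum[OF this s]
    show "((\<lambda>j. case (k, j) of (k, j) \<Rightarrow> log_gf_term c \<tau> (j, k)) has_sum - of_real (c (Suc k)) * Ln (1 - exp (- \<tau>) ^ Suc k)) UNIV"
      by (simp add: z_def)
  qed
  then show ?thesis by (rule has_sum_imp_sums)
qed

lemma weighted_gf_eq_exp_log_gf:
  assumes c: "subweight c" and tau: "Re \<tau> > 0"
  shows "weighted_gf c (exp (- \<tau>)) = exp (log_gf c \<tau>)"
proof -
  have "norm (exp (- \<tau>)) < 1" using tau by simp
  from weighted_gf_exp[OF c this] log_gf_sums[OF assms] show ?thesis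
    using sums_unique2 by blast
qed

lemma log_gf_real_sums:
  assumes c: "subweight c" and "\<alpha> > 0"
  shows "(\<lambda>k. c (Suc k) * (- ln (1 - exp (- (\<alpha> * real (Suc k)))))) sums Re (log_gf c (of_real \<alpha>))"
    and "Im (log_gf c (of_real \<alpha>)) = 0"
proof -
  have "(\<lambda>k. - of_real (c (Suc k)) * Ln (1 - exp (- complex_of_real \<alpha>) ^ Suc k)) sums log_gf c (of_real \<alpha>)"
    using assms by (intro log_gf_sums) auto
  also have "(\<lambda>k. - of_real (c (Suc k)) * Ln (1 - exp (- complex_of_real \<alpha>) ^ Suc k)) =
     (\<lambda>k. complex_of_real (c (Suc k) * (- ln (1 - exp (- (\<alpha> * real (Suc k)))))))"
  proof
    fix k
    have "exp (- complex_of_real \<alpha>) ^ Suc k = of_real (exp (- (\<alpha> * real (Suc k))))"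
      unfolding exp_of_nat_mult[symmetric] exp_of_real[symmetric]
      by (rule arg_cong[where f = exp]) (simp add: algebra_simps)
    then have "1 - exp (- complex_of_real \<alpha>) ^ Suc k = of_real (1 - exp (- (\<alpha> * real (Suc k))))" by simp
    moreover have "1 - exp (- (\<alpha> * real (Suc k))) > 0" using assms by simp
    ultimately have "Ln (1 - exp (- complex_of_real \<alpha>) ^ Suc k) = of_real (ln (1 - exp (- (\<alpha> * real (Suc k)))))"
      by (simp only: Ln_of_real)
    then show "- of_real (c (Suc k)) * Ln (1 - exp (- complex_of_real \<alpha>) ^ Suc k) =
      complex_of_real (c (Suc k) * (- ln (1 - exp (- (\<alpha> * real (Suc k))))))"
      by (simp only: of_real_mult of_real_minus mult_minus_left mult_minus_right)
  qed
  finally have s: "(\<lambda>k. complex_of_real (c (Suc k) * (- ln (1 - exp (- (\<alpha> * real (Suc k))))))) sums log_gf c (of_real \<alpha>)" .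
  show "(\<lambda>k. c (Suc k) * (- ln (1 - exp (- (\<alpha> * real (Suc k)))))) sums Re (log_gf c (of_real \<alpha>))"
    using sums_Re[OF s] by (simp only: Re_complex_of_real)
  have "(\<lambda>k::nat. 0::real) sums Im (log_gf c (of_real \<alpha>))" using sums_Im[OF s] by (simp only: Im_complex_of_real)
  then show "Im (log_gf c (of_real \<alpha>)) = 0" using sums_zero sums_unique2 by blast
qed

end

lemma fps_expansion_nth_eq_coeff:
  fixes F :: "complex \<Rightarrow> complex"
  assumes "\<And>x. norm x < 1 \<Longrightarrow> (\<lambda>n. a n * x ^ n) sums F x"
  shows "fps_nth (fps_expansion F 0) n = a n"
proof -
  have "F has_fps_expansion Abs_fps a"
    unfolding has_fps_expansion_def
  proof
    have "norm (1 / 2 :: complex) \<le> conv_radius a"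
      using assms[of "1 / 2"] by (intro conv_radius_geI sums_summable) simp
    then show "fps_conv_radius (Abs_fps a) > 0"
      by (simp add: fps_conv_radius_def) (metis ereal_less(2) half_gt_zero less_le_trans zero_less_one)
    have "eventually (\<lambda>z. z \<in> ball (0::complex) 1) (nhds 0)"
      by (intro eventually_nhds_in_open) auto
    then show "\<forall>\<^sub>F z in nhds 0. eval_fps (Abs_fps a) z = F z"
      by eventually_elim (use assms in \<open>auto simp: eval_fps_def sums_iff\<close>)
  qed
  from fps_nth_fps_expansion[OF this, of n] show ?thesis
    by (simp add: fps_expansion_def)
qed

text \<open>The weights c of the overview. Only finitely many are non-zero, and the resulting finite
  product is the one that defines the law of the largest part.\<close>

definition head_weights :: "(nat \<Rightarrow> real) \<Rightarrow> nat \<Rightarrow> nat \<Rightarrow> real" where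
  "head_weights b m k = (if k \<le> m then b k else 0)"

lemma weighted_gf_head_weights:
  assumes "norm x < 1"
  shows "weighted_gf (head_weights b m) x = (\<Prod>k=1..m. (1 - x ^ k) powr (- of_real (b k)))"
proof -
  have ne: "1 - x ^ Suc k \<noteq> 0" for k
  proof
    assume "1 - x ^ Suc k = 0"
    then have "x ^ Suc k = 1" by simp
    then have "norm x ^ Suc k = 1" by (metis norm_one norm_power)
    moreover have "norm x ^ Suc k < 1" using assms by (intro le_less_trans[OF power_Suc_le_self]) auto
    ultimately show False by simp
  qed
  have "weighted_gf (head_weights b m) x = (\<Prod>k<m. (1 - x ^ Suc k) powr (- of_real (head_weights b m (Suc k))))"
    unfolding weighted_gf_def using ne by (intro prodinf_finite) (auto simp: head_weights_def powr_def)
  also have "\<dots> = (\<Prod>k<m. (1 - x ^ Suc k) powr (- of_real (b (Suc k))))"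
    by (intro prod.cong) (auto simp: head_weights_def)
  also have "\<dots> = (\<Prod>k=1..m. (1 - x ^ k) powr (- of_real (b k)))"
    by (rule prod.reindex_bij_witness[of _ "\<lambda>k. k - 1" Suc]) auto
  finally show ?thesis .
qed

text \<open>The defining identity says that the left sides are the power series coefficients of
  \<open>weighted_gf (head_weights b m)\<close>, and coefficients are unique.\<close>

lemma largest_part_prob:
  assumes "largest_part_model b M X" "m \<ge> 1" "n \<ge> 1"
  shows "weighted_partitions b n * \<P>(\<omega> in M n. X n \<omega> \<le> m) = weighted_partitions (head_weights b m) n"
proof -
  define a where "a n = (if n = 0 then 1 else complex_of_real (weighted_partitions b n * \<P>(\<omega> in M n. X n \<omega> \<le> m)))" for n
  have "(\<lambda>n. a n * x ^ n) sums weighted_gf (head_weights b m) x" if "norm x < 1" for x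
  proof -
    have "(\<lambda>n. if n = 0 then 1 else of_real (weighted_partitions b n * \<P>(\<omega> in M n. X n \<omega> \<le> m)) * x ^ n)
          sums (\<Prod>k=1..m. (1 - x ^ k) powr (- of_real (b k)))"
      using assms(1,2) that unfolding largest_part_model_def by blast
    also have "(\<lambda>n. if n = 0 then 1 else of_real (weighted_partitions b n * \<P>(\<omega> in M n. X n \<omega> \<le> m)) * x ^ n) = (\<lambda>n. a n * x ^ n)"
      by (auto simp: a_def fun_eq_iff)
    finally show ?thesis using weighted_gf_head_weights[OF that] by simp
  qed
  from fps_expansion_nth_eq_coeff[of a, OF this, of n] show ?thesis
    using assms(3) unfolding weighted_partitions_def[of "head_weights b m"] by (simp add: a_def)
qed

text \<open>Translates the sector in (M3) into |\<theta>| > \<alpha>, the complement of the central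
  arc.\<close>

lemma abs_Arg_gt_pi_quarter:
  assumes "0 < a" "a < \<bar>y\<bar>"
  shows "\<bar>Arg (Complex a y)\<bar> > pi / 4"
proof -
  have "Complex a y \<noteq> 0" using assms by (simp add: complex_eq_iff)
  then have "Arg (Complex a y) = arctan (y / a)"
    using assms by (simp add: Arg_eq_Im_Ln Im_Ln_eq)
  moreover have "\<bar>arctan (y / a)\<bar> = arctan \<bar>y / a\<bar>"
    by (cases "y / a \<ge> 0") (auto simp: arctan_minus abs_if)
  moreover have "arctan 1 < arctan \<bar>y / a\<bar>"
    unfolding arctan_less_iff using assms by (simp add: less_divide_eq)
  ultimately show ?thesis by (simp add: arctan_one)
qed

section \<open>Coefficients as integrals, and the size of the discarded part\<close>

context power_weights
begin

text \<open>Cauchy's formula on the circle of radius \<open>exp (- \<alpha>)\<close>, with the value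
  at the real point taken out and the angle rescaled by e. The real part on the right matches the
  one in \<open>weighted_partitions\<close>.\<close>

lemma weighted_partitions_integral:
  assumes c: "subweight c" and "\<alpha> > 0" "e > 0"
  shows "weighted_partitions c n * exp (- (real n * \<alpha>)) = exp (Re (log_gf c (of_real \<alpha>))) * (e / (2 * pi)) *
     Re (\<integral>v. indicator {- pi / e..pi / e} v *\<^sub>R char_ratio c \<alpha> n (v * e) \<partial>lborel)"
proof -
  define r where "r = exp (- \<alpha>)"
  define a where "a = fps_nth (fps_expansion (weighted_gf c) 0) n"
  have r: "0 < r" "r < 1" using assms by (auto simp: r_def)
  have Leq: "exp (log_gf c (of_real \<alpha>)) = of_real (exp (Re (log_gf c (of_real \<alpha>))))"
    using log_gf_real_sums(2)[OF c assms(2)] by (simp add: exp_eq_polar)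
  have Heq: "weighted_gf c (of_real r * exp (- (\<i> * of_real \<theta>))) * exp (\<i> * of_real (real n * \<theta>)) = exp (log_gf c (of_real \<alpha>)) * char_ratio c \<alpha> n \<theta>" for \<theta>
  proof -
    have "of_real r * exp (- (\<i> * of_real \<theta>)) = exp (- Complex \<alpha> \<theta>)"
      unfolding r_def exp_of_real[symmetric] exp_add[symmetric] by (rule arg_cong[where f = exp]) (simp add: complex_eq_iff)
    then have "weighted_gf c (of_real r * exp (- (\<i> * of_real \<theta>))) = exp (log_gf c (Complex \<alpha> \<theta>))"
      using weighted_gf_eq_exp_log_gf[OF c, of "Complex \<alpha> \<theta>"] assms by simp
    then show ?thesis unfolding char_ratio_def by (simp add: exp_add[symmetric])
  qed
  define I where "I = integral {-pi..pi} (char_ratio c \<alpha> n)"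
  have cont: "continuous_on {-pi..pi} (char_ratio c \<alpha> n)"
    using char_ratio_continuous[OF c assms(2)] by (rule continuous_on_subset) simp
  have "((\<lambda>\<theta>. exp (log_gf c (of_real \<alpha>)) * char_ratio c \<alpha> n \<theta>) has_integral (exp (log_gf c (of_real \<alpha>)) * I)) {-pi..pi}"
    unfolding I_def by (intro has_integral_mult_right integrable_integral integrable_continuous_real cont)
  moreover have "((\<lambda>\<theta>. exp (log_gf c (of_real \<alpha>)) * char_ratio c \<alpha> n \<theta>) has_integral (2 * pi * (a * of_real (r ^ n)))) {-pi..pi}"
    using fps_expansion_nth_circle[OF weighted_gf_holomorphic[OF c] r, of n] unfolding Heq a_def .
  ultimately have eq1: "exp (log_gf c (of_real \<alpha>)) * I = 2 * pi * (a * of_real (r ^ n))" by (rule has_integral_unique)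
  define J where "J = (\<integral>v. indicator {- pi / e..pi / e} v *\<^sub>R char_ratio c \<alpha> n (v * e) \<partial>lborel)"
  have "I = (\<integral>\<theta>. indicator {-pi..pi} \<theta> *\<^sub>R char_ratio c \<alpha> n \<theta> \<partial>lborel)"
    using set_borel_integral_eq_integral(2)[OF borel_integrable_atLeastAtMost'[OF cont]]
    by (simp add: I_def set_lebesgue_integral_def)
  also have "\<dots> = e *\<^sub>R (\<integral>v. indicator {-pi..pi} (0 + e * v) *\<^sub>R char_ratio c \<alpha> n (0 + e * v) \<partial>lborel)"
    using assms by (subst lborel_integral_real_affine[where c = e and t = 0]) auto
  also have "(\<lambda>v. indicator {-pi..pi} (0 + e * v) *\<^sub>R char_ratio c \<alpha> n (0 + e * v)) = (\<lambda>v. indicator {- pi / e..pi / e} v *\<^sub>R char_ratio c \<alpha> n (v * e))"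
    using assms by (auto simp: fun_eq_iff indicator_def field_simps)
  finally have IJ: "I = e *\<^sub>R J" unfolding J_def .
  have "2 * pi * (a * of_real (r ^ n)) = of_real (exp (Re (log_gf c (of_real \<alpha>))) * e) * J"
    using eq1[symmetric] unfolding IJ Leq scaleR_conv_of_real of_real_mult mult.assoc .
  then have "Re (of_real (2 * pi * r ^ n) * a) = Re (of_real (exp (Re (log_gf c (of_real \<alpha>))) * e) * J)"
    by (simp add: mult_ac)
  then have "2 * pi * r ^ n * Re a = exp (Re (log_gf c (of_real \<alpha>))) * e * Re J"
    unfolding Re_complex_of_real Re_divide_of_real by (simp only: times_complex.simps complex_of_real_def) simp
  moreover have "r ^ n = exp (- (real n * \<alpha>))" unfolding r_def by (simp add: exp_of_nat_mult[symmetric])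
  ultimately show ?thesis
    unfolding weighted_partitions_def a_def[symmetric] J_def[symmetric] by (simp add: field_simps)
qed

lemma weight_series_diff:
  assumes "\<alpha> > 0"
  shows "Re (weight_series b (exp (- Complex \<alpha> \<theta>))) - Re (weight_series b (exp (- of_real \<alpha>))) = - cos_defect b \<alpha> \<theta>"
proof -
  have s: "(\<lambda>k. b (Suc k) * exp (- (\<alpha> * real (Suc k))) * cos (t * real (Suc k))) sums Re (weight_series b (exp (- Complex \<alpha> t)))" for t
  proof -
    have e: "exp (- Complex \<alpha> t) ^ Suc k = exp (Complex (- (\<alpha> * real (Suc k))) (- (t * real (Suc k))))" for k
      unfolding exp_of_nat_mult[symmetric] by (rule arg_cong[where f = exp]) (simp add: complex_eq_iff algebra_simps)
    have "summable (\<lambda>k. of_real (b (Suc k)) * exp (- Complex \<alpha> t) ^ Suc k)"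
    proof (rule summable_norm_cancel, rule summable_comparison_test')
      show "summable (\<lambda>k. b (Suc k) * exp (- (\<alpha> * real (Suc k))))" by (rule weight_exp_summable[OF assms])
      show "norm (norm (of_real (b (Suc k)) * exp (- Complex \<alpha> t) ^ Suc k)) \<le> b (Suc k) * exp (- (\<alpha> * real (Suc k)))" for k
        unfolding e using weight_nonneg[of "Suc k"] by (simp add: norm_mult del: of_nat_Suc)
    qed
    then have "(\<lambda>k. of_real (b (Suc k)) * exp (- Complex \<alpha> t) ^ Suc k) sums weight_series b (exp (- Complex \<alpha> t))"
      unfolding weight_series_def by (rule summable_sums)
    from sums_Re[OF this] show ?thesis unfolding e by (simp add: Re_exp mult_ac del: of_nat_Suc)
  qed
  have "(\<lambda>k. b (Suc k) * exp (- (\<alpha> * real (Suc k))) * (1 - cos (\<theta> * real (Suc k)))) sums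
     (Re (weight_series b (exp (- Complex \<alpha> 0))) - Re (weight_series b (exp (- Complex \<alpha> \<theta>))))"
    using sums_diff[OF s[of 0] s[of \<theta>]] by (simp add: right_diff_distrib del: of_nat_Suc)
  moreover have "Complex \<alpha> 0 = of_real \<alpha>" by (simp add: complex_eq_iff)
  ultimately show ?thesis unfolding cos_defect_def by (simp add: sums_iff)
qed

lemma meinardus_M3_cos_defect:
  assumes "meinardus_M3 b"
  shows "\<exists>\<epsilon>>0. \<exists>C2>0. \<forall>\<^sub>F \<alpha> in at_right 0. \<forall>\<theta>. \<alpha> < \<bar>\<theta>\<bar> \<longrightarrow> \<bar>\<theta>\<bar> \<le> pi \<longrightarrow> cos_defect b \<alpha> \<theta> \<ge> C2 * \<alpha> powr (- \<epsilon>)"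
proof -
  obtain \<epsilon> C2 where eps: "\<epsilon> > 0" "C2 > 0" and ev: "\<forall>\<^sub>F \<alpha> in at_right 0. \<forall>u::real.
        (let \<tau> = Complex \<alpha> (2 * pi * u) in
          \<bar>Arg \<tau>\<bar> > pi / 4 \<and> u \<noteq> 0 \<and> \<bar>u\<bar> \<le> 1 / 2 \<longrightarrow>
          Re (weight_series b (exp (- \<tau>))) - Re (weight_series b (exp (- of_real \<alpha>)))
            \<le> - C2 * \<alpha> powr (- \<epsilon>))"
    using assms unfolding meinardus_M3_def by blast
  have "\<forall>\<^sub>F \<alpha> in at_right 0. \<forall>\<theta>. \<alpha> < \<bar>\<theta>\<bar> \<longrightarrow> \<bar>\<theta>\<bar> \<le> pi \<longrightarrow> cos_defect b \<alpha> \<theta> \<ge> C2 * \<alpha> powr (- \<epsilon>)"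
    using ev eventually_at_right_less[of 0]
  proof eventually_elim
    case (elim \<alpha>)
    show ?case
    proof (intro allI impI)
      fix \<theta> assume th: "\<alpha> < \<bar>\<theta>\<bar>" "\<bar>\<theta>\<bar> \<le> pi"
      define u where "u = \<theta> / (2 * pi)"
      have u: "2 * pi * u = \<theta>" "u \<noteq> 0" "\<bar>u\<bar> \<le> 1 / 2" using th elim by (auto simp: u_def)
      have "\<bar>Arg (Complex \<alpha> \<theta>)\<bar> > pi / 4" using th elim by (intro abs_Arg_gt_pi_quarter) auto
      then have "Re (weight_series b (exp (- Complex \<alpha> \<theta>))) - Re (weight_series b (exp (- of_real \<alpha>))) \<le> - C2 * \<alpha> powr (- \<epsilon>)"
        using elim(1)[rule_format, of u] u unfolding Let_def u(1) by blast
      then show "cos_defect b \<alpha> \<theta> \<ge> C2 * \<alpha> powr (- \<epsilon>)" using weight_series_diff[OF elim(2), of \<theta>] by simp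
    qed
  qed
  then show ?thesis using eps by blast
qed

definition tail_weights :: "nat \<Rightarrow> nat \<Rightarrow> real" where
  "tail_weights m k = (if k \<le> m then 0 else b k)"

lemma head_tail: "b k - head_weights b m k = tail_weights m k"
  by (simp add: head_weights_def tail_weights_def)

lemma subweight_head: "subweight (head_weights b m)"
  using weight_nonneg by (auto simp: subweight_def head_weights_def)

lemma subweight_tail: "subweight (tail_weights m)"
  using weight_nonneg by (auto simp: subweight_def tail_weights_def)

lemma laplace_tail: "laplace_sum (tail_weights m) 0 \<alpha> = tail_sum m \<alpha>"
  by (simp add: laplace_sum_def tail_sum_def tail_weights_def)

text \<open>Rankin's trick: for the surviving terms z = j k is at least m, so the share
  \<open>exp (- (1 - \<mu>) \<alpha> z)\<close> of the exponential is at most its value at m, and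
  the rest is a moment of b at the smaller argument \<mu> \<alpha>.\<close>

lemma tail_moment_le:
  assumes "q \<ge> 1" "\<alpha> > 0" "0 < \<mu>" "\<mu> < 1"
  shows "moment (tail_weights m) q \<alpha> \<le> exp (- ((1 - \<mu>) * (\<alpha> * real m))) * moment b q (\<mu> * \<alpha>)"
proof -
  have "moment (tail_weights m) q \<alpha> \<le> infsum (\<lambda>p. exp (- ((1 - \<mu>) * (\<alpha> * real m))) * moment_term b q (\<mu> * \<alpha>) p) UNIV"
    unfolding moment_def
  proof (rule infsum_mono)
    show "moment_term (tail_weights m) q \<alpha> summable_on UNIV"
      using assms by (intro subweight_moment_summable subweight_tail)
    show "(\<lambda>p. exp (- ((1 - \<mu>) * (\<alpha> * real m))) * moment_term b q (\<mu> * \<alpha>) p) summable_on UNIV"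
      using assms by (intro summable_on_cmult_right moment_term_summable) auto
    fix p :: "nat \<times> nat"
    obtain j k where p: "p = (j, k)" by (cases p)
    show "moment_term (tail_weights m) q \<alpha> p \<le> exp (- ((1 - \<mu>) * (\<alpha> * real m))) * moment_term b q (\<mu> * \<alpha>) p"
    proof (cases "Suc k \<le> m")
      case True
      have "0 \<le> moment_term b q (\<mu> * \<alpha>) p"
        by (rule moment_term_nonneg) (rule weight_nonneg)
      moreover have "moment_term (tail_weights m) q \<alpha> p = 0"
        using True by (simp add: p moment_term_def tail_weights_def)
      ultimately show ?thesis by simp
    next
      case False
      define z where "z = real (Suc j) * real (Suc k)"
      have "1 * real m \<le> z" unfolding z_def using False by (intro mult_mono) auto
      then have "(1 - \<mu>) * \<alpha> * real m \<le> (1 - \<mu>) * \<alpha> * z" using assms by (intro mult_left_mono) auto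
      then have "exp (- (\<alpha> * z)) \<le> exp (- ((1 - \<mu>) * (\<alpha> * real m))) * exp (- (\<mu> * \<alpha> * z))"
        unfolding exp_add[symmetric] by (simp add: algebra_simps)
      then have "b (Suc k) * real (Suc k) ^ q * real (Suc j) ^ (q - 1) * exp (- (\<alpha> * z)) \<le>
         b (Suc k) * real (Suc k) ^ q * real (Suc j) ^ (q - 1) * (exp (- ((1 - \<mu>) * (\<alpha> * real m))) * exp (- (\<mu> * \<alpha> * z)))"
        using weight_nonneg[of "Suc k"] by (intro mult_left_mono) auto
      then show ?thesis using False by (simp add: p moment_term_def tail_weights_def z_def mult_ac del: of_nat_Suc)
    qed
  qed
  also have "\<dots> = exp (- ((1 - \<mu>) * (\<alpha> * real m))) * moment b q (\<mu> * \<alpha>)"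
    unfolding moment_def using moment_term_summable[of q "\<mu> * \<alpha>"] assms by (intro infsum_cmult_right) auto
  finally show ?thesis .
qed

text \<open>By y \<le> - ln (1 - y) \<le> y / (1 - y) with y at most
  \<open>exp (- \<alpha> m)\<close>, the higher powers in the logarithms change the tail only by a
  factor tending to 1 as \<alpha> m grows.\<close>

lemma log_gf_head_diff:
  assumes "\<alpha> > 0" and q: "exp (- (\<alpha> * real m)) \<le> 1 / 2"
  shows "tail_sum m \<alpha> \<le> Re (log_gf b (of_real \<alpha>)) - Re (log_gf (head_weights b m) (of_real \<alpha>))"
    and "Re (log_gf b (of_real \<alpha>)) - Re (log_gf (head_weights b m) (of_real \<alpha>)) \<le> (1 + 2 * exp (- (\<alpha> * real m))) * tail_sum m \<alpha>"
proof -
  have s: "(\<lambda>k. tail_weights m (Suc k) * (- ln (1 - exp (- (\<alpha> * real (Suc k)))))) sums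
      (Re (log_gf b (of_real \<alpha>)) - Re (log_gf (head_weights b m) (of_real \<alpha>)))"
    using sums_diff[OF log_gf_real_sums(1)[OF subweight_self assms(1)] log_gf_real_sums(1)[OF subweight_head assms(1), of m]]
    unfolding left_diff_distrib[symmetric] head_tail .
  have "summable (\<lambda>k. tail_weights m (Suc k) * exp (- (\<alpha> * real (Suc k))))"
    by (rule summable_comparison_test'[OF weight_exp_summable[OF assms(1)], of 0])
       (use weight_nonneg in \<open>auto simp: tail_weights_def\<close>)
  then have t: "(\<lambda>k. tail_weights m (Suc k) * exp (- (\<alpha> * real (Suc k)))) sums tail_sum m \<alpha>"
    unfolding laplace_tail[symmetric] laplace_sum_def by (simp add: summable_sums)
  have bnd: "exp (- (\<alpha> * real (Suc k))) \<le> - ln (1 - exp (- (\<alpha> * real (Suc k)))) \<and>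
     - ln (1 - exp (- (\<alpha> * real (Suc k)))) \<le> (1 + 2 * exp (- (\<alpha> * real m))) * exp (- (\<alpha> * real (Suc k)))" if "\<not> Suc k \<le> m" for k
  proof -
    define y where "y = exp (- (\<alpha> * real (Suc k)))"
    define Q where "Q = exp (- (\<alpha> * real m))"
    have "\<alpha> * real m \<le> \<alpha> * real (Suc k)" using that assms by (intro mult_left_mono) auto
    then have y: "0 < y" "y \<le> Q" "Q \<le> 1 / 2" using q by (auto simp: y_def Q_def)
    have "ln (1 - y) \<le> - y" using y ln_le_minus_one[of "1 - y"] by simp
    moreover have "- ln (1 - y) \<le> (1 + 2 * Q) * y"
    proof -
      have "- ln (1 - y) = ln (1 / (1 - y))" using y by (simp add: ln_div)
      also have "\<dots> \<le> 1 / (1 - y) - 1" using y by (intro ln_le_minus_one) auto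
      also have "\<dots> = y / (1 - y)" using y by (simp add: field_simps)
      also have "\<dots> \<le> y * (1 + 2 * Q)"
      proof -
        have "1 \<le> (1 + 2 * y) * (1 - y)" using y mult_left_mono[of y "1 / 2" y] by (simp add: algebra_simps)
        also have "\<dots> \<le> (1 + 2 * Q) * (1 - y)" using y by (intro mult_right_mono) auto
        finally have "y * 1 \<le> y * ((1 + 2 * Q) * (1 - y))" using y by (intro mult_left_mono) auto
        then show ?thesis using y by (simp add: divide_le_eq mult_ac)
      qed
      finally show ?thesis by (simp add: mult.commute)
    qed
    ultimately show ?thesis unfolding y_def Q_def by simp
  qed
  show "tail_sum m \<alpha> \<le> Re (log_gf b (of_real \<alpha>)) - Re (log_gf (head_weights b m) (of_real \<alpha>))"
  proof (rule sums_le[OF _ t s])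
    show "tail_weights m (Suc k) * exp (- (\<alpha> * real (Suc k))) \<le> tail_weights m (Suc k) * (- ln (1 - exp (- (\<alpha> * real (Suc k)))))" for k
    proof (cases "Suc k \<le> m")
      case False
      then have "b (Suc k) * exp (- (\<alpha> * real (Suc k))) \<le> b (Suc k) * (- ln (1 - exp (- (\<alpha> * real (Suc k)))))"
        using bnd[OF False] weight_nonneg[of "Suc k"] by (intro mult_left_mono) auto
      then show ?thesis using False by (simp only: tail_weights_def if_False)
    qed (simp add: tail_weights_def)
  qed
  show "Re (log_gf b (of_real \<alpha>)) - Re (log_gf (head_weights b m) (of_real \<alpha>)) \<le> (1 + 2 * exp (- (\<alpha> * real m))) * tail_sum m \<alpha>"
  proof (rule sums_le[OF _ s sums_mult[OF t]])
    show "tail_weights m (Suc k) * (- ln (1 - exp (- (\<alpha> * real (Suc k))))) \<le> (1 + 2 * exp (- (\<alpha> * real m))) * (tail_weights m (Suc k) * exp (- (\<alpha> * real (Suc k))))" for k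
    proof (cases "Suc k \<le> m")
      case False
      then have "b (Suc k) * (- ln (1 - exp (- (\<alpha> * real (Suc k))))) \<le> b (Suc k) * ((1 + 2 * exp (- (\<alpha> * real m))) * exp (- (\<alpha> * real (Suc k))))"
        using bnd[OF False] weight_nonneg[of "Suc k"] by (intro mult_left_mono) auto
      then show ?thesis using False by (simp add: tail_weights_def mult_ac)
    qed (simp add: tail_weights_def)
  qed
qed

end

section \<open>The limit law\<close>

text \<open>
  With \<open>a = a(n)\<close> and the appropriate constant \<open>c\<close>, the event of the theorem reads \<open>a X\<^sub>n \<le> Y a\<close>.
\<close>

lemma cutoff_asymptotics:
  fixes \<rho> \<delta> t c :: real
  assumes "\<rho> > 0" "\<delta> > 0"
  defines "Y \<equiv> \<lambda>a. t - \<rho> * ln a + (\<rho> - 1) * ln \<bar>ln a\<bar> + c"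
  shows "filterlim Y at_top (at_right 0)"
    and "((\<lambda>a. a powr \<delta> * (Y a + 1)) \<longlongrightarrow> 0) (at_right 0)"
    and "((\<lambda>a. ln (Y a) - ln \<bar>ln a\<bar>) \<longlongrightarrow> ln \<rho>) (at_right 0)"
    and "filterlim (\<lambda>a. 3 / 4 * Y a + \<rho> / 2 * ln a) at_top (at_right 0)"
proof -
  have small: "\<forall>\<^sub>F a::real in at_right 0. 0 < a \<and> a < 1"
    using eventually_at_right_less[of 0] eventually_at_right_real[of 0 1] by (auto elim: eventually_mono)
  have L: "filterlim (\<lambda>a::real. - ln a) at_top (at_right 0)" by real_asymp
  have l1: "((\<lambda>a::real. ln (- ln a) / (- ln a)) \<longlongrightarrow> 0) (at_right 0)"
    and l2: "((\<lambda>a::real. 1 / (- ln a)) \<longlongrightarrow> 0) (at_right 0)" by real_asymp+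
  \<comment> \<open>\<open>Y a / (- ln a)\<close> written as a combination of limits free of
    parameters, since t + c and \<rho> - 1 may have either sign.\<close>
  have "((\<lambda>a. (t + c) * (1 / (- ln a)) + \<rho> + (\<rho> - 1) * (ln (- ln a) / (- ln a))) \<longlongrightarrow> (t + c) * 0 + \<rho> + (\<rho> - 1) * 0) (at_right 0)"
    by (intro tendsto_add tendsto_mult_left tendsto_const l1 l2)
  moreover have "\<forall>\<^sub>F a in at_right 0. (t + c) * (1 / (- ln a)) + \<rho> + (\<rho> - 1) * (ln (- ln a) / (- ln a)) = Y a / (- ln a)"
    using small
  proof eventually_elim
    case (elim a)
    then have "ln a < 0" by simp
    then show ?case by (simp add: Y_def field_simps)
  qed
  ultimately have YL: "((\<lambda>a. Y a / (- ln a)) \<longlongrightarrow> \<rho>) (at_right 0)"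
    by (simp add: Lim_transform_eventually)
  have Y_eq: "\<forall>\<^sub>F a in at_right 0. Y a / (- ln a) * (- ln a) = Y a"
    using small by eventually_elim (auto simp: ln_less_zero less_imp_neq)
  show Y_top: "filterlim Y at_top (at_right 0)"
    using filterlim_tendsto_pos_mult_at_top[OF YL assms(1) L]
    by (rule filterlim_mono_eventually[OF _ order_refl order_refl]) (use Y_eq in auto)
  have "((\<lambda>a. Y a / (- ln a) * (a powr \<delta> * (- ln a)) + a powr \<delta>) \<longlongrightarrow> \<rho> * 0 + 0) (at_right 0)"
  proof (intro tendsto_add tendsto_mult YL)
    show "((\<lambda>a. a powr \<delta> * (- ln a)) \<longlongrightarrow> 0) (at_right 0)" using assms(2) by real_asymp
    show "((\<lambda>a. a powr \<delta>) \<longlongrightarrow> 0) (at_right 0)" using assms(2) by real_asymp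
  qed
  moreover have "\<forall>\<^sub>F a in at_right 0. Y a / (- ln a) * (a powr \<delta> * (- ln a)) + a powr \<delta> = a powr \<delta> * (Y a + 1)"
    using small by eventually_elim (auto simp: ln_less_zero less_imp_neq algebra_simps)
  ultimately show "((\<lambda>a. a powr \<delta> * (Y a + 1)) \<longlongrightarrow> 0) (at_right 0)"
    by (simp add: Lim_transform_eventually)
  have "((\<lambda>a. ln (Y a / (- ln a))) \<longlongrightarrow> ln \<rho>) (at_right 0)"
    using YL assms(1) by (intro tendsto_ln) auto
  moreover have "\<forall>\<^sub>F a in at_right 0. Y a > 0" using Y_top by (simp add: filterlim_at_top_dense)
  then have "\<forall>\<^sub>F a in at_right 0. ln (Y a / (- ln a)) = ln (Y a) - ln \<bar>ln a\<bar>"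
    using small
  proof eventually_elim
    case (elim a)
    then have "ln a < 0" by simp
    then have "\<bar>ln a\<bar> = - ln a" "0 < - ln a" by simp_all
    then show ?case using ln_divide_pos[of "Y a" "- ln a"] elim(1) by (simp only:)
  qed
  ultimately show "((\<lambda>a. ln (Y a) - ln \<bar>ln a\<bar>) \<longlongrightarrow> ln \<rho>) (at_right 0)"
    by (rule Lim_transform_eventually)
  \<comment> \<open>The limit is \<rho> / 4. The weight 3/4 is the share \<open>1 - \<mu>\<close> of
    \<open>tail_moment_le\<close> with \<mu> = 1/4; it has to exceed 1/2 for this bound to make the
    discarded mean small against the standard deviation.\<close>
  have "((\<lambda>a. 3 / 4 * (Y a / (- ln a)) - \<rho> / 2) \<longlongrightarrow> 3 / 4 * \<rho> - \<rho> / 2) (at_right 0)"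
    by (intro tendsto_intros YL)
  moreover have "3 / 4 * \<rho> - \<rho> / 2 > 0" using assms(1) by simp
  ultimately have "filterlim (\<lambda>a. (3 / 4 * (Y a / (- ln a)) - \<rho> / 2) * (- ln a)) at_top (at_right 0)"
    using L by (rule filterlim_tendsto_pos_mult_at_top)
  moreover have "\<forall>\<^sub>F a in at_right 0. (3 / 4 * (Y a / (- ln a)) - \<rho> / 2) * (- ln a) = 3 / 4 * Y a + \<rho> / 2 * ln a"
    using Y_eq
  proof eventually_elim
    case (elim a)
    have "(3 / 4 * (Y a / (- ln a)) - \<rho> / 2) * (- ln a) = 3 / 4 * (Y a / (- ln a) * (- ln a)) + \<rho> / 2 * ln a"
      by (simp add: algebra_simps)
    then show ?case unfolding elim .
  qed
  ultimately show "filterlim (\<lambda>a. 3 / 4 * Y a + \<rho> / 2 * ln a) at_top (at_right 0)"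
    by (rule filterlim_mono_eventually[OF _ order_refl order_refl])
qed

text \<open>The value of this integral cancels in the quotient of the two coefficients; its
  positivity keeps the denominator away from 0.\<close>

lemma gaussian_integral_pos:
  assumes "s > (0::real)"
  shows "Re (\<integral>v. exp (of_real (- (s / 2 * v\<^sup>2))) \<partial>lborel) > 0"
proof -
  define \<sigma> where "\<sigma> = 1 / sqrt s"
  have sig: "\<sigma> > 0" "\<sigma>\<^sup>2 = 1 / s" using assms by (auto simp: \<sigma>_def power_divide)
  have eq: "exp (complex_of_real (- (s / 2 * v\<^sup>2))) = of_real (sqrt (2 * pi * \<sigma>\<^sup>2) * normal_density 0 \<sigma> v)" for v
  proof -
    have "exp (- (s / 2 * v\<^sup>2)) = sqrt (2 * pi * \<sigma>\<^sup>2) * normal_density 0 \<sigma> v"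
      using sig assms by (simp add: normal_density_def)
    then show ?thesis by (simp only: exp_of_real)
  qed
  have "(\<integral>v. exp (complex_of_real (- (s / 2 * v\<^sup>2))) \<partial>lborel) = of_real (\<integral>v. sqrt (2 * pi * \<sigma>\<^sup>2) * normal_density 0 \<sigma> v \<partial>lborel)"
    unfolding eq by (rule integral_complex_of_real)
  also have "(\<integral>v. sqrt (2 * pi * \<sigma>\<^sup>2) * normal_density 0 \<sigma> v \<partial>lborel) = sqrt (2 * pi * \<sigma>\<^sup>2)"
    using sig by simp
  finally show ?thesis using sig assms by simp
qed

context power_weights
begin

lemma var_const_pos: "var_const > 0"
  unfolding var_const_def using A_pos rho_pos by (intro mult_pos_pos Gamma_real_pos zeta_real_pos) auto

text \<open>The normalisation comes from the tail: T is asymptotic to A \<open>exp (- w)\<close>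
  \<alpha>^(-\<rho>) w^(\<rho> - 1) with w = \<alpha> m. Setting this equal to
  \<open>exp (- t)\<close> and solving for w, with ln w close to ln \<rho> + ln |ln a|, gives w = Y
  a; each of the terms \<rho> ln a, (\<rho> - 1) ln |ln a|, (\<rho> - 1) ln \<rho> and ln A accounts
  for one factor.\<close>

lemma largest_part_limit:
  assumes M3: "meinardus_M3 b" and model: "largest_part_model b M X"
  shows "(\<lambda>n. \<P>(\<omega> in M n.
            scaling \<rho> A n * real (X n \<omega>) + \<rho> * ln (scaling \<rho> A n)
              - (\<rho> - 1) * ln \<bar>ln (scaling \<rho> A n)\<bar> - (\<rho> - 1) * ln \<rho> - ln A \<le> t))
         \<longlonglongrightarrow> exp (- exp (- t))"
proof -
  \<comment> \<open>At n = 0 the saddle point is replaced by the value 1, so that \<alpha> n > 0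
    holds for every index.\<close>
  have "\<exists>\<alpha>. \<alpha> > 0 \<and> (n \<ge> 1 \<longrightarrow> moment b 1 \<alpha> = real n)" for n :: nat
    using saddle_point_exists[of "real n"] by (cases "n \<ge> 1") (auto intro: exI[of _ 1])
  then obtain \<alpha> :: "nat \<Rightarrow> real" where \<alpha>: "\<And>n. \<alpha> n > 0" "\<And>n. n \<ge> 1 \<Longrightarrow> moment b 1 (\<alpha> n) = real n"
    by metis
  define a where "a n = scaling \<rho> A n" for n
  define Y where "Y a = t - \<rho> * ln a + (\<rho> - 1) * ln \<bar>ln a\<bar> + ((\<rho> - 1) * ln \<rho> + ln A)" for a
  \<comment> \<open>The largest part is an integer, so the event becomes X n \<le> m n. Where Y is
    negative the truncation by \<open>nat\<close> yields the default 0; eventually Y \<ge>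
    1.\<close>
  define m where "m n = nat \<lfloor>Y (a n) / a n\<rfloor>" for n
  define w where "w n = \<alpha> n * real (m n)" for n
  define R where "R n = \<alpha> n / a n" for n
  note cut = cutoff_asymptotics[OF rho_pos delta_pos, of t "(\<rho> - 1) * ln \<rho> + ln A", folded Y_def]

  have \<alpha>_lim: "\<alpha> \<longlonglongrightarrow> 0" by (rule saddle_point_asymptotics(1)[OF \<alpha>])
  have \<alpha>_lim0: "filterlim \<alpha> (at_right 0) sequentially"
    unfolding filterlim_at using \<alpha>_lim \<alpha>(1) by (auto intro!: always_eventually simp: less_imp_neq[symmetric])
  obtain K where K: "\<And>n. n \<ge> 1 \<Longrightarrow> \<bar>R n - 1\<bar> \<le> K * \<alpha> n powr \<delta>"
    using saddle_point_asymptotics(2)[OF \<alpha>] unfolding R_def a_def by blast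
  have a_pos: "a n > 0" if "n \<ge> 1" for n
    using that mean_const_pos by (simp add: a_def scaling_def flip: mean_const_def)
  have a_lim: "a \<longlonglongrightarrow> 0"
  proof -
    have "(\<lambda>n. (mean_const / real n) powr (1 / (\<rho> + 1))) \<longlonglongrightarrow> 0"
      using mean_const_pos rho_pos by real_asymp
    then show ?thesis unfolding a_def scaling_def mean_const_def .
  qed
  have a_lim0: "filterlim a (at_right 0) sequentially"
  proof (rule tendsto_imp_filterlim_at_right[OF a_lim])
    show "\<forall>\<^sub>F n in sequentially. a n > 0"
      using eventually_ge_at_top[of 1] by eventually_elim (rule a_pos)
  qed
  note Y_top = filterlim_compose[OF cut(1) a_lim0] and Y_small = filterlim_compose[OF cut(2) a_lim0]
    and Y_ln = filterlim_compose[OF cut(3) a_lim0] and Y_top2 = filterlim_compose[OF cut(4) a_lim0]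
  have \<alpha>\<delta>: "(\<lambda>n. \<alpha> n powr \<delta>) \<longlonglongrightarrow> 0"
  proof -
    have "((\<lambda>x. x powr \<delta>) \<longlongrightarrow> 0) (at_right 0)" using delta_pos by real_asymp
    from filterlim_compose[OF this \<alpha>_lim0] show ?thesis .
  qed
  have R_lim: "R \<longlonglongrightarrow> 1"
  proof (rule LIM_zero_cancel, rule Lim_null_comparison)
    show "\<forall>\<^sub>F n in sequentially. norm (R n - 1) \<le> K * \<alpha> n powr \<delta>"
      using eventually_ge_at_top[of 1] by eventually_elim (use K in auto)
    show "(\<lambda>n. K * \<alpha> n powr \<delta>) \<longlonglongrightarrow> 0" by (rule tendsto_mult_right_zero[OF \<alpha>\<delta>])
  qed
  have \<alpha>Y: "(\<lambda>n. \<alpha> n powr \<delta> * (Y (a n) + 1)) \<longlonglongrightarrow> 0"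
  proof -
    have "(\<lambda>n. R n powr \<delta> * (a n powr \<delta> * (Y (a n) + 1))) \<longlonglongrightarrow> 1 powr \<delta> * 0"
      by (intro tendsto_mult tendsto_powr R_lim tendsto_const Y_small) auto
    moreover have "\<forall>\<^sub>F n in sequentially. R n powr \<delta> * (a n powr \<delta> * (Y (a n) + 1)) = \<alpha> n powr \<delta> * (Y (a n) + 1)"
      using eventually_ge_at_top[of 1]
    proof eventually_elim
      case (elim n)
      have "R n powr \<delta> * a n powr \<delta> = (R n * a n) powr \<delta>" by (simp add: powr_mult)
      then show ?case using a_pos[OF elim] by (simp add: R_def mult.assoc[symmetric])
    qed
    ultimately show ?thesis by (simp add: Lim_transform_eventually)
  qed
  have Y_ge1: "\<forall>\<^sub>F n in sequentially. Y (a n) \<ge> 1" using Y_top by (simp add: filterlim_at_top)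
  have a_le1: "\<forall>\<^sub>F n in sequentially. a n < 1" using a_lim by (rule order_tendstoD) simp
  \<comment> \<open>Two errors: rounding to an integer costs at most a n, and replacing a n by
    \<alpha> n costs the relative error K \<alpha>^\<delta> times a quantity of size Y, a power
    against a logarithm.\<close>
  have wY: "(\<lambda>n. w n - Y (a n)) \<longlonglongrightarrow> 0"
  proof (rule Lim_null_comparison)
    show "\<forall>\<^sub>F n in sequentially. norm (w n - Y (a n)) \<le> \<bar>K\<bar> * (\<alpha> n powr \<delta> * (Y (a n) + 1)) + a n"
      using Y_ge1 a_le1 eventually_ge_at_top[of 1]
    proof eventually_elim
      case (elim n)
      have an: "a n > 0" using a_pos elim by simp
      have "Y (a n) / a n \<ge> 0" using elim an by simp
      then have "real (m n) \<le> Y (a n) / a n" "Y (a n) / a n - 1 \<le> real (m n)"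
        unfolding m_def by linarith+
      then have f2: "a n * real (m n) \<le> Y (a n)" "Y (a n) - a n \<le> a n * real (m n)"
        using an by (simp_all add: field_simps)
      have "w n - Y (a n) = (R n - 1) * (a n * real (m n)) + (a n * real (m n) - Y (a n))"
        using an by (simp add: w_def R_def field_simps)
      then have "\<bar>w n - Y (a n)\<bar> \<le> \<bar>R n - 1\<bar> * \<bar>a n * real (m n)\<bar> + \<bar>a n * real (m n) - Y (a n)\<bar>"
        by (metis abs_mult abs_triangle_ineq)
      also have "\<dots> \<le> (\<bar>K\<bar> * \<alpha> n powr \<delta>) * (Y (a n) + 1) + a n"
      proof (intro add_mono mult_mono)
        have "K * \<alpha> n powr \<delta> \<le> \<bar>K\<bar> * \<alpha> n powr \<delta>" by (intro mult_right_mono) auto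
        then show "\<bar>R n - 1\<bar> \<le> \<bar>K\<bar> * \<alpha> n powr \<delta>" using K[OF elim(3)] by linarith
        show "\<bar>a n * real (m n)\<bar> \<le> Y (a n) + 1" using f2 an by (simp add: abs_mult)
        show "\<bar>a n * real (m n) - Y (a n)\<bar> \<le> a n" using f2 an by linarith
      qed auto
      finally show ?case by (simp add: mult.assoc)
    qed
    have "(\<lambda>n. \<bar>K\<bar> * (\<alpha> n powr \<delta> * (Y (a n) + 1)) + a n) \<longlonglongrightarrow> \<bar>K\<bar> * 0 + 0"
      by (intro tendsto_add tendsto_mult_left \<alpha>Y a_lim)
    then show "(\<lambda>n. \<bar>K\<bar> * (\<alpha> n powr \<delta> * (Y (a n) + 1)) + a n) \<longlonglongrightarrow> 0" by simp
  qed
  have w_top: "filterlim w at_top sequentially"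
    using filterlim_tendsto_add_at_top[OF wY Y_top] by simp
  have w_ge1: "\<forall>\<^sub>F n in sequentially. w n \<ge> 1" using w_top by (simp add: filterlim_at_top)
  have err: "(\<lambda>n. \<alpha> n powr \<delta> * w n) \<longlonglongrightarrow> 0"
  proof -
    have "(\<lambda>n. \<alpha> n powr \<delta> * (Y (a n) + 1) + \<alpha> n powr \<delta> * ((w n - Y (a n)) - 1)) \<longlonglongrightarrow> 0 + 0 * (0 - 1)"
      by (intro tendsto_add tendsto_mult tendsto_diff tendsto_const \<alpha>Y \<alpha>\<delta> wY)
    moreover have "\<alpha> n powr \<delta> * (Y (a n) + 1) + \<alpha> n powr \<delta> * ((w n - Y (a n)) - 1) = \<alpha> n powr \<delta> * w n" for n
      by (simp add: algebra_simps)
    ultimately show ?thesis by simp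
  qed
  have lnR: "(\<lambda>n. ln (R n)) \<longlonglongrightarrow> 0" using tendsto_ln[OF R_lim] by simp
  have exponent: "(\<lambda>n. - w n - \<rho> * ln (\<alpha> n) + (\<rho> - 1) * ln (w n)) \<longlonglongrightarrow> - t - ln A"
  proof -
    have "(\<lambda>n. 1 + (w n - Y (a n)) / Y (a n)) \<longlonglongrightarrow> 1 + 0"
      using tendsto_divide_0[OF wY filterlim_at_top_imp_at_infinity[OF Y_top]] by (intro tendsto_add tendsto_const)
    then have lnq: "(\<lambda>n. ln (1 + (w n - Y (a n)) / Y (a n))) \<longlonglongrightarrow> 0"
      using tendsto_ln[of "\<lambda>n. 1 + (w n - Y (a n)) / Y (a n)" 1 sequentially] by simp
    \<comment> \<open>The exponent split into parts with known limits: w - Y, ln (\<alpha> / a), ln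
      (w / Y) and ln Y - ln |ln a| - ln \<rho>. By the definition of Y the remaining terms reduce to
      - t - ln A.\<close>
    have "(\<lambda>n. - (w n - Y (a n)) - \<rho> * ln (R n) + (\<rho> - 1) * ln (1 + (w n - Y (a n)) / Y (a n))
        + (\<rho> - 1) * ((ln (Y (a n)) - ln \<bar>ln (a n)\<bar>) - ln \<rho>) + (- t - ln A)) \<longlonglongrightarrow> - 0 - \<rho> * 0 + (\<rho> - 1) * 0 + (\<rho> - 1) * (ln \<rho> - ln \<rho>) + (- t - ln A)"
      by (intro tendsto_add tendsto_diff tendsto_minus tendsto_mult_left tendsto_const wY lnR lnq Y_ln)
    moreover have "\<forall>\<^sub>F n in sequentially. - (w n - Y (a n)) - \<rho> * ln (R n) + (\<rho> - 1) * ln (1 + (w n - Y (a n)) / Y (a n))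
        + (\<rho> - 1) * ((ln (Y (a n)) - ln \<bar>ln (a n)\<bar>) - ln \<rho>) + (- t - ln A) = - w n - \<rho> * ln (\<alpha> n) + (\<rho> - 1) * ln (w n)"
      using Y_ge1 w_ge1 eventually_ge_at_top[of 1]
    proof eventually_elim
      case (elim n)
      have an: "a n > 0" using a_pos elim by simp
      have lR: "ln (R n) = ln (\<alpha> n) - ln (a n)" unfolding R_def using an \<alpha>(1)[of n] by (simp add: ln_div)
      have "1 + (w n - Y (a n)) / Y (a n) = w n / Y (a n)" using elim by (simp add: field_simps)
      moreover have "ln (w n / Y (a n)) = ln (w n) - ln (Y (a n))" using elim by (intro ln_divide_pos) auto
      ultimately have lq: "ln (1 + (w n - Y (a n)) / Y (a n)) = ln (w n) - ln (Y (a n))" by simp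
      have alg: "- (W - y) - \<rho> * (x - la) + (\<rho> - 1) * (lw - ly) + (\<rho> - 1) * ((ly - l) - ln \<rho>) + (- t - ln A) = - W - \<rho> * x + (\<rho> - 1) * lw"
        if "y = t - \<rho> * la + (\<rho> - 1) * l + ((\<rho> - 1) * ln \<rho> + ln A)" for W y x la lw ly l
        unfolding that by (simp add: algebra_simps)
      show ?case unfolding lq lR by (rule alg) (simp add: Y_def)
    qed
    ultimately show ?thesis by (simp add: Lim_transform_eventually)
  qed
  have tail: "(\<lambda>n. tail_sum (m n) (\<alpha> n)) \<longlonglongrightarrow> exp (- t)"
  proof -
    have "(\<lambda>n. tail_sum (m n) (\<alpha> n) * exp (w n) * \<alpha> n powr \<rho> / w n powr (\<rho> - 1)) \<longlonglongrightarrow> A"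
      using tail_sum_asymptotic[where \<alpha> = \<alpha> and m = m, OF \<alpha>(1)] w_top err unfolding w_def by blast
    from tendsto_mult[OF this tendsto_exp[OF exponent]]
    have "(\<lambda>n. tail_sum (m n) (\<alpha> n) * exp (w n) * \<alpha> n powr \<rho> / w n powr (\<rho> - 1) * exp (- w n - \<rho> * ln (\<alpha> n) + (\<rho> - 1) * ln (w n))) \<longlonglongrightarrow> A * exp (- t - ln A)" .
    moreover have "A * exp (- t - ln A) = exp (- t)" using A_pos by (simp add: exp_diff)
    moreover have "\<forall>\<^sub>F n in sequentially. tail_sum (m n) (\<alpha> n) * exp (w n) * \<alpha> n powr \<rho> / w n powr (\<rho> - 1) * exp (- w n - \<rho> * ln (\<alpha> n) + (\<rho> - 1) * ln (w n)) = tail_sum (m n) (\<alpha> n)"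
      using w_ge1
    proof eventually_elim
      case (elim n)
      have p1: "\<alpha> n powr \<rho> = exp (\<rho> * ln (\<alpha> n))" using \<alpha>(1)[of n] by (simp add: powr_def)
      have p2: "w n powr (\<rho> - 1) = exp ((\<rho> - 1) * ln (w n))" using elim by (simp add: powr_def)
      have "exp (w n) * exp (\<rho> * ln (\<alpha> n)) * exp (- w n - \<rho> * ln (\<alpha> n) + (\<rho> - 1) * ln (w n)) = exp ((\<rho> - 1) * ln (w n))"
        unfolding exp_add[symmetric] by simp
      then show ?case unfolding p1 p2 by (simp add: field_simps)
    qed
    ultimately show ?thesis by (simp add: Lim_transform_eventually)
  qed
  have diff_eq: "(\<lambda>k. b k - head_weights b m k) = tail_weights m" for m
    by (rule ext) (rule head_tail)
  have cb: "\<forall>\<^sub>F n in sequentially. \<forall>k\<ge>1. real k \<le> 1 / \<alpha> n \<longrightarrow> head_weights b (m n) k = b k"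
    using w_ge1
  proof eventually_elim
    case (elim n)
    have "1 / \<alpha> n \<le> real (m n)" using elim \<alpha>(1)[of n] by (simp add: w_def divide_le_eq mult.commute)
    then show ?case by (auto simp: head_weights_def)
  qed
  \<comment> \<open>Moments at \<mu> \<alpha> have the same order as at \<alpha>, the limit changing
    by a power of \<mu>; this controls the second factor in \<open>tail_moment_le\<close>.\<close>
  have scaled: "(\<lambda>n. \<alpha> n powr (\<rho> + real q) * moment b q (\<mu> * \<alpha> n)) \<longlonglongrightarrow> \<mu> powr (- (\<rho> + real q)) * (A * Gamma (\<rho> + real q) * zeta_real (\<rho> + 1))"
    if "q \<ge> 1" "\<mu> > 0" for q \<mu>
  proof -
    have "filterlim (\<lambda>n. \<mu> * \<alpha> n) (at_right 0) sequentially"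
      unfolding filterlim_at using tendsto_mult_right_zero[OF \<alpha>_lim, of \<mu>] \<alpha>(1) that
      by (auto intro!: always_eventually simp: less_imp_neq[symmetric])
    from tendsto_mult_left[OF filterlim_compose[OF moment_asymptotic[OF that(1)] this], of "\<mu> powr (- (\<rho> + real q))"]
    have "(\<lambda>n. \<mu> powr (- (\<rho> + real q)) * ((\<mu> * \<alpha> n) powr (\<rho> + real q) * moment b q (\<mu> * \<alpha> n))) \<longlonglongrightarrow> \<mu> powr (- (\<rho> + real q)) * (A * Gamma (\<rho> + real q) * zeta_real (\<rho> + 1))" .
    moreover have "\<mu> powr (- (\<rho> + real q)) * ((\<mu> * \<alpha> n) powr (\<rho> + real q) * moment b q (\<mu> * \<alpha> n)) = \<alpha> n powr (\<rho> + real q) * moment b q (\<mu> * \<alpha> n)" for n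
    proof -
      have "\<mu> powr (- (\<rho> + real q)) * (\<mu> * \<alpha> n) powr (\<rho> + real q) = (\<mu> powr (- (\<rho> + real q)) * \<mu> powr (\<rho> + real q)) * \<alpha> n powr (\<rho> + real q)"
        by (simp add: powr_mult)
      also have "\<mu> powr (- (\<rho> + real q)) * \<mu> powr (\<rho> + real q) = 1" using that by (simp add: powr_add[symmetric])
      finally show ?thesis by (simp add: mult.assoc[symmetric])
    qed
    ultimately show ?thesis by (simp only:)
  qed
  have d1: "(\<lambda>n. \<alpha> n powr (1 + \<rho> / 2) * moment (\<lambda>k. b k - head_weights b (m n) k) 1 (\<alpha> n)) \<longlonglongrightarrow> 0"
    unfolding diff_eq
  proof (rule Lim_null_comparison)
    show "\<forall>\<^sub>F n in sequentially. norm (\<alpha> n powr (1 + \<rho> / 2) * moment (tail_weights (m n)) 1 (\<alpha> n)) \<le>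
        exp (- (3 / 4 * w n + \<rho> / 2 * ln (\<alpha> n))) * (\<alpha> n powr (\<rho> + real 1) * moment b 1 (1 / 4 * \<alpha> n))"
    proof (intro always_eventually allI)
      fix n
      \<comment> \<open>With \<mu> = 1/4 the bound is \<open>exp (- (3 / 4 * w))\<close>
        \<alpha>^(-\<rho>/2) times a bounded factor. Since w is about \<rho> |ln \<alpha>|, this is
        \<alpha>^(\<rho>/4) up to logarithms.\<close>
      have "\<alpha> n powr (1 + \<rho> / 2) * moment (tail_weights (m n)) 1 (\<alpha> n) \<le> \<alpha> n powr (1 + \<rho> / 2) * (exp (- (3 / 4 * w n)) * moment b 1 (1 / 4 * \<alpha> n))"
        using tail_moment_le[of 1 "\<alpha> n" "1 / 4" "m n"] \<alpha>(1)[of n] by (intro mult_left_mono) (auto simp: w_def)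
      also have "\<dots> = exp (- (3 / 4 * w n + \<rho> / 2 * ln (\<alpha> n))) * (\<alpha> n powr (\<rho> + real 1) * moment b 1 (1 / 4 * \<alpha> n))"
      proof -
        have "\<alpha> n powr (1 + \<rho> / 2) * exp (- (3 / 4 * w n)) = exp (- (3 / 4 * w n + \<rho> / 2 * ln (\<alpha> n))) * \<alpha> n powr (\<rho> + real 1)"
          using \<alpha>(1)[of n] unfolding powr_def by (simp add: exp_add[symmetric] algebra_simps)
        then show ?thesis by (simp only: mult.assoc[symmetric])
      qed
      finally have "\<alpha> n powr (1 + \<rho> / 2) * moment (tail_weights (m n)) 1 (\<alpha> n) \<le>
        exp (- (3 / 4 * w n + \<rho> / 2 * ln (\<alpha> n))) * (\<alpha> n powr (\<rho> + real 1) * moment b 1 (1 / 4 * \<alpha> n))" .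
      moreover have "0 \<le> \<alpha> n powr (1 + \<rho> / 2) * moment (tail_weights (m n)) 1 (\<alpha> n)"
        using subweight_moment(1)[OF subweight_tail, of 1 "\<alpha> n" "m n"] \<alpha>(1)[of n] by (intro mult_nonneg_nonneg) auto
      ultimately show "norm (\<alpha> n powr (1 + \<rho> / 2) * moment (tail_weights (m n)) 1 (\<alpha> n)) \<le>
        exp (- (3 / 4 * w n + \<rho> / 2 * ln (\<alpha> n))) * (\<alpha> n powr (\<rho> + real 1) * moment b 1 (1 / 4 * \<alpha> n))"
        by (simp only: real_norm_def abs_of_nonneg)
    qed
    have "filterlim (\<lambda>n. (3 / 4 * (w n - Y (a n)) + \<rho> / 2 * ln (R n)) + (3 / 4 * Y (a n) + \<rho> / 2 * ln (a n))) at_top sequentially"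
      by (rule filterlim_tendsto_add_at_top[OF tendsto_add[OF tendsto_mult_left[OF wY] tendsto_mult_left[OF lnR]] Y_top2])
    moreover have "\<forall>\<^sub>F n in sequentially. (3 / 4 * (w n - Y (a n)) + \<rho> / 2 * ln (R n)) + (3 / 4 * Y (a n) + \<rho> / 2 * ln (a n)) = 3 / 4 * w n + \<rho> / 2 * ln (\<alpha> n)"
      using eventually_ge_at_top[of 1]
    proof eventually_elim
      case (elim n)
      have "ln (R n) = ln (\<alpha> n) - ln (a n)" unfolding R_def using a_pos[OF elim] \<alpha>(1)[of n] by (simp add: ln_div)
      then show ?case by (simp only:) (simp add: field_simps)
    qed
    ultimately have "filterlim (\<lambda>n. 3 / 4 * w n + \<rho> / 2 * ln (\<alpha> n)) at_top sequentially"
      by (rule filterlim_mono_eventually[OF _ order_refl order_refl])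
    then have "(\<lambda>n. exp (- (3 / 4 * w n + \<rho> / 2 * ln (\<alpha> n)))) \<longlonglongrightarrow> 0"
      by (intro filterlim_compose[OF exp_at_bot] filterlim_compose[OF filterlim_uminus_at_bot_at_top])
    from tendsto_mult[OF this scaled[of 1 "1 / 4"]]
    show "(\<lambda>n. exp (- (3 / 4 * w n + \<rho> / 2 * ln (\<alpha> n))) * (\<alpha> n powr (\<rho> + real 1) * moment b 1 (1 / 4 * \<alpha> n))) \<longlonglongrightarrow> 0" by simp
  qed
  have expw: "(\<lambda>n. exp (- (x * w n))) \<longlonglongrightarrow> 0" if "x > 0" for x
    using filterlim_tendsto_pos_mult_at_top[OF tendsto_const that w_top]
    by (intro filterlim_compose[OF exp_at_bot] filterlim_compose[OF filterlim_uminus_at_bot_at_top])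
  have d2: "(\<lambda>n. \<alpha> n powr (2 + \<rho>) * moment (\<lambda>k. b k - head_weights b (m n) k) 2 (\<alpha> n)) \<longlonglongrightarrow> 0"
    unfolding diff_eq
  proof (rule Lim_null_comparison)
    show "\<forall>\<^sub>F n in sequentially. norm (\<alpha> n powr (2 + \<rho>) * moment (tail_weights (m n)) 2 (\<alpha> n)) \<le>
        exp (- (1 / 2 * w n)) * (\<alpha> n powr (\<rho> + real 2) * moment b 2 (1 / 2 * \<alpha> n))"
    proof (intro always_eventually allI)
      fix n
      \<comment> \<open>For the variance the normalisation already matches the second moment of b,
        so any fixed \<mu> strictly between 0 and 1 leaves a factor tending to 0; here it is
        1/2.\<close>
      have "\<alpha> n powr (2 + \<rho>) * moment (tail_weights (m n)) 2 (\<alpha> n) \<le> \<alpha> n powr (2 + \<rho>) * (exp (- (1 / 2 * w n)) * moment b 2 (1 / 2 * \<alpha> n))"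
        using tail_moment_le[of 2 "\<alpha> n" "1 / 2" "m n"] \<alpha>(1)[of n] by (intro mult_left_mono) (auto simp: w_def)
      also have "\<dots> = exp (- (1 / 2 * w n)) * (\<alpha> n powr (\<rho> + real 2) * moment b 2 (1 / 2 * \<alpha> n))"
        by (simp add: mult_ac add.commute)
      finally have "\<alpha> n powr (2 + \<rho>) * moment (tail_weights (m n)) 2 (\<alpha> n) \<le>
        exp (- (1 / 2 * w n)) * (\<alpha> n powr (\<rho> + real 2) * moment b 2 (1 / 2 * \<alpha> n))" .
      moreover have "0 \<le> \<alpha> n powr (2 + \<rho>) * moment (tail_weights (m n)) 2 (\<alpha> n)"
        using subweight_moment(1)[OF subweight_tail, of 2 "\<alpha> n" "m n"] \<alpha>(1)[of n] by (intro mult_nonneg_nonneg) auto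
      ultimately show "norm (\<alpha> n powr (2 + \<rho>) * moment (tail_weights (m n)) 2 (\<alpha> n)) \<le>
        exp (- (1 / 2 * w n)) * (\<alpha> n powr (\<rho> + real 2) * moment b 2 (1 / 2 * \<alpha> n))"
        by (simp only: real_norm_def abs_of_nonneg)
    qed
    from tendsto_mult[OF expw[of "1 / 2"] scaled[of 2 "1 / 2"]]
    show "(\<lambda>n. exp (- (1 / 2 * w n)) * (\<alpha> n powr (\<rho> + real 2) * moment b 2 (1 / 2 * \<alpha> n))) \<longlonglongrightarrow> 0" by simp
  qed
  obtain \<epsilon> C2 where eps: "\<epsilon> > 0" "C2 > 0" and M3': "\<forall>\<^sub>F \<alpha> in at_right 0. \<forall>\<theta>. \<alpha> < \<bar>\<theta>\<bar> \<longrightarrow> \<bar>\<theta>\<bar> \<le> pi \<longrightarrow> cos_defect b \<alpha> \<theta> \<ge> C2 * \<alpha> powr (- \<epsilon>)"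
    using meinardus_M3_cos_defect[OF M3] by blast
  define e where "e n = \<alpha> n powr (1 + \<rho> / 2)" for n
  define I where "I c n = (\<integral>v. indicator {- pi / e n..pi / e n} v *\<^sub>R char_ratio c (\<alpha> n) n (v * e n) \<partial>lborel)" for c n
  define L where "L = (\<integral>v. exp (complex_of_real (- (var_const / 2 * v\<^sup>2))) \<partial>lborel)"
  have e_pos: "e n > 0" for n using \<alpha>(1)[of n] by (simp add: e_def)
  have I1: "(\<lambda>n. I (head_weights b (m n)) n) \<longlonglongrightarrow> L"
    unfolding I_def L_def e_def
  proof (rule local_limit_integral[OF \<alpha>(1) \<alpha>_lim \<alpha>(2) subweight_head cb _ d1 d2 eps M3'])
    have "\<forall>\<^sub>F n in sequentially. tail_sum (m n) (\<alpha> n) < exp (- t) + 1"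
      using tail by (rule order_tendstoD) simp
    then show "\<forall>\<^sub>F n in sequentially. laplace_sum (\<lambda>k. b k - head_weights b (m n) k) 0 (\<alpha> n) \<le> exp (- t) + 1"
      unfolding diff_eq laplace_tail by (auto elim: eventually_mono)
  qed
  have zero_moment: "moment (\<lambda>k. 0) q x = 0" for q x
    by (simp add: moment_def moment_term_def case_prod_unfold)
  \<comment> \<open>The same local limit for c = b: nothing is discarded, so the conditions on b - c
    hold with value 0.\<close>
  have I2: "(\<lambda>n. I b n) \<longlonglongrightarrow> L"
    unfolding I_def L_def e_def
    by (rule local_limit_integral[OF \<alpha>(1) \<alpha>_lim \<alpha>(2) subweight_self _ _ _ _ eps M3', where K = 0])
       (auto simp: zero_moment laplace_sum_def)
  have L_pos: "Re L > 0" unfolding L_def by (rule gaussian_integral_pos[OF var_const_pos])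
  define \<Lambda> where "\<Lambda> c n = Re (log_gf c (of_real (\<alpha> n)))" for c n
  have \<Lambda>_lim: "(\<lambda>n. \<Lambda> b n - \<Lambda> (head_weights b (m n)) n) \<longlonglongrightarrow> exp (- t)"
  proof (rule tendsto_sandwich)
    have "\<forall>\<^sub>F n in sequentially. exp (- (1 * w n)) < 1 / 2" using expw[of 1] by (rule order_tendstoD) auto
    then have q: "\<forall>\<^sub>F n in sequentially. exp (- (\<alpha> n * real (m n))) \<le> 1 / 2" by (auto simp: w_def elim: eventually_mono)
    show "\<forall>\<^sub>F n in sequentially. tail_sum (m n) (\<alpha> n) \<le> \<Lambda> b n - \<Lambda> (head_weights b (m n)) n"
      using q by eventually_elim (unfold \<Lambda>_def, rule log_gf_head_diff(1)[OF \<alpha>(1)])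
    show "\<forall>\<^sub>F n in sequentially. \<Lambda> b n - \<Lambda> (head_weights b (m n)) n \<le> (1 + 2 * exp (- (1 * w n))) * tail_sum (m n) (\<alpha> n)"
      using q by eventually_elim (unfold \<Lambda>_def w_def mult_1, rule log_gf_head_diff(2)[OF \<alpha>(1)])
    have "(\<lambda>n. (1 + 2 * exp (- (1 * w n))) * tail_sum (m n) (\<alpha> n)) \<longlonglongrightarrow> (1 + 2 * 0) * exp (- t)"
      by (intro tendsto_mult tendsto_add tendsto_const tail expw) auto
    then show "(\<lambda>n. (1 + 2 * exp (- (1 * w n))) * tail_sum (m n) (\<alpha> n)) \<longlonglongrightarrow> exp (- t)" by simp
  qed (rule tail)
  have wp: "weighted_partitions c n * exp (- (real n * \<alpha> n)) = exp (\<Lambda> c n) * (e n / (2 * pi)) * Re (I c n)" if "subweight c" for c n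
    unfolding \<Lambda>_def I_def by (rule weighted_partitions_integral[OF that \<alpha>(1) e_pos])
  \<comment> \<open>The factors \<open>e n / (2 * pi)\<close> and
    \<open>exp (- (real n * \<alpha> n))\<close> are common to both coefficients, so their quotient
    is this product, and the common limit L of the integrals cancels.\<close>
  have "(\<lambda>n. exp (- (\<Lambda> b n - \<Lambda> (head_weights b (m n)) n)) * (Re (I (head_weights b (m n)) n) / Re (I b n))) \<longlonglongrightarrow> exp (- exp (- t)) * (Re L / Re L)"
    using L_pos by (intro tendsto_mult tendsto_exp tendsto_minus \<Lambda>_lim tendsto_divide tendsto_Re I1 I2) auto
  then have lim: "(\<lambda>n. exp (- (\<Lambda> b n - \<Lambda> (head_weights b (m n)) n)) * (Re (I (head_weights b (m n)) n) / Re (I b n))) \<longlonglongrightarrow> exp (- exp (- t))"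
    using L_pos by simp
  have I2_pos: "\<forall>\<^sub>F n in sequentially. Re (I b n) > 0"
    using tendsto_Re[OF I2] L_pos by (rule order_tendstoD)
  have "\<forall>\<^sub>F n in sequentially. exp (- (\<Lambda> b n - \<Lambda> (head_weights b (m n)) n)) * (Re (I (head_weights b (m n)) n) / Re (I b n)) =
     \<P>(\<omega> in M n. scaling \<rho> A n * real (X n \<omega>) + \<rho> * ln (scaling \<rho> A n)
              - (\<rho> - 1) * ln \<bar>ln (scaling \<rho> A n)\<bar> - (\<rho> - 1) * ln \<rho> - ln A \<le> t)"
    using I2_pos w_ge1 Y_ge1 eventually_ge_at_top[of 1]
  proof eventually_elim
    case (elim n)
    have an: "a n > 0" using a_pos elim by simp
    \<comment> \<open>The identity for the law is stated for m \<ge> 1; w n \<ge> 1 excludes m n =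
      0.\<close>
    have "m n \<noteq> 0" using elim(2) unfolding w_def by (metis mult_zero_right not_one_le_zero of_nat_0)
    then have m1: "m n \<ge> 1" by simp
    have ev: "(scaling \<rho> A n * real x + \<rho> * ln (scaling \<rho> A n)
              - (\<rho> - 1) * ln \<bar>ln (scaling \<rho> A n)\<bar> - (\<rho> - 1) * ln \<rho> - ln A \<le> t) \<longleftrightarrow> x \<le> m n" for x
    proof -
      have "(scaling \<rho> A n * real x + \<rho> * ln (scaling \<rho> A n)
              - (\<rho> - 1) * ln \<bar>ln (scaling \<rho> A n)\<bar> - (\<rho> - 1) * ln \<rho> - ln A \<le> t) \<longleftrightarrow> a n * real x \<le> Y (a n)"
        unfolding a_def[symmetric] Y_def by (auto simp: algebra_simps)
      also have "\<dots> \<longleftrightarrow> real x \<le> Y (a n) / a n" using an by (simp add: field_simps)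
      also have "\<dots> \<longleftrightarrow> x \<le> m n"
      proof -
        have "Y (a n) / a n \<ge> 0" using elim an by simp
        then show ?thesis unfolding m_def by linarith
      qed
      finally show ?thesis .
    qed
    have pb: "weighted_partitions b n * exp (- (real n * \<alpha> n)) = exp (\<Lambda> b n) * (e n / (2 * pi)) * Re (I b n)"
      by (rule wp[OF subweight_self])
    have "exp (\<Lambda> b n) * (e n / (2 * pi)) * Re (I b n) > 0"
      using elim(1) e_pos[of n] by simp
    \<comment> \<open>Positivity of the coefficient for large n comes out of the same integral; it
      licenses the division by \<open>weighted_partitions b n\<close>.\<close>
    then have pb_pos: "weighted_partitions b n > 0"
      unfolding pb[symmetric] by (simp add: zero_less_mult_iff)
    have "weighted_partitions b n * \<P>(\<omega> in M n. X n \<omega> \<le> m n) = weighted_partitions (head_weights b (m n)) n"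
      by (rule largest_part_prob[OF model m1 elim(4)])
    then have "\<P>(\<omega> in M n. X n \<omega> \<le> m n) = (weighted_partitions (head_weights b (m n)) n * exp (- (real n * \<alpha> n))) / (weighted_partitions b n * exp (- (real n * \<alpha> n)))"
      using pb_pos by (simp add: field_simps)
    also have "\<dots> = (exp (\<Lambda> (head_weights b (m n)) n) * (e n / (2 * pi)) * Re (I (head_weights b (m n)) n)) / (exp (\<Lambda> b n) * (e n / (2 * pi)) * Re (I b n))"
      unfolding pb wp[OF subweight_head] ..
    also have "\<dots> = exp (- (\<Lambda> b n - \<Lambda> (head_weights b (m n)) n)) * (Re (I (head_weights b (m n)) n) / Re (I b n))"
      using e_pos[of n] by (simp add: exp_diff)
    finally show ?case unfolding ev by simp
  qed
  with lim show ?thesis by (rule Lim_transform_eventually)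
qed

end

theorem theorem1:
  fixes b :: "nat \<Rightarrow> real" and \<rho> A C0 :: real and D :: "complex \<Rightarrow> complex"
    and M :: "nat \<Rightarrow> 'a measure" and X :: "nat \<Rightarrow> 'a \<Rightarrow> nat" and t :: real
  assumes "\<And>k. k \<ge> 1 \<Longrightarrow> b k \<ge> 0"
    and "meinardus_M1 b \<rho> A C0 D"
    and "meinardus_M2 C0 D"
    and "meinardus_M3 b"
    and "largest_part_model b M X"
  shows "(\<lambda>n. \<P>(\<omega> in M n.
            scaling \<rho> A n * real (X n \<omega>) + \<rho> * ln (scaling \<rho> A n)
              - (\<rho> - 1) * ln \<bar>ln (scaling \<rho> A n)\<bar> - (\<rho> - 1) * ln \<rho> - ln A \<le> t))
         \<longlonglongrightarrow> exp (- exp (- t))"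
proof -
  interpret meinardus_dirichlet b \<rho> A C0 D
    by standard (use assms in auto)
  obtain \<delta> C where "0 < \<delta>" "\<delta> < \<rho>" "C \<ge> 0"
    "\<And>x. x > 0 \<Longrightarrow> \<bar>weight_sum b x - A / \<rho> * x powr \<rho>\<bar> \<le> C * x powr (\<rho> - \<delta>)"
    using weight_sum_power_saving by blast
  then interpret power_weights b \<rho> A \<delta> C
    by unfold_locales (use assms(1) rho_pos A_pos in auto)
  show ?thesis by (rule largest_part_limit[OF assms(4,5)])
qed

end
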